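(* (1) For every $T\in\mathcal{PM}$ there exists a unique $\eta_T\in\mathcal{A}_0(\mathbb{R})^*$ such that $\langle\eta_T,f\star h\rangle=\int_{\mathbb{R}}(Th)(t)f(-t)\,dt$ for all $f\in C_0(\mathbb{R})$ and $h\in H^1(\mathbb{R})$. (2) The map $T\mapsto\eta_T$ is an isometric isomorphism from $\mathcal{PM}$ onto $\mathcal{A}_0(\mathbb{R})^*$ which is a homeomorphism for the respective weak$^*$-topologies.
   Context: $H^1(\mathbb{R})=\{h\in L^1(\mathbb{R}):\widehat h(u)=0\ \forall u\le0\}$, $\widehat h(u)=\int h(t)e^{-itu}dt$; $\tau_sf(t)=f(t-s)$. $\mathcal{A}_0(\mathbb{R})$ is the set of $F\colon\mathbb{R}\to\mathbb{C}$ such that $F=\sum_k f_k\star h_k$ pointwise for some $(f_k)\subset C_0(\mathbb{R})$, $(h_k)\subset H^1(\mathbb{R})$ with $\sum_k\|f_k\|_\infty\|h_k\|_1<\infty$, with norm $\|F\|_{\mathcal{A}_0}$ the infimum of $\sum_k\|f_k\|_\infty\|h_k\|_1$ over such representations (a Banach space). $H^\infty(\mathbb{R})$ is the weak$^*$-closure of $H^1\cap L^\infty$ in $L^\infty(\mathbb{R})$, $Z_0=C_0(\mathbb{R})\cap H^\infty(\mathbb{R})$. $B(H^1(\mathbb{R}))$ is given the weak$^*$-topology from the isometric identification $B(H^1(\mathbb{R}))\simeq\big((C_0(\mathbb{R})/Z_0)\widehat\otimes H^1(\mathbb{R})\big)^*$, $\langle T,\dot f\otimes h\rangle=\int(Th)(t)f(-t)dt$.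 $\mathcal{PM}$ is the weak$^*$-closed linear span of $\{\tau_s|_{H^1(\mathbb{R})}:s\in\mathbb{R}\}$ in $B(H^1(\mathbb{R}))$, with the operator norm. *)

theory Defs
  imports "HOL-Analysis.Analysis"
begin

type_synonym rfun = "real \<Rightarrow> complex"
type_synonym rop = "rfun \<Rightarrow> rfun"

definition fourier :: "rfun \<Rightarrow> real \<Rightarrow> complex" where
  "fourier h u = (LINT t|lborel. h t * exp (- (\<i> * complex_of_real (t * u))))"

definition L1norm :: "rfun \<Rightarrow> real" where
  "L1norm h = (LINT t|lborel. norm (h t))"

definition supnorm :: "rfun \<Rightarrow> real" where
  "supnorm f = Sup (range (\<lambda>t. norm (f t)))"

definition C0 :: "rfun set" where
  "C0 = {f. continuous_on UNIV f \<and> (f \<longlongrightarrow> 0) at_infinity}"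

definition H1 :: "rfun set" where
  "H1 = {h. integrable lborel h \<and> (\<forall>u\<le>0. fourier h u = 0)}"

definition conv :: "rfun \<Rightarrow> rfun \<Rightarrow> rfun" (infixl "\<star>" 70) where
  "(f \<star> h) t = (LINT s|lborel. f (t - s) * h s)"

definition tau :: "real \<Rightarrow> rfun \<Rightarrow> rfun" where
  "tau s f = (\<lambda>t. f (t - s))"

definition aeeq :: "rfun \<Rightarrow> rfun \<Rightarrow> bool" where
  "aeeq g h \<longleftrightarrow> (AE t in lborel. g t = h t)"

definition A0_rep :: "rfun \<Rightarrow> (nat \<Rightarrow> rfun) \<Rightarrow> (nat \<Rightarrow> rfun) \<Rightarrow> bool" where
  "A0_rep F f h \<longleftrightarrow> (\<forall>k. f k \<in> C0 \<and> h k \<in> H1)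
      \<and> summable (\<lambda>k. supnorm (f k) * L1norm (h k))
      \<and> (\<forall>t. (\<lambda>k. (f k \<star> h k) t) sums F t)"

definition A0 :: "rfun set" where
  "A0 = {F. \<exists>f h. A0_rep F f h}"

definition A0norm :: "rfun \<Rightarrow> real" where
  "A0norm F = Inf {(\<Sum>k. supnorm (f k) * L1norm (h k)) | f h. A0_rep F f h}"

(* Dual space A_0(R)^*: bounded complex-linear functionals on A_0, normalised to be 0
   off A_0 so that equality of functionals is genuine equality. *)
definition A0dual :: "(rfun \<Rightarrow> complex) set" where
  "A0dual = {\<phi>. (\<forall>F\<in>A0. \<forall>G\<in>A0. \<phi> (\<lambda>t. F t + G t) = \<phi> F + \<phi> G)
      \<and> (\<forall>F\<in>A0. \<forall>c. \<phi> (\<lambda>t. c * F t) = c * \<phi> F)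
      \<and> (\<exists>C. \<forall>F\<in>A0. norm (\<phi> F) \<le> C * A0norm F)
      \<and> (\<forall>F. F \<notin> A0 \<longrightarrow> \<phi> F = 0)}"

definition dualnorm :: "(rfun \<Rightarrow> complex) \<Rightarrow> real" where
  "dualnorm \<phi> = Sup {norm (\<phi> F) | F. F \<in> A0 \<and> A0norm F \<le> 1}"

definition wstarA :: "(rfun \<Rightarrow> complex) topology" where
  "wstarA = subtopology
     (topology_generated_by {{\<phi>. \<phi> F \<in> U} | F U. F \<in> A0 \<and> open U}) A0dual"

definition Bop :: "rop set" where
  "Bop = {T. (\<forall>h\<in>H1. T h \<in> H1)
      \<and> (\<forall>g\<in>H1. \<forall>h\<in>H1. aeeq g h \<longrightarrow> aeeq (T g) (T h))
      \<and> (\<forall>g\<in>H1. \<forall>h\<in>H1. aeeq (T (\<lambda>t. g t + h t)) (\<lambda>t. T g t + T h t))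
      \<and> (\<forall>h\<in>H1. \<forall>c. aeeq (T (\<lambda>t. c * h t)) (\<lambda>t. c * T h t))
      \<and> (\<exists>C. \<forall>h\<in>H1. L1norm (T h) \<le> C * L1norm h)}"

definition op_eq :: "rop \<Rightarrow> rop \<Rightarrow> bool" where
  "op_eq T S \<longleftrightarrow> (\<forall>h\<in>H1. aeeq (T h) (S h))"

definition opnorm :: "rop \<Rightarrow> real" where
  "opnorm T = Sup {L1norm (T h) | h. h \<in> H1 \<and> L1norm h \<le> 1}"

(* elements of the predual (C_0/Z_0) \<otimes>^ H^1, given by absolutely summable series of
   elementary tensors, and their pairing with operators *)
definition predual_elt :: "(nat \<Rightarrow> rfun) \<times> (nat \<Rightarrow> rfun) \<Rightarrow> bool" where
  "predual_elt u \<longleftrightarrow> (\<forall>k. fst u k \<in> C0 \<and> snd u k \<in> H1)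
      \<and> summable (\<lambda>k. supnorm (fst u k) * L1norm (snd u k))"

definition wpair :: "rop \<Rightarrow> (nat \<Rightarrow> rfun) \<times> (nat \<Rightarrow> rfun) \<Rightarrow> complex" where
  "wpair T u = (\<Sum>k. LINT t|lborel. T (snd u k) t * fst u k (- t))"

definition wstarB :: "rop topology" where
  "wstarB = subtopology
     (topology_generated_by {{T. wpair T u \<in> U} | u U. predual_elt u \<and> open U}) Bop"

definition span_tau :: "rop set" where
  "span_tau = {(\<lambda>h t. \<Sum>i<n. c i * h (t - s i)) | (n::nat) (c::nat \<Rightarrow> complex) (s::nat \<Rightarrow> real). True}"

definition PM :: "rop set" where
  "PM = wstarB closure_of span_tau"

end

theory Submission
  imports Defs
begin

text \<open>
  An operator in \<open>PM\<close> kills every \<open>u = \<Sum> f\<^sub>k \<otimes> h\<^sub>k\<close> whose convolution sum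
  \<open>\<Sum> f\<^sub>k \<star> h\<^sub>k\<close> vanishes, because translations act on such a \<open>u\<close> as point evaluations of that
  sum; hence \<open>T\<close> descends to a functional on \<open>A0\<close>. Conversely an operator killing all these \<open>u\<close>
  agrees, on any finite set of predual elements, with a finite combination of point evaluations, so
  it lies in \<open>PM\<close>.

  For surjectivity one has to represent \<open>f \<mapsto> \<phi> (f \<star> h)\<close> by an element of \<open>H1\<close>. Neither the Riesz
  representation theorem nor the theorem of F. and M. Riesz is needed: for a Lipschitz bump \<open>k\<close> the
  functional \<open>f \<mapsto> \<phi> (f \<star> (k \<star> h)) = \<phi> ((f \<star> k) \<star> h)\<close> has the continuous density
  \<open>s \<mapsto> \<phi> (\<tau>\<^sub>s k \<star> h)\<close>, which is integrable because the functional is bounded. Since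
  \<open>k \<star> h \<rightarrow> h\<close> in \<open>L\<^sup>1\<close> as \<open>k\<close> shrinks, these densities converge in \<open>L\<^sup>1\<close>. Testing with functions
  whose spectrum lies in \<open>{..0}\<close>, for which \<open>f \<star> h = 0\<close>, shows that the limit is in \<open>H1\<close>.
\<close>

section \<open>Continuous functions, Hardy space and convolution\<close>

text \<open>Why finite sets suffice: elements of \<open>A0\<close> are genuine functions, so point
  evaluations separate them, and on a finite-dimensional space of functions every linear functional
  is a combination of point evaluations. Weak-star neighbourhoods constrain only finitely many
  pairings, so exact interpolation there gives membership in the closure. The predual is not formed
  as a quotient: its elements stay pairs of sequences, and what a quotient would supply becomes a
  statement about representations of the zero function. Operators act on functions rather than
  classes, so they are compared through pairings with \<open>C0\<close>, which see a function only
  up to null sets. These pairings also recover \<open>L1norm\<close>. The extremal test function,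
  the conjugate sign of the integrand, is discontinuous; \<open>cnj z / (norm z + d)\<close>
  replaces it continuously at the price of an error of at most \<open>d\<close> per point. This
  yields both the isometry and the integrability of the density in the surjectivity
  argument.\<close>

lemma C0_bounded:
  assumes "f \<in> C0" shows "bounded (range f)"
proof -
  have c: "continuous_on UNIV f" and l: "(f \<longlongrightarrow> 0) at_infinity"
    using assms by (auto simp: C0_def)
  obtain b where b: "\<And>x. b \<le> norm x \<Longrightarrow> dist (f x) 0 < 1"
    using tendstoD[OF l, of 1] by (auto simp: eventually_at_infinity)
  have "bounded (f ` {-b..b})"
    by (intro compact_imp_bounded compact_continuous_image continuous_on_subset[OF c]) auto
  moreover have "range f \<subseteq> f ` {-b..b} \<union> ball 0 1"
    using b by (force simp: dist_commute image_iff)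
  ultimately show ?thesis
    using bounded_subset bounded_Un bounded_ball by metis
qed

lemma norm_le_supnorm: "f \<in> C0 \<Longrightarrow> norm (f t) \<le> supnorm f"
  unfolding supnorm_def
  using C0_bounded[of f] by (intro cSup_upper) (auto simp: bounded_iff bdd_above_def)

lemma supnorm_le: "(\<And>t. norm (f t) \<le> B) \<Longrightarrow> supnorm f \<le> B"
  unfolding supnorm_def by (intro cSup_least) auto

lemma supnorm_nonneg: "f \<in> C0 \<Longrightarrow> 0 \<le> supnorm f"
  using norm_le_supnorm[of f 0] norm_ge_zero order_trans by blast

lemma C0_zero: "(\<lambda>t. 0) \<in> C0"
  by (auto simp: C0_def)

lemma C0_add: "f \<in> C0 \<Longrightarrow> g \<in> C0 \<Longrightarrow> (\<lambda>t. f t + g t) \<in> C0"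
  by (auto simp: C0_def intro!: continuous_intros tendsto_add_zero)

lemma C0_cmult: "f \<in> C0 \<Longrightarrow> (\<lambda>t. c * f t) \<in> C0"
  by (auto simp: C0_def intro!: continuous_intros tendsto_mult_right_zero)

lemma C0_diff: "f \<in> C0 \<Longrightarrow> g \<in> C0 \<Longrightarrow> (\<lambda>t. f t - g t) \<in> C0"
  using C0_add[OF _ C0_cmult[of g "-1"], of f] by simp

lemma C0_I:
  assumes "continuous_on UNIV f"
    and "\<And>e. e > 0 \<Longrightarrow> \<exists>R. \<forall>t. R \<le> \<bar>t\<bar> \<longrightarrow> norm (f t) < e"
  shows "f \<in> C0"
  using assms by (auto simp: C0_def tendsto_iff eventually_at_infinity)

lemma C0_small:
  assumes "f \<in> C0" "e > 0"
  obtains R where "R > 0" "\<And>t. R \<le> \<bar>t\<bar> \<Longrightarrow> norm (f t) < e"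
proof -
  obtain b where b: "\<And>x. b \<le> norm x \<Longrightarrow> dist (f x) 0 < e"
    using tendstoD[of f 0 at_infinity e] assms by (auto simp: eventually_at_infinity C0_def)
  show thesis
    by (rule that[of "max 1 b"]) (use b in auto)
qed

lemma C0_compact_support:
  assumes "continuous_on UNIV f" "\<And>t. R < \<bar>t\<bar> \<Longrightarrow> f t = 0"
  shows "f \<in> C0"
proof (rule C0_I[OF assms(1)])
  fix e :: real assume "e > 0"
  then show "\<exists>R. \<forall>t. R \<le> \<bar>t\<bar> \<longrightarrow> norm (f t) < e"
    using assms(2) by (intro exI[of _ "R + 1"]) auto
qed

lemma C0_measurable [measurable_dest]: "f \<in> C0 \<Longrightarrow> f \<in> borel_measurable borel"
  by (auto simp: C0_def intro: borel_measurable_continuous_onI)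

lemma H1_integrable: "h \<in> H1 \<Longrightarrow> integrable lborel h"
  by (simp add: H1_def)

lemma integrable_measurable_borel:
  fixes h :: rfun
  shows "integrable lborel h \<Longrightarrow> h \<in> borel_measurable borel"
  using borel_measurable_integrable by fastforce

lemma L1norm_nonneg: "0 \<le> L1norm h"
  by (simp add: L1norm_def)

lemma L1norm_cmult: "L1norm (\<lambda>t. c * h t) = norm c * L1norm h"
  by (simp add: L1norm_def norm_mult)

lemma L1norm_minus_commute: "L1norm (\<lambda>t. g t - h t) = L1norm (\<lambda>t. h t - g t)"
  by (simp add: L1norm_def norm_minus_commute)

lemma L1norm_triangle:
  assumes "integrable lborel g" "integrable lborel h"
  shows "L1norm (\<lambda>t. g t + h t) \<le> L1norm g + L1norm h"
proof -
  have "(LINT t|lborel. norm (g t + h t)) \<le> (LINT t|lborel. norm (g t) + norm (h t))"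
    using assms by (intro integral_mono) (auto intro: norm_triangle_ineq)
  with assms show ?thesis by (simp add: L1norm_def)
qed

lemma integrable_bounded_mult:
  fixes g h :: rfun
  assumes h: "integrable lborel h" and g: "g \<in> borel_measurable borel" and B: "\<And>t. norm (g t) \<le> B"
  shows "integrable lborel (\<lambda>t. g t * h t)"
proof (rule Bochner_Integration.integrable_bound)
  show "integrable lborel (\<lambda>t. B * norm (h t))" using h by auto
  show "(\<lambda>t. g t * h t) \<in> borel_measurable lborel"
    using g integrable_measurable_borel[OF h] by simp
  have "norm (g t * h t) \<le> norm (B * norm (h t))" for t
  proof -
    have "0 \<le> B" using B[of t] norm_ge_zero order_trans by blast
    then show ?thesis using B[of t] by (simp add: norm_mult mult_right_mono)
  qed
  then show "AE t in lborel. norm (g t * h t) \<le> norm (B * norm (h t))" by simp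
qed

lemma norm_integral_bounded_mult:
  fixes g h :: rfun
  assumes h: "integrable lborel h" and g: "g \<in> borel_measurable borel" and B: "\<And>t. norm (g t) \<le> B"
  shows "norm (LINT t|lborel. g t * h t) \<le> B * L1norm h"
proof -
  have "norm (LINT t|lborel. g t * h t) \<le> (LINT t|lborel. norm (g t * h t))"
    by simp
  also have "\<dots> \<le> (LINT t|lborel. B * norm (h t))"
    using integrable_bounded_mult[OF assms, THEN integrable_norm] h B
    by (intro integral_mono) (auto simp: norm_mult mult_right_mono)
  finally show ?thesis by (simp add: L1norm_def)
qed

lemma C0_reflect_measurable: "f \<in> C0 \<Longrightarrow> (\<lambda>s. f (t - s)) \<in> borel_measurable borel"
  by (rule measurable_compose[OF _ C0_measurable]) auto

lemma conv_integrable: "f \<in> C0 \<Longrightarrow> integrable lborel h \<Longrightarrow> integrable lborel (\<lambda>s. f (t - s) * h s)"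
  by (rule integrable_bounded_mult[of h _ "supnorm f"]) (auto intro: norm_le_supnorm C0_reflect_measurable)

lemma norm_conv_le: "f \<in> C0 \<Longrightarrow> integrable lborel h \<Longrightarrow> norm ((f \<star> h) t) \<le> supnorm f * L1norm h"
  unfolding conv_def by (rule norm_integral_bounded_mult) (auto intro: norm_le_supnorm C0_reflect_measurable)

lemma conv_add_left: "f \<in> C0 \<Longrightarrow> g \<in> C0 \<Longrightarrow> integrable lborel h \<Longrightarrow>
    (\<lambda>t. f t + g t) \<star> h = (\<lambda>t. (f \<star> h) t + (g \<star> h) t)"
  by (auto simp: conv_def fun_eq_iff distrib_right conv_integrable)

lemma conv_add_right: "f \<in> C0 \<Longrightarrow> integrable lborel g \<Longrightarrow> integrable lborel h \<Longrightarrow>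
    f \<star> (\<lambda>t. g t + h t) = (\<lambda>t. (f \<star> g) t + (f \<star> h) t)"
  by (auto simp: conv_def fun_eq_iff distrib_left conv_integrable)

lemma conv_cmult_left: "(\<lambda>t. c * f t) \<star> h = (\<lambda>t. c * (f \<star> h) t)"
  by (auto simp: conv_def fun_eq_iff mult.assoc)

lemma conv_cmult_right: "f \<star> (\<lambda>t. c * h t) = (\<lambda>t. c * (f \<star> h) t)"
  by (auto simp: conv_def fun_eq_iff mult.left_commute)

lemma conv_zero_left: "(\<lambda>t. 0) \<star> h = (\<lambda>t. 0)"
  by (auto simp: conv_def)

lemma conv_cong_AE:
  assumes "aeeq g h" "integrable lborel g" "integrable lborel h" "f \<in> C0"
  shows "f \<star> g = f \<star> h"
proof
  fix t
  have [measurable]: "g \<in> borel_measurable borel" "h \<in> borel_measurable borel" "f \<in> borel_measurable borel"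
    using assms by (auto intro: integrable_measurable_borel C0_measurable)
  show "(f \<star> g) t = (f \<star> h) t"
    unfolding conv_def using assms(1)
    by (intro integral_cong_AE) (auto simp: aeeq_def)
qed

lemma fourier_integrable: "integrable lborel h \<Longrightarrow>
    integrable lborel (\<lambda>t. h t * exp (- (\<i> * complex_of_real (t * u))))"
  using integrable_bounded_mult[of h "\<lambda>t. exp (- (\<i> * complex_of_real (t * u)))" 1]
  by (simp add: mult.commute)

lemma H1_add: "g \<in> H1 \<Longrightarrow> h \<in> H1 \<Longrightarrow> (\<lambda>t. g t + h t) \<in> H1"
  by (auto simp: H1_def fourier_def distrib_right fourier_integrable simp del: of_real_mult)

lemma H1_cmult: "h \<in> H1 \<Longrightarrow> (\<lambda>t. c * h t) \<in> H1"
  by (auto simp: H1_def fourier_def mult.assoc)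

lemma H1_zero: "(\<lambda>t. 0) \<in> H1"
  by (auto simp: H1_def fourier_def)

section \<open>Series of convolutions: operations on representations and the norm of
  \<open>A0\<close>\<close>

definition interleave :: "(nat \<Rightarrow> 'a) \<Rightarrow> (nat \<Rightarrow> 'a) \<Rightarrow> nat \<Rightarrow> 'a" where
  "interleave a b n = (if even n then a (n div 2) else b (n div 2))"

text \<open>Each series is padded with zeros at the positions of the other one; this keeps its sum,
  being a strictly increasing reindexing, and the padded series are added termwise.\<close>

lemma interleave_sums:
  fixes a b :: "nat \<Rightarrow> 'a::real_normed_vector"
  assumes "a sums x" "b sums y"
  shows "interleave a b sums (x + y)"
proof -
  have "(\<lambda>n. if even n then a (n div 2) else 0) sums x"
  proof (rule sums_mono_reindex[of "\<lambda>n. 2 * n", THEN iffD1])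
    show "(if even n then a (n div 2) else 0) = 0" if "n \<notin> range ((*) 2)" for n
      using that by (metis dvd_def rangeI)
  qed (use assms(1) in \<open>auto simp: strict_mono_def\<close>)
  moreover have "(\<lambda>n. if even n then 0 else b (n div 2)) sums y"
  proof (rule sums_mono_reindex[of "\<lambda>n. 2 * n + 1", THEN iffD1])
    show "(if even n then 0 else b (n div 2)) = 0" if "n \<notin> range (\<lambda>n. 2 * n + 1)" for n
      using that by (metis oddE rangeI)
  qed (use assms(2) in \<open>auto simp: strict_mono_def\<close>)
  ultimately have "(\<lambda>n. (if even n then a (n div 2) else 0) + (if even n then 0 else b (n div 2))) sums (x + y)"
    by (rule sums_add)
  then show ?thesis
    by (rule sums_cong[THEN iffD1, rotated]) (auto simp: interleave_def)
qed

lemma interleave_apply2: "(\<lambda>k. P (interleave a b k) (interleave c d k)) = interleave (\<lambda>k. P (a k) (c k)) (\<lambda>k. P (b k) (d k))"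
  by (auto simp: interleave_def fun_eq_iff)

lemma predual_elt_conv_summable:
  assumes "predual_elt (f, h)"
  shows "summable (\<lambda>k. (f k \<star> h k) t)"
proof (rule summable_comparison_test)
  show "summable (\<lambda>k. supnorm (f k) * L1norm (h k))"
    using assms by (auto simp: predual_elt_def)
  show "\<exists>N. \<forall>n\<ge>N. norm ((f n \<star> h n) t) \<le> supnorm (f n) * L1norm (h n)"
    using assms by (auto simp: predual_elt_def intro!: norm_conv_le H1_integrable)
qed

lemma A0_rep_iff: "A0_rep F f h \<longleftrightarrow> predual_elt (f, h) \<and> (\<forall>t. (\<lambda>k. (f k \<star> h k) t) sums F t)"
  by (auto simp: A0_rep_def predual_elt_def)

text \<open>The map from \<open>f \<otimes> h\<close> to \<open>f \<star> h\<close>, extended to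
  series: the quotient map of the predual onto \<open>A0\<close>. The value is meaningful under
  \<open>predual_elt u\<close>, where the series converges at every point.\<close>

definition predual_fun :: "(nat \<Rightarrow> rfun) \<times> (nat \<Rightarrow> rfun) \<Rightarrow> rfun" where
  "predual_fun u t = (\<Sum>k. (fst u k \<star> snd u k) t)"

lemma A0_rep_predual_fun: "predual_elt (f, h) \<Longrightarrow> A0_rep (predual_fun (f, h)) f h"
  by (auto simp: A0_rep_iff predual_fun_def intro: summable_sums predual_elt_conv_summable)

lemma A0_rep_imp_A0: "A0_rep F f h \<Longrightarrow> F \<in> A0"
  by (auto simp: A0_def)

lemma A0_rep_total_nonneg: "A0_rep F f h \<Longrightarrow> 0 \<le> (\<Sum>k. supnorm (f k) * L1norm (h k))"
  by (intro suminf_nonneg) (auto simp: A0_rep_iff predual_elt_def intro!: mult_nonneg_nonneg supnorm_nonneg L1norm_nonneg)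

lemma A0norm_le: "A0_rep F f h \<Longrightarrow> A0norm F \<le> (\<Sum>k. supnorm (f k) * L1norm (h k))"
  unfolding A0norm_def
  by (rule cInf_lower) (auto simp: bdd_below_def intro: A0_rep_total_nonneg)

lemma A0norm_greatest:
  assumes "F \<in> A0" "\<And>f h. A0_rep F f h \<Longrightarrow> B \<le> (\<Sum>k. supnorm (f k) * L1norm (h k))"
  shows "B \<le> A0norm F"
  unfolding A0norm_def using assms by (intro cInf_greatest) (auto simp: A0_def)

lemma A0norm_nonneg: "F \<in> A0 \<Longrightarrow> 0 \<le> A0norm F"
  by (rule A0norm_greatest) (auto intro: A0_rep_total_nonneg)

lemma A0_rep_add:
  assumes "A0_rep F f h" "A0_rep G f' h'"
  shows "A0_rep (\<lambda>t. F t + G t) (interleave f f') (interleave h h')"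
proof -
  have "summable (\<lambda>k. supnorm (interleave f f' k) * L1norm (interleave h h' k))"
    using assms interleave_sums[THEN sums_summable] 
    by (auto simp: interleave_apply2[of "\<lambda>x y. supnorm x * L1norm y"] A0_rep_def summable_sums_iff)
  moreover have "(\<lambda>k. (interleave f f' k \<star> interleave h h' k) t) sums (F t + G t)" for t
    using assms by (auto simp: interleave_apply2[of "\<lambda>x y. (x \<star> y) t"] A0_rep_def intro: interleave_sums)
  ultimately show ?thesis
    using assms by (auto simp: A0_rep_def interleave_def)
qed

lemma A0_rep_cmult:
  assumes "A0_rep F f h"
  shows "A0_rep (\<lambda>t. c * F t) (\<lambda>k t. c * f k t) h"
proof -
  have fC: "f k \<in> C0" for k using assms by (auto simp: A0_rep_def)
  have "summable (\<lambda>k. supnorm (\<lambda>t. c * f k t) * L1norm (h k))"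
  proof (rule summable_comparison_test)
    show "summable (\<lambda>k. norm c * (supnorm (f k) * L1norm (h k)))"
      using assms by (auto simp: A0_rep_def intro: summable_mult)
    have "supnorm (\<lambda>t. c * f k t) \<le> norm c * supnorm (f k)" for k
      by (rule supnorm_le) (auto simp: norm_mult intro!: mult_left_mono norm_le_supnorm fC)
    then have "norm (supnorm (\<lambda>t. c * f k t) * L1norm (h k)) \<le> norm c * (supnorm (f k) * L1norm (h k))" for k
      using supnorm_nonneg[OF C0_cmult[OF fC[of k], of c]] L1norm_nonneg[of "h k"]
      by (simp add: abs_mult mult_right_mono flip: mult.assoc)
    then show "\<exists>N. \<forall>k\<ge>N. norm (supnorm (\<lambda>t. c * f k t) * L1norm (h k)) \<le> norm c * (supnorm (f k) * L1norm (h k))"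
      by blast
  qed
  then show ?thesis
    using assms by (auto simp: A0_rep_def conv_cmult_left intro: C0_cmult sums_mult)
qed

lemma A0_rep_conv:
  assumes "f \<in> C0" "h \<in> H1"
  shows "A0_rep (f \<star> h) (\<lambda>k. if k = 0 then f else (\<lambda>t. 0)) (\<lambda>k. h)"
    and "(\<Sum>k. supnorm (if k = 0 then f else (\<lambda>t. 0)) * L1norm h) = supnorm f * L1norm h"
proof -
  have z: "supnorm (\<lambda>t. 0) = 0" by (simp add: supnorm_def)
  have "(\<lambda>k. if k = 0 then supnorm f * L1norm h else 0) sums (supnorm f * L1norm h)"
    by (rule sums_single)
  then have s: "(\<lambda>k. supnorm (if k = (0::nat) then f else (\<lambda>t. 0)) * L1norm h) sums (supnorm f * L1norm h)"
    by (rule sums_cong[THEN iffD1, rotated]) (auto simp: z)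
  then show "(\<Sum>k. supnorm (if k = (0::nat) then f else (\<lambda>t. 0)) * L1norm h) = supnorm f * L1norm h"
    by (simp add: sums_iff)
  have "(\<lambda>k. ((if k = (0::nat) then f else (\<lambda>t. 0)) \<star> h) t) sums (f \<star> h) t" for t
    using sums_single[of 0 "\<lambda>_. (f \<star> h) t"]
    by (rule sums_cong[THEN iffD1, rotated]) (auto simp: conv_zero_left)
  then show "A0_rep (f \<star> h) (\<lambda>k. if k = 0 then f else (\<lambda>t. 0)) (\<lambda>k. h)"
    using assms s by (auto simp: A0_rep_def sums_iff C0_zero)
qed

lemma conv_in_A0: "f \<in> C0 \<Longrightarrow> h \<in> H1 \<Longrightarrow> f \<star> h \<in> A0"
  using A0_rep_conv(1) A0_rep_imp_A0 by blast

lemma A0norm_conv_le: "f \<in> C0 \<Longrightarrow> h \<in> H1 \<Longrightarrow> A0norm (f \<star> h) \<le> supnorm f * L1norm h"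
  using A0norm_le[OF A0_rep_conv(1)] A0_rep_conv(2) by metis

lemma A0_add: "F \<in> A0 \<Longrightarrow> G \<in> A0 \<Longrightarrow> (\<lambda>t. F t + G t) \<in> A0"
  unfolding A0_def by (blast intro: A0_rep_add)

lemma A0_cmult: "F \<in> A0 \<Longrightarrow> (\<lambda>t. c * F t) \<in> A0"
  unfolding A0_def by (blast intro: A0_rep_cmult)

section \<open>Bounded functionals on \<open>A0\<close>\<close>

lemma A0dual_bound:
  assumes "\<phi> \<in> A0dual"
  obtains C where "C \<ge> 0" "\<And>F. F \<in> A0 \<Longrightarrow> norm (\<phi> F) \<le> C * A0norm F"
proof -
  obtain C where C: "\<And>F. F \<in> A0 \<Longrightarrow> norm (\<phi> F) \<le> C * A0norm F"
    using assms unfolding A0dual_def by blast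
  have "norm (\<phi> F) \<le> max C 0 * A0norm F" if "F \<in> A0" for F
    using C[OF that] A0norm_nonneg[OF that] by (meson max.cobounded1 mult_right_mono order_trans)
  then show thesis by (intro that[of "max C 0"]) auto
qed

lemma A0dual_add: "\<phi> \<in> A0dual \<Longrightarrow> F \<in> A0 \<Longrightarrow> G \<in> A0 \<Longrightarrow> \<phi> (\<lambda>t. F t + G t) = \<phi> F + \<phi> G"
  and A0dual_cmult: "\<phi> \<in> A0dual \<Longrightarrow> F \<in> A0 \<Longrightarrow> \<phi> (\<lambda>t. c * F t) = c * \<phi> F"
  and A0dual_outside: "\<phi> \<in> A0dual \<Longrightarrow> F \<notin> A0 \<Longrightarrow> \<phi> F = 0"
  by (auto simp: A0dual_def)

text \<open>Together with \<open>A0norm_le\<close> this bounds the remainder of the series in the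
  norm of \<open>A0\<close>, not just pointwise.\<close>

lemma A0_rep_tail:
  assumes "A0_rep F f h"
  shows "A0_rep (\<lambda>t. F t - (\<Sum>k<n. (f k \<star> h k) t)) (\<lambda>k. f (k + n)) (\<lambda>k. h (k + n))"
proof -
  have "summable (\<lambda>k. supnorm (f (k + n)) * L1norm (h (k + n)))"
    using assms summable_iff_shift[of "\<lambda>k. supnorm (f k) * L1norm (h k)" n] by (simp add: A0_rep_def)
  moreover have "(\<lambda>k. (f (k + n) \<star> h (k + n)) t) sums (F t - (\<Sum>k<n. (f k \<star> h k) t))" for t
    using assms sums_iff_shift[of "\<lambda>k. (f k \<star> h k) t" n] by (simp add: A0_rep_def)
  ultimately show ?thesis using assms by (simp add: A0_rep_def)
qed

text \<open>Additivity only covers finite sums. The remainder \<open>R n\<close> has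
  \<open>A0norm\<close> at most a tail of the summable series of norms, so boundedness of
  \<open>\<phi>\<close> sends \<open>\<phi> (R n)\<close> to 0.\<close>

lemma A0dual_rep_sums:
  assumes \<phi>: "\<phi> \<in> A0dual" and r: "A0_rep F f h"
  shows "(\<lambda>k. \<phi> (f k \<star> h k)) sums \<phi> F"
proof -
  obtain C where C: "C \<ge> 0" "\<And>F. F \<in> A0 \<Longrightarrow> norm (\<phi> F) \<le> C * A0norm F"
    using A0dual_bound[OF \<phi>] by blast
  define R where "R n t = F t - (\<Sum>k<n. (f k \<star> h k) t)" for n t
  have R: "A0_rep (R n) (\<lambda>k. f (k + n)) (\<lambda>k. h (k + n))" for n
    unfolding R_def by (rule A0_rep_tail[OF r])
  have fh: "f k \<star> h k \<in> A0" for k using r by (auto simp: A0_rep_def intro: conv_in_A0)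
  have eq: "\<phi> F = (\<Sum>k<n. \<phi> (f k \<star> h k)) + \<phi> (R n)" for n
  proof (induction n)
    case 0 then show ?case by (simp add: R_def[abs_def])
  next
    case (Suc n)
    have "R n = (\<lambda>t. (f n \<star> h n) t + R (Suc n) t)" by (auto simp: R_def)
    then have "\<phi> (R n) = \<phi> (f n \<star> h n) + \<phi> (R (Suc n))"
      using A0dual_add[OF \<phi> fh A0_rep_imp_A0[OF R]] by metis
    with Suc show ?case by simp
  qed
  have sm: "summable (\<lambda>k. supnorm (f k) * L1norm (h k))" using r by (auto simp: A0_rep_def)
  have "(\<lambda>n. C * (\<Sum>k. supnorm (f (k + n)) * L1norm (h (k + n)))) \<longlonglongrightarrow> 0"
    using suminf_exist_split2[OF sm] by (intro tendsto_mult_right_zero)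
  moreover have "norm (\<phi> (R n)) \<le> C * (\<Sum>k. supnorm (f (k + n)) * L1norm (h (k + n)))" for n
    using C(2)[OF A0_rep_imp_A0[OF R]] A0norm_le[OF R] C(1) by (meson mult_left_mono order_trans)
  ultimately have "(\<lambda>n. \<phi> (R n)) \<longlonglongrightarrow> 0"
    by (rule Lim_null_comparison[OF always_eventually, OF allI, rotated])
  then have "(\<lambda>n. \<phi> F - \<phi> (R n)) \<longlonglongrightarrow> \<phi> F - 0" by (intro tendsto_intros)
  moreover have "\<phi> F - \<phi> (R n) = (\<Sum>k<n. \<phi> (f k \<star> h k))" for n using eq[of n] by simp
  ultimately show ?thesis by (simp add: sums_def)
qed

text \<open>Values on convolutions determine a functional on \<open>A0\<close> by termwise
  summation, and off \<open>A0\<close> both functionals are 0 by normalisation. This is the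
  uniqueness of \<open>\<eta>\<close> in the theorem.\<close>

lemma A0dual_eqI:
  assumes "\<phi> \<in> A0dual" "\<psi> \<in> A0dual" "\<And>f h. f \<in> C0 \<Longrightarrow> h \<in> H1 \<Longrightarrow> \<phi> (f \<star> h) = \<psi> (f \<star> h)"
  shows "\<phi> = \<psi>"
proof
  fix F
  show "\<phi> F = \<psi> F"
  proof (cases "F \<in> A0")
    case True
    then obtain f h where r: "A0_rep F f h" by (auto simp: A0_def)
    then have "\<phi> (f k \<star> h k) = \<psi> (f k \<star> h k)" for k using assms by (auto simp: A0_rep_def)
    then show ?thesis
      using A0dual_rep_sums[OF assms(1) r] A0dual_rep_sums[OF assms(2) r] sums_unique2 by auto
  qed (use assms A0dual_outside in metis)
qed

section \<open>Duality of integrable and continuous functions\<close>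

text \<open>A continuous truncation to modulus \<open>M\<close> that tends to the identity as
  \<open>M\<close> grows; applied to continuous approximants it makes them uniformly bounded and
  keeps them continuous.\<close>

lemma soft_clamp_bounds:
  fixes z :: complex
  assumes "M > 0"
  shows "norm (z /\<^sub>R (1 + norm z / M)) \<le> norm z" "norm (z /\<^sub>R (1 + norm z / M)) \<le> M"
proof -
  have p: "0 < 1 + norm z / M" using assms by (simp add: add_pos_nonneg)
  show "norm (z /\<^sub>R (1 + norm z / M)) \<le> norm z"
    using assms p by (simp add: field_simps)
  show "norm (z /\<^sub>R (1 + norm z / M)) \<le> M"
    using assms p by (simp add: field_simps)
qed

text \<open>Almost everywhere convergence of continuous functions provides no integrable majorant.
  So \<open>h\<close> is first replaced by its truncation in value and space at some level
  \<open>m\<close>; then, with \<open>m\<close> fixed, by equally truncated continuous functions,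
  which are bounded and live on one bounded interval.\<close>

lemma continuous_compact_support_dense_L1:
  assumes h: "integrable lborel h" and e: "e > 0"
  obtains g :: rfun and R where "continuous_on UNIV g" "R > 0" "\<And>t. R < \<bar>t\<bar> \<Longrightarrow> g t = 0"
    "integrable lborel g" "L1norm (\<lambda>t. h t - g t) < e"
proof -
  have hm [measurable]: "h \<in> borel_measurable borel" by (rule integrable_measurable_borel[OF h])
  \<comment> \<open>The detour through \<open>measurable_on\<close> is made for its definition,
    which supplies continuous functions converging to \<open>h\<close> off a negligible set.\<close>
  have "h \<in> borel_measurable (lebesgue_on UNIV)"
    using hm by (simp add: lebesgue_on_UNIV_eq measurable_completion)
  then have "h measurable_on UNIV"
    by (simp add: measurable_on_iff_borel_measurable)
  then obtain N g where N: "negligible N" and gc: "\<And>n. continuous_on UNIV (g n)"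
    and gl: "\<And>x. x \<notin> N \<Longrightarrow> (\<lambda>n. g n x) \<longlonglongrightarrow> h x"
    by (auto simp: measurable_on_def)
  have "AE x in lebesgue. x \<notin> N"
    using N by (simp add: AE_not_in negligible_iff_null_sets)
  then have ae: "AE x in lborel. (\<lambda>n. g n x) \<longlonglongrightarrow> h x"
    using gl by (auto simp: AE_completion_iff elim: eventually_mono)
  \<comment> \<open>\<open>p m\<close> clamps values to modulus \<open>Suc m\<close> and
    \<open>c m\<close> is a tent vanishing beyond \<open>Suc m\<close>; \<open>Suc\<close> keeps the
    denominators positive.\<close>
  define p where "p m z = z /\<^sub>R (1 + norm z / real (Suc m))" for m and z :: complex
  define c where "c m t = max 0 (1 - \<bar>t\<bar> / real (Suc m))" for m and t :: real
  have c01: "0 \<le> c m t" "c m t \<le> 1" for m t by (auto simp: c_def)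
  have c0: "c m t = 0" if "real (Suc m) < \<bar>t\<bar>" for m t using that by (auto simp: c_def field_simps)
  have p1: "norm (p m z) \<le> norm z" and p2: "norm (p m z) \<le> real (Suc m)" for m z
    unfolding p_def by (rule soft_clamp_bounds; simp)+
  have nz: "1 + cmod z / (1 + real m) \<noteq> 0" for z m
    by (metis add_cancel_left_right add_nonneg_eq_0_iff divide_nonneg_nonneg norm_ge_zero of_nat_0_le_iff zero_le_one zero_neq_one add_nonneg_nonneg)
  have cc [continuous_intros]: "continuous_on UNIV (c m)" for m
    unfolding c_def[abs_def] by (intro continuous_intros) auto
  have pc: "continuous_on UNIV (p m)" for m
    unfolding p_def[abs_def] by (intro continuous_intros) (auto simp: nz)
  have [measurable]: "c m \<in> borel_measurable borel" "p m \<in> borel_measurable borel" "g n \<in> borel_measurable borel" for m n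
    using cc pc gc by (auto intro: borel_measurable_continuous_onI)
  have "(\<lambda>m. LINT t|lborel. norm (h t - c m t *\<^sub>R p m (h t))) \<longlonglongrightarrow> (LINT t|(lborel::real measure). 0)"
  proof (rule integral_dominated_convergence[where w = "\<lambda>t. 2 * norm (h t)"])
    have "(\<lambda>m. norm (h t - c m t *\<^sub>R p m (h t))) \<longlonglongrightarrow> 0" for t
    proof -
      have r: "(\<lambda>m. a / real (Suc m)) \<longlonglongrightarrow> 0" for a
        by (rule LIMSEQ_Suc[OF lim_const_over_n])
      have "(\<lambda>m. c m t) \<longlonglongrightarrow> max 0 (1 - 0)"
        unfolding c_def by (intro tendsto_intros r)
      moreover have "(\<lambda>m. p m (h t)) \<longlonglongrightarrow> h t /\<^sub>R (1 + 0)"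
        unfolding p_def by (intro tendsto_intros r) auto
      ultimately have "(\<lambda>m. norm (h t - c m t *\<^sub>R p m (h t))) \<longlonglongrightarrow> norm (h t - max 0 (1 - 0) *\<^sub>R (h t /\<^sub>R (1 + 0)))"
        by (intro tendsto_intros)
      then show ?thesis by simp
    qed
    then show "AE t in lborel. (\<lambda>m. norm (h t - c m t *\<^sub>R p m (h t))) \<longlonglongrightarrow> 0" by simp
    have "norm (c m t *\<^sub>R p m (h t)) \<le> norm (h t)" for m t
      using mult_mono[OF c01(2)[of m t] p1[of m "h t"]] c01[of m t] by simp
    then have "norm (h t - c m t *\<^sub>R p m (h t)) \<le> norm (h t) + norm (h t)" for m t
      using norm_triangle_ineq4 add_left_mono order_trans by metis
    then show "AE t in lborel. norm (norm (h t - c m t *\<^sub>R p m (h t))) \<le> 2 * norm (h t)" for m by simp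
  qed (use h in auto)
  then have "eventually (\<lambda>m. (LINT t|lborel. norm (h t - c m t *\<^sub>R p m (h t))) < e / 2) sequentially"
    using e by (intro order_tendstoD(2)) auto
  then obtain m where m: "(LINT t|lborel. norm (h t - c m t *\<^sub>R p m (h t))) < e / 2"
    by (auto simp: eventually_sequentially)
  have "(\<lambda>n. LINT t|lborel. norm (c m t *\<^sub>R p m (h t) - c m t *\<^sub>R p m (g n t))) \<longlonglongrightarrow> (LINT t|(lborel::real measure). 0)"
  proof (rule integral_dominated_convergence[where w = "\<lambda>t. 2 * real (Suc m) * indicator {- real (Suc m)..real (Suc m)} t"])
    show "AE t in lborel. (\<lambda>n. norm (c m t *\<^sub>R p m (h t) - c m t *\<^sub>R p m (g n t))) \<longlonglongrightarrow> 0"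
      using ae
    proof eventually_elim
      case (elim t)
      have "(\<lambda>n. p m (g n t)) \<longlonglongrightarrow> p m (h t)"
        using continuous_on_tendsto_compose[OF pc elim] by simp
      then have "(\<lambda>n. norm (c m t *\<^sub>R p m (h t) - c m t *\<^sub>R p m (g n t))) \<longlonglongrightarrow> norm (c m t *\<^sub>R p m (h t) - c m t *\<^sub>R p m (h t))"
        by (intro tendsto_intros)
      then show ?case by simp
    qed
    have b: "norm (c m t *\<^sub>R p m z) \<le> real (Suc m)" for t z
      using mult_mono[OF c01(2)[of m t] p2[of m z]] c01[of m t] by simp
    have "norm (c m t *\<^sub>R p m (h t) - c m t *\<^sub>R p m (g n t)) \<le> 2 * real (Suc m) * indicator {- real (Suc m)..real (Suc m)} t" for t n
    proof (cases "\<bar>t\<bar> \<le> real (Suc m)")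
      case True
      then have ind: "indicator {- real (Suc m)..real (Suc m)} t = (1::real)" by (auto simp: indicator_def)
      show ?thesis
        unfolding ind mult_1_right mult_2 by (rule order_trans[OF norm_triangle_ineq4 add_mono[OF b b]])
    next
      case False
      then show ?thesis using c0[of m t] by simp
    qed
    then show "AE t in lborel. norm (norm (c m t *\<^sub>R p m (h t) - c m t *\<^sub>R p m (g n t))) \<le> 2 * real (Suc m) * indicator {- real (Suc m)..real (Suc m)} t" for n
      by simp
  qed auto
  then have "eventually (\<lambda>n. (LINT t|lborel. norm (c m t *\<^sub>R p m (h t) - c m t *\<^sub>R p m (g n t))) < e / 2) sequentially"
    using e by (intro order_tendstoD(2)) auto
  then obtain n where n: "(LINT t|lborel. norm (c m t *\<^sub>R p m (h t) - c m t *\<^sub>R p m (g n t))) < e / 2"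
    by (auto simp: eventually_sequentially)
  define q where "q t = c m t *\<^sub>R p m (g n t)" for t
  have qc: "continuous_on UNIV q"
    unfolding q_def using continuous_on_compose2[OF pc[of m] gc[of n]] by (intro continuous_intros) auto
  have ib: "integrable lborel (\<lambda>t. c m t *\<^sub>R p m (k t))" if [measurable]: "k \<in> borel_measurable borel" for k
  proof (rule Bochner_Integration.integrable_bound)
    show "integrable lborel (\<lambda>t. real (Suc m) * indicator {- real (Suc m)..real (Suc m)} t)" by simp
    have "norm (c m t *\<^sub>R p m (k t)) \<le> norm (real (Suc m) * indicator {- real (Suc m)..real (Suc m)} t)" for t
      using mult_mono[OF c01(2)[of m t] p2[of m "k t"]] c01[of m t] c0[of m t] by (auto simp: indicator_def abs_le_iff)
    then show "AE t in lborel. norm (c m t *\<^sub>R p m (k t)) \<le> norm (real (Suc m) * indicator {- real (Suc m)..real (Suc m)} t)"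
      by simp
  qed auto
  have i1: "integrable lborel q" unfolding q_def by (rule ib) simp
  have i2: "integrable lborel (\<lambda>t. c m t *\<^sub>R p m (h t))" by (rule ib) simp
  have "L1norm (\<lambda>t. h t - q t) \<le> L1norm (\<lambda>t. h t - c m t *\<^sub>R p m (h t)) + L1norm (\<lambda>t. c m t *\<^sub>R p m (h t) - q t)"
    using L1norm_triangle[of "\<lambda>t. h t - c m t *\<^sub>R p m (h t)" "\<lambda>t. c m t *\<^sub>R p m (h t) - q t"] h i1 i2 by simp
  also have "\<dots> < e" using m n by (simp add: L1norm_def q_def)
  finally have "L1norm (\<lambda>t. h t - q t) < e" .
  moreover have "q t = 0" if "real (Suc m) < \<bar>t\<bar>" for t using c0[OF that] by (simp add: q_def)
  ultimately show thesis using that[of q "real (Suc m)"] qc i1 by simp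
qed

text \<open>The regularised conjugate sign of \<open>z\<close>: multiplying \<open>z\<close> by it
  recovers \<open>norm z\<close> up to \<open>d\<close>, because
  \<open>(norm z - d) * (norm z + d)\<close> is a difference of squares.\<close>

lemma norm_sq_div_ge:
  fixes z :: complex
  assumes "d > 0"
  shows "norm z - d \<le> (norm z)\<^sup>2 / (norm z + d)" "norm (cnj z /\<^sub>R (norm z + d)) \<le> 1"
    "z * (cnj z /\<^sub>R (norm z + d)) = of_real ((norm z)\<^sup>2 / (norm z + d))"
proof -
  have p: "norm z + d > 0" using assms by (simp add: add_nonneg_pos)
  have "(norm z - d) * (norm z + d) \<le> (norm z)\<^sup>2"
    by (simp add: algebra_simps power2_eq_square)
  then show "norm z - d \<le> (norm z)\<^sup>2 / (norm z + d)" using p by (simp add: field_simps)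
  show "norm (cnj z /\<^sub>R (norm z + d)) \<le> 1" using p assms by (simp add: field_simps)
  show "z * (cnj z /\<^sub>R (norm z + d)) = of_real ((norm z)\<^sup>2 / (norm z + d))"
    by (simp add: scaleR_conv_of_real complex_norm_square divide_inverse del: of_real_power)
qed

text \<open>The claim reduces to a compactly supported continuous \<open>g\<close>, for which the
  regularised conjugate sign of \<open>g\<close> is itself an admissible test function.\<close>

lemma L1norm_le_pairing:
  assumes G: "integrable lborel G"
    and B: "\<And>f. f \<in> C0 \<Longrightarrow> (\<And>t. norm (f t) \<le> 1) \<Longrightarrow> norm (LINT t|lborel. f t * G t) \<le> B"
  shows "L1norm G \<le> B"
proof (rule field_le_epsilon)
  fix e' :: real assume "e' > 0"
  \<comment> \<open>One third each for the regularisation, for exchanging \<open>G\<close> and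
    \<open>g\<close> in the pairing, and for exchanging them in the norm.\<close>
  define e where "e = e' / 3"
  have e: "e > 0" using \<open>e' > 0\<close> by (simp add: e_def)
  obtain g R where g: "continuous_on UNIV g" "R > 0" "\<And>t. R < \<bar>t\<bar> \<Longrightarrow> g t = 0"
    "integrable lborel g" "L1norm (\<lambda>t. G t - g t) < e"
    using continuous_compact_support_dense_L1[OF G e] by metis
  \<comment> \<open>The support of \<open>g\<close> lies in an interval of length
    \<open>2 * R\<close>, so a pointwise loss of \<open>d\<close> integrates to
    \<open>e\<close>.\<close>
  define d where "d = e / (2 * R)"
  have d: "d > 0" using e g by (simp add: d_def)
  define f where "f t = cnj (g t) /\<^sub>R (norm (g t) + d)" for t
  have nz: "norm z + d \<noteq> 0" for z :: complex using d by (metis add_nonneg_pos norm_ge_zero less_irrefl)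
  have fc: "continuous_on UNIV f"
    unfolding f_def using g(1) by (intro continuous_intros) (auto simp: nz)
  have fC: "f \<in> C0" by (rule C0_compact_support[OF fc, of R]) (auto simp: f_def g)
  have f1: "norm (f t) \<le> 1" for t unfolding f_def by (rule norm_sq_div_ge[OF d])
  have fm: "f \<in> borel_measurable borel" using fC by (rule C0_measurable)
  have fgi: "integrable lborel (\<lambda>t. f t * g t)" by (rule integrable_bounded_mult[OF g(4) fm f1])
  have fg: "f t * g t = of_real ((norm (g t))\<^sup>2 / (norm (g t) + d))" for t
    unfolding f_def using norm_sq_div_ge(3)[OF d, of "g t"] by (simp add: mult.commute)
  have rfg: "integrable lborel (\<lambda>t. (norm (g t))\<^sup>2 / (norm (g t) + d))"
    using integrable_Re[OF fgi] by (simp add: fg)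
  have "L1norm g \<le> (LINT t|lborel. (norm (g t))\<^sup>2 / (norm (g t) + d) + d * indicator {-R..R} t)"
    unfolding L1norm_def
  proof (rule integral_mono)
    show "norm (g t) \<le> (norm (g t))\<^sup>2 / (norm (g t) + d) + d * indicator {-R..R} t" for t
      using norm_sq_div_ge(1)[OF d, of "g t"] g(3)[of t] by (cases "R < \<bar>t\<bar>") (auto simp: indicator_def)
  qed (use g rfg in auto)
  also have "\<dots> = (LINT t|lborel. (norm (g t))\<^sup>2 / (norm (g t) + d)) + e"
    using rfg g(2) by (simp add: d_def)
  also have "(LINT t|lborel. (norm (g t))\<^sup>2 / (norm (g t) + d)) = Re (LINT t|lborel. f t * g t)"
    using integral_Re[OF fgi] by (simp add: fg)
  also have "\<dots> \<le> norm (LINT t|lborel. f t * g t)" by (rule complex_Re_le_cmod)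
  also have "(LINT t|lborel. f t * g t) = (LINT t|lborel. f t * G t) - (LINT t|lborel. f t * (G t - g t))"
    using integrable_bounded_mult[OF G fm f1] fgi by (simp add: right_diff_distrib)
  also have "norm \<dots> \<le> norm (LINT t|lborel. f t * G t) + norm (LINT t|lborel. f t * (G t - g t))"
    by (rule norm_triangle_ineq4)
  also have "norm (LINT t|lborel. f t * (G t - g t)) \<le> 1 * L1norm (\<lambda>t. G t - g t)"
    by (rule norm_integral_bounded_mult) (use G g fm f1 in auto)
  also have "norm (LINT t|lborel. f t * G t) \<le> B" using B fC f1 by blast
  finally have "L1norm g \<le> B + 2 * e" using g(5) by simp
  moreover have "L1norm G \<le> L1norm g + L1norm (\<lambda>t. G t - g t)"
    using L1norm_triangle[OF g(4), of "\<lambda>t. G t - g t"] G g by simp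
  ultimately show "L1norm G \<le> B + e'" using g(5) by (simp add: e_def)
qed

lemma C0_reflect: "f \<in> C0 \<Longrightarrow> (\<lambda>t. f (- t)) \<in> C0"
proof (rule C0_I)
  assume f: "f \<in> C0"
  show "continuous_on UNIV (\<lambda>t. f (- t))"
    using f by (auto simp: C0_def intro!: continuous_on_compose2[of UNIV f] continuous_intros)
  fix e :: real assume "e > 0"
  then obtain R where "\<And>t. R \<le> \<bar>t\<bar> \<Longrightarrow> norm (f t) < e" using C0_small[OF f] by metis
  then show "\<exists>R. \<forall>t. R \<le> \<bar>t\<bar> \<longrightarrow> norm (f (- t)) < e" by (intro exI[of _ R]) auto
qed

lemma L1norm_le_reflected_pairing:
  assumes G: "integrable lborel G"
    and B: "\<And>f. f \<in> C0 \<Longrightarrow> (\<And>t. norm (f t) \<le> 1) \<Longrightarrow> norm (LINT t|lborel. G t * f (- t)) \<le> B"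
  shows "L1norm G \<le> B"
proof (rule L1norm_le_pairing[OF G])
  fix f assume "f \<in> C0" "\<And>t. norm (f t) \<le> 1"
  then show "norm (LINT t|lborel. f t * G t) \<le> B"
    using B[OF C0_reflect[of f]] by (simp add: mult.commute)
qed

lemma L1norm_eq_0_imp_AE:
  assumes "integrable lborel G" "L1norm G \<le> 0"
  shows "AE t in lborel. G t = 0"
proof -
  have "(LINT t|lborel. norm (G t)) = 0" using assms(2) L1norm_nonneg[of G] unfolding L1norm_def by linarith
  then have "AE t in lborel. norm (G t) = 0"
    using integral_nonneg_eq_0_iff_AE[of lborel "\<lambda>t. norm (G t)"] assms(1) by auto
  then show ?thesis by simp
qed

text \<open>Turns equality almost everywhere into equalities of numbers, so that identities between
  operators can be checked through functionals.\<close>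

lemma aeeq_iff_reflected_pairing:
  assumes g: "integrable lborel g" and h: "integrable lborel h"
  shows "aeeq g h \<longleftrightarrow> (\<forall>f\<in>C0. (LINT t|lborel. g t * f (- t)) = (LINT t|lborel. h t * f (- t)))"
proof
  assume *: "aeeq g h"
  show "\<forall>f\<in>C0. (LINT t|lborel. g t * f (- t)) = (LINT t|lborel. h t * f (- t))"
  proof
    fix f assume "f \<in> C0"
    have [measurable]: "g \<in> borel_measurable borel" "h \<in> borel_measurable borel" "(\<lambda>t. f (- t)) \<in> borel_measurable borel"
      using g h C0_measurable[OF C0_reflect[OF \<open>f \<in> C0\<close>]] by (auto intro: integrable_measurable_borel)
    show "(LINT t|lborel. g t * f (- t)) = (LINT t|lborel. h t * f (- t))"
      using * by (intro integral_cong_AE) (auto simp: aeeq_def)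
  qed
next
  assume *: "\<forall>f\<in>C0. (LINT t|lborel. g t * f (- t)) = (LINT t|lborel. h t * f (- t))"
  have "L1norm (\<lambda>t. g t - h t) \<le> 0"
  proof (rule L1norm_le_reflected_pairing)
    fix f assume f: "f \<in> C0"
    have "integrable lborel (\<lambda>t. g t * f (- t))" "integrable lborel (\<lambda>t. h t * f (- t))"
      using integrable_bounded_mult[OF g C0_measurable[OF C0_reflect[OF f]], of "supnorm f"]
        integrable_bounded_mult[OF h C0_measurable[OF C0_reflect[OF f]], of "supnorm f"] norm_le_supnorm[OF f]
      by (auto simp: mult.commute)
    then show "norm (LINT t|lborel. (g t - h t) * f (- t)) \<le> 0"
      using * f by (simp add: left_diff_distrib)
  qed (use g h in auto)
  then have "AE t in lborel. g t - h t = 0"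
    using g h by (intro L1norm_eq_0_imp_AE) auto
  then show "aeeq g h" by (auto simp: aeeq_def)
qed

section \<open>Operators and their action on the predual\<close>

abbreviation (input) op_pair :: "rop \<Rightarrow> rfun \<Rightarrow> rfun \<Rightarrow> complex" where
  "op_pair T h f \<equiv> (LINT t|lborel. T h t * f (- t))"

lemma Bop_H1: "T \<in> Bop \<Longrightarrow> h \<in> H1 \<Longrightarrow> T h \<in> H1"
  by (simp add: Bop_def)

lemma Bop_integrable: "T \<in> Bop \<Longrightarrow> h \<in> H1 \<Longrightarrow> integrable lborel (T h)"
  using Bop_H1 H1_integrable by blast

lemma Bop_bound:
  assumes "T \<in> Bop"
  obtains C where "C \<ge> 0" "\<And>h. h \<in> H1 \<Longrightarrow> L1norm (T h) \<le> C * L1norm h"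
proof -
  obtain C where C: "\<And>h. h \<in> H1 \<Longrightarrow> L1norm (T h) \<le> C * L1norm h"
    using assms unfolding Bop_def by blast
  have "L1norm (T h) \<le> max C 0 * L1norm h" if "h \<in> H1" for h
    using C[OF that] L1norm_nonneg[of h] by (meson max.cobounded1 mult_right_mono order_trans)
  then show thesis by (intro that[of "max C 0"]) auto
qed

lemma reflected_pairing_integrable:
  "integrable lborel g \<Longrightarrow> f \<in> C0 \<Longrightarrow> integrable lborel (\<lambda>t. g t * f (- t))"
  using integrable_bounded_mult[of g "\<lambda>t. f (- t)" "supnorm f"] C0_measurable[OF C0_reflect[of f]]
    norm_le_supnorm[of f] by (simp add: mult.commute)

lemma norm_reflected_pairing_le:
  "integrable lborel g \<Longrightarrow> f \<in> C0 \<Longrightarrow> norm (LINT t|lborel. g t * f (- t)) \<le> supnorm f * L1norm g"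
  using norm_integral_bounded_mult[of g "\<lambda>t. f (- t)" "supnorm f"] C0_measurable[OF C0_reflect[of f]]
    norm_le_supnorm[of f] by (simp add: mult.commute)

lemma norm_op_pair_le:
  assumes "T \<in> Bop" "C \<ge> 0" "\<And>h. h \<in> H1 \<Longrightarrow> L1norm (T h) \<le> C * L1norm h" "f \<in> C0" "h \<in> H1"
  shows "norm (op_pair T h f) \<le> C * (supnorm f * L1norm h)"
proof -
  have "norm (op_pair T h f) \<le> supnorm f * L1norm (T h)"
    using assms by (intro norm_reflected_pairing_le Bop_integrable)
  also have "\<dots> \<le> supnorm f * (C * L1norm h)"
    using assms by (intro mult_left_mono supnorm_nonneg) auto
  finally show ?thesis by (simp add: mult_ac)
qed

text \<open>\<open>wpair\<close> is a \<open>suminf\<close>, informative only for convergent series;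
  boundedness of \<open>T\<close> makes the series converge absolutely.\<close>

lemma wpair_sums_bound:
  assumes T: "T \<in> Bop" "C \<ge> 0" "\<And>h. h \<in> H1 \<Longrightarrow> L1norm (T h) \<le> C * L1norm h" and u: "predual_elt (f, h)"
  shows "(\<lambda>k. op_pair T (h k) (f k)) sums wpair T (f, h)"
    and "norm (wpair T (f, h)) \<le> C * (\<Sum>k. supnorm (f k) * L1norm (h k))"
proof -
  have sm: "summable (\<lambda>k. supnorm (f k) * L1norm (h k))" using u by (simp add: predual_elt_def)
  have b: "norm (op_pair T (h k) (f k)) \<le> C * (supnorm (f k) * L1norm (h k))" for k
    using norm_op_pair_le[OF T] u by (auto simp: predual_elt_def)
  have sn: "summable (\<lambda>k. norm (op_pair T (h k) (f k)))"
    by (rule summable_comparison_test[OF _ summable_mult[OF sm]]) (use b in auto)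
  then show "(\<lambda>k. op_pair T (h k) (f k)) sums wpair T (f, h)"
    by (auto simp: wpair_def intro: summable_sums summable_norm_cancel)
  have "norm (wpair T (f, h)) \<le> (\<Sum>k. norm (op_pair T (h k) (f k)))"
    using summable_norm[OF sn] by (simp add: wpair_def)
  also have "\<dots> \<le> (\<Sum>k. C * (supnorm (f k) * L1norm (h k)))"
    by (intro suminf_le b sn summable_mult sm)
  finally show "norm (wpair T (f, h)) \<le> C * (\<Sum>k. supnorm (f k) * L1norm (h k))"
    using suminf_mult[OF sm] by simp
qed

lemma wpair_sums:
  assumes "T \<in> Bop" "predual_elt (f, h)"
  shows "(\<lambda>k. op_pair T (h k) (f k)) sums wpair T (f, h)"
  using Bop_bound[OF assms(1)] wpair_sums_bound(1)[OF assms(1) _ _ assms(2)] by metis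

lemma wpair_interleave:
  assumes "T \<in> Bop" "predual_elt (f, h)" "predual_elt (f', h')" "predual_elt (interleave f f', interleave h h')"
  shows "wpair T (interleave f f', interleave h h') = wpair T (f, h) + wpair T (f', h')"
  using wpair_sums[OF assms(1,4)] interleave_sums[OF wpair_sums[OF assms(1,2)] wpair_sums[OF assms(1,3)]]
  by (simp add: interleave_apply2[of "\<lambda>x y. op_pair T y x"] sums_unique2)

lemma wpair_cmult:
  assumes "T \<in> Bop" "predual_elt (f, h)" "predual_elt (\<lambda>k t. c * f k t, h)"
  shows "wpair T (\<lambda>k t. c * f k t, h) = c * wpair T (f, h)"
proof -
  have "op_pair T (h k) (\<lambda>t. c * f k t) = c * op_pair T (h k) (f k)" for k
    by (simp add: mult.left_commute)
  then show ?thesis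
    using wpair_sums[OF assms(1,3)] sums_mult[OF wpair_sums[OF assms(1,2)], of c] by (simp add: sums_unique2)
qed

text \<open>The annihilator of the kernel of the quotient map from the predual onto
  \<open>A0\<close>. It links the two sides: \<open>PM\<close> turns out to be exactly this set, and
  \<open>A0dual\<close> its image under \<open>eta_op\<close>.\<close>

definition annihilates :: "rop \<Rightarrow> bool" where
  "annihilates T \<longleftrightarrow> T \<in> Bop \<and> (\<forall>f h. A0_rep (\<lambda>t. 0) f h \<longrightarrow> wpair T (f, h) = 0)"

lemma annihilates_Bop: "annihilates T \<Longrightarrow> T \<in> Bop"
  by (simp add: annihilates_def)

text \<open>Interleaving one representation of \<open>F\<close> with the negative of the other gives
  a representation of 0.\<close>

lemma wpair_rep_independent:
  assumes T: "annihilates T" and r: "A0_rep F f h" "A0_rep F f' h'"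
  shows "wpair T (f, h) = wpair T (f', h')"
proof -
  have m: "A0_rep (\<lambda>t. -1 * F t) (\<lambda>k t. -1 * f' k t) h'" by (rule A0_rep_cmult[OF r(2)])
  have "A0_rep (\<lambda>t. 0) (interleave f (\<lambda>k t. -1 * f' k t)) (interleave h h')"
    using A0_rep_add[OF r(1) m] by simp
  then have "wpair T (interleave f (\<lambda>k t. -1 * f' k t), interleave h h') = 0"
    "predual_elt (interleave f (\<lambda>k t. -1 * f' k t), interleave h h')"
    using T unfolding annihilates_def A0_rep_iff by blast+
  then show ?thesis
    using wpair_interleave[OF annihilates_Bop[OF T], of f h "\<lambda>k t. -1 * f' k t" h'] r m
      wpair_cmult[OF annihilates_Bop[OF T], of f' h' "-1"]
    by (simp add: A0_rep_iff)
qed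

text \<open>For annihilating \<open>T\<close> the chosen representation does not matter, by
  \<open>wpair_rep_independent\<close>; the value 0 off \<open>A0\<close> is the normalisation built
  into \<open>A0dual\<close>.\<close>

definition eta_op :: "rop \<Rightarrow> rfun \<Rightarrow> complex" where
  "eta_op T F = (if F \<in> A0 then wpair T (SOME u. A0_rep F (fst u) (snd u)) else 0)"

lemma eta_op_rep:
  assumes "annihilates T" "A0_rep F f h"
  shows "eta_op T F = wpair T (f, h)"
proof -
  define u where "u = (SOME u. A0_rep F (fst u) (snd u))"
  have "A0_rep F (fst u) (snd u)"
    unfolding u_def by (rule someI[of "\<lambda>u. A0_rep F (fst u) (snd u)" "(f, h)"]) (use assms in simp)
  then show ?thesis
    using wpair_rep_independent[OF assms(1) _ assms(2), of "fst u" "snd u"] A0_rep_imp_A0[OF assms(2)]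
    by (simp add: eta_op_def u_def)
qed

lemma eta_op_bound:
  assumes T: "annihilates T" and C: "C \<ge> 0" "\<And>h. h \<in> H1 \<Longrightarrow> L1norm (T h) \<le> C * L1norm h"
    and F: "F \<in> A0"
  shows "norm (eta_op T F) \<le> C * A0norm F"
\<comment> \<open>\<open>A0norm\<close> is an infimum, so the estimate is divided by
  \<open>C\<close> before being compared with every representation; for \<open>C = 0\<close> a
  single representation settles it.\<close>
proof (cases "C = 0")
  case True
  obtain f h where r: "A0_rep F f h" using F by (auto simp: A0_def)
  then show ?thesis
    using wpair_sums_bound(2)[OF annihilates_Bop[OF T] C, of f h] eta_op_rep[OF T r] True by (simp add: A0_rep_iff)
next
  case False
  have "norm (eta_op T F) / C \<le> A0norm F"
  proof (rule A0norm_greatest[OF F])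
    fix f h assume r: "A0_rep F f h"
    then have "norm (eta_op T F) \<le> C * (\<Sum>k. supnorm (f k) * L1norm (h k))"
      using wpair_sums_bound(2)[OF annihilates_Bop[OF T] C, of f h] eta_op_rep[OF T r] by (simp add: A0_rep_iff)
    then show "norm (eta_op T F) / C \<le> (\<Sum>k. supnorm (f k) * L1norm (h k))"
      using C(1) False by (simp add: field_simps)
  qed
  then show ?thesis using C(1) False by (simp add: field_simps)
qed

lemma eta_op_A0dual:
  assumes T: "annihilates T"
  shows "eta_op T \<in> A0dual"
proof -
  obtain C where C: "C \<ge> 0" "\<And>h. h \<in> H1 \<Longrightarrow> L1norm (T h) \<le> C * L1norm h"
    using Bop_bound[OF annihilates_Bop[OF T]] by metis
  have "eta_op T (\<lambda>t. F t + G t) = eta_op T F + eta_op T G" if FG: "F \<in> A0" "G \<in> A0" for F G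
  proof -
    obtain f h f' h' where r: "A0_rep F f h" "A0_rep G f' h'" using FG by (auto simp: A0_def)
    show ?thesis
      using eta_op_rep[OF T r(1)] eta_op_rep[OF T r(2)] eta_op_rep[OF T A0_rep_add[OF r]]
        wpair_interleave[OF annihilates_Bop[OF T]] r A0_rep_add[OF r] by (simp add: A0_rep_iff)
  qed
  moreover have "eta_op T (\<lambda>t. c * F t) = c * eta_op T F" if F: "F \<in> A0" for F c
  proof -
    obtain f h where r: "A0_rep F f h" using F by (auto simp: A0_def)
    show ?thesis
      using eta_op_rep[OF T r] eta_op_rep[OF T A0_rep_cmult[OF r, of c]]
        wpair_cmult[OF annihilates_Bop[OF T], of f h c] r A0_rep_cmult[OF r, of c] by (simp add: A0_rep_iff)
  qed
  moreover have "\<exists>C. \<forall>F\<in>A0. norm (eta_op T F) \<le> C * A0norm F"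
    using eta_op_bound[OF T C] by blast
  moreover have "eta_op T F = 0" if "F \<notin> A0" for F using that by (simp add: eta_op_def)
  ultimately show ?thesis unfolding A0dual_def by blast
qed

lemma eta_op_conv:
  assumes T: "annihilates T" and "f \<in> C0" "h \<in> H1"
  shows "eta_op T (f \<star> h) = op_pair T h f"
proof -
  have r: "A0_rep (f \<star> h) (\<lambda>k. if k = 0 then f else (\<lambda>t. 0)) (\<lambda>k. h)"
    by (rule A0_rep_conv[OF assms(2,3)])
  have "(\<lambda>k. op_pair T h (if k = (0::nat) then f else (\<lambda>t. 0))) sums op_pair T h f"
    using sums_single[of 0 "\<lambda>_. op_pair T h f"]
    by (rule sums_cong[THEN iffD1, rotated]) auto
  then show ?thesis
    using wpair_sums[OF annihilates_Bop[OF T], of "\<lambda>k. if k = 0 then f else (\<lambda>t. 0)" "\<lambda>k. h"] r eta_op_rep[OF T r]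
    by (simp add: A0_rep_iff sums_unique2)
qed

section \<open>Translations acting as point evaluations\<close>

lemma lborel_integral_translate:
  fixes g :: rfun
  shows "(LINT t|lborel. g (t - s)) = (LINT t|lborel. g t)"
  using lborel_integral_real_affine[of 1 g "- s"] by simp

lemma lborel_integrable_translate:
  fixes g :: rfun
  shows "integrable lborel g \<Longrightarrow> integrable lborel (\<lambda>t. g (t - s))"
  using lborel_integrable_real_affine[of g 1 "- s"] by simp

lemma L1norm_translate: "L1norm (\<lambda>t. h (t - s)) = L1norm h"
  unfolding L1norm_def using lborel_integral_real_affine[of 1 "\<lambda>t. norm (h t)" "- s"] by simp

text \<open>Translation multiplies the Fourier transform by a character and so keeps its
  zeros.\<close>

lemma H1_translate:
  assumes "h \<in> H1" shows "(\<lambda>t. h (t - s)) \<in> H1"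
proof -
  have "fourier (\<lambda>t. h (t - s)) u = exp (- (\<i> * complex_of_real (s * u))) * fourier h u" for u
  proof -
    have "fourier (\<lambda>t. h (t - s)) u = (LINT t|lborel. (\<lambda>r. h r * exp (- (\<i> * complex_of_real ((r + s) * u)))) (t - s))"
      by (simp add: fourier_def)
    also have "\<dots> = (LINT r|lborel. h r * exp (- (\<i> * complex_of_real ((r + s) * u))))"
      by (rule lborel_integral_translate)
    also have "\<dots> = (LINT r|lborel. exp (- (\<i> * complex_of_real (s * u))) * (h r * exp (- (\<i> * complex_of_real (r * u)))))"
      by (intro Bochner_Integration.integral_cong) (auto simp: algebra_simps exp_diff exp_minus divide_inverse)
    finally show ?thesis by (simp add: fourier_def del: of_real_mult)
  qed
  then show ?thesis using assms lborel_integrable_translate by (auto simp: H1_def)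
qed

lemma H1_sum: "(\<And>i. i < (n::nat) \<Longrightarrow> g i \<in> H1) \<Longrightarrow> (\<lambda>t. \<Sum>i<n. g i t) \<in> H1"
  by (induction n) (auto simp: H1_zero intro: H1_add)

lemma translation_sum_Bop:
  fixes n :: nat
  shows "(\<lambda>h t. \<Sum>i<n. c i * h (t - s i)) \<in> Bop" (is "?S \<in> Bop")
proof -
  have 1: "?S h \<in> H1" if "h \<in> H1" for h
    using that by (intro H1_sum H1_cmult H1_translate)
  have 2: "aeeq (?S g) (?S h)" if gh: "g \<in> H1" "h \<in> H1" "aeeq g h" for g h
  proof -
    have [measurable]: "g \<in> borel_measurable borel" "h \<in> borel_measurable borel"
      using gh by (auto intro: integrable_measurable_borel H1_integrable)
    have "AE t in lborel. g (t - r) = h (t - r)" for r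
      using AE_borel_affine[of 1 "\<lambda>t. g t = h t" "- r"] gh(3) by (simp add: aeeq_def)
    then have "AE t in lborel. \<forall>i\<in>{..<n}. g (t - s i) = h (t - s i)"
      by (subst AE_finite_all) auto
    then show ?thesis unfolding aeeq_def by eventually_elim auto
  qed
  have 3: "L1norm (?S h) \<le> (\<Sum>i<n. norm (c i)) * L1norm h" if h: "h \<in> H1" for h
  proof -
    have i: "integrable lborel (\<lambda>t. norm (c k * h (t - s k)))" for k
      using lborel_integrable_translate[OF H1_integrable[OF h], of "s k"] by (intro integrable_norm) simp
    have "L1norm (?S h) \<le> (LINT t|lborel. (\<Sum>k<n. norm (c k * h (t - s k))))"
      unfolding L1norm_def
    proof (rule integral_mono)
      show "integrable lborel (\<lambda>t. norm (?S h t))" using H1_integrable[OF 1[OF h]] by simp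
    qed (use i in \<open>auto intro: norm_sum\<close>)
    also have "\<dots> = (\<Sum>k<n. LINT t|lborel. norm (c k * h (t - s k)))"
      using i by (intro Bochner_Integration.integral_sum) auto
    also have "\<dots> = (\<Sum>k<n. norm (c k) * L1norm h)"
      using L1norm_translate[of h] by (simp add: norm_mult L1norm_def)
    finally show ?thesis by (simp add: sum_distrib_right)
  qed
  show ?thesis
    unfolding Bop_def using 1 2 exI[of "\<lambda>C. \<forall>h\<in>H1. L1norm (?S h) \<le> C * L1norm h", OF ballI, OF 3]
    by (auto simp: aeeq_def distrib_left sum.distrib sum_distrib_left mult.left_commute)
qed

text \<open>A substitution turns the pairing of a translate of \<open>h\<close> with the reflected
  \<open>f\<close> into a value of \<open>f \<star> h\<close>; the reflection is responsible for the
  argument \<open>- s i\<close>.\<close>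

lemma op_pair_translation_sum:
  fixes n :: nat
  assumes "f \<in> C0" "h \<in> H1"
  shows "op_pair (\<lambda>h t. \<Sum>i<n. c i * h (t - s i)) h f = (\<Sum>i<n. c i * (f \<star> h) (- s i))"
proof -
  have i: "integrable lborel (\<lambda>t. h (t - r) * f (- t))" for r
    using assms by (intro reflected_pairing_integrable lborel_integrable_translate H1_integrable)
  have e: "(LINT t|lborel. h (t - r) * f (- t)) = (f \<star> h) (- r)" for r
    using lborel_integral_translate[of "\<lambda>t. h t * f (- r - t)" r]
    by (simp add: conv_def mult.commute)
  have "op_pair (\<lambda>h t. \<Sum>i<n. c i * h (t - s i)) h f = (LINT t|lborel. (\<Sum>i<n. c i * (h (t - s i) * f (- t))))"
    by (simp add: sum_distrib_right mult.assoc)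
  also have "\<dots> = (\<Sum>i<n. LINT t|lborel. c i * (h (t - s i) * f (- t)))"
    using i by (intro Bochner_Integration.integral_sum) auto
  finally show ?thesis by (simp add: e)
qed

text \<open>The right-hand side sees \<open>f\<close> and \<open>h\<close> only through
  \<open>F\<close>. Hence translations, and then their weak-star limits, kill representations of
  0.\<close>

lemma wpair_translation_sum:
  fixes n :: nat
  assumes r: "A0_rep F f h"
  shows "wpair (\<lambda>h t. \<Sum>i<n. c i * h (t - s i)) (f, h) = (\<Sum>i<n. c i * F (- s i))"
proof -
  have "(\<lambda>k. \<Sum>i<n. c i * (f k \<star> h k) (- s i)) sums (\<Sum>i<n. c i * F (- s i))"
    using r by (intro sums_sum sums_mult) (auto simp: A0_rep_def)
  moreover have "op_pair (\<lambda>h t. \<Sum>i<n. c i * h (t - s i)) (h k) (f k) = (\<Sum>i<n. c i * (f k \<star> h k) (- s i))" for k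
    using r by (intro op_pair_translation_sum) (auto simp: A0_rep_def)
  ultimately show ?thesis
    using wpair_sums[OF translation_sum_Bop[where n = n and c = c and s = s], of f h] r by (simp add: A0_rep_iff sums_unique2)
qed

section \<open>Point evaluations and the weak-star topologies\<close>

text \<open>Linearity alone, because it must also cover differences of a functional and a point
  evaluation, which need not vanish off \<open>A0\<close> as \<open>A0dual\<close> demands.\<close>

definition A0_linear :: "(rfun \<Rightarrow> complex) \<Rightarrow> bool" where
  "A0_linear \<phi> \<longleftrightarrow> (\<forall>F\<in>A0. \<forall>G\<in>A0. \<phi> (\<lambda>t. F t + G t) = \<phi> F + \<phi> G)
     \<and> (\<forall>F\<in>A0. \<forall>c. \<phi> (\<lambda>t. c * F t) = c * \<phi> F)"

lemma A0dual_linear: "\<phi> \<in> A0dual \<Longrightarrow> A0_linear \<phi>"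
  by (auto simp: A0_linear_def A0dual_def)

definition point_evals :: "(rfun \<Rightarrow> complex) set" where
  "point_evals = {(\<lambda>F. \<Sum>s\<in>S. c s * F s) | S c. finite S}"

lemma point_evals_zero: "(\<lambda>F. 0) \<in> point_evals"
  unfolding point_evals_def by (intro CollectI exI[of _ "{}"]) auto

lemma point_evals_single: "(\<lambda>F. F s) \<in> point_evals"
  unfolding point_evals_def by (intro CollectI exI[of _ "{s}"] exI[of _ "\<lambda>_. 1"]) auto

lemma point_evals_cmult: "\<mu> \<in> point_evals \<Longrightarrow> (\<lambda>F. a * \<mu> F) \<in> point_evals"
proof -
  assume "\<mu> \<in> point_evals"
  then obtain S c where "finite S" "\<mu> = (\<lambda>F. \<Sum>s\<in>S. c s * F s)" by (auto simp: point_evals_def)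
  then show ?thesis
    unfolding point_evals_def
    by (intro CollectI exI[of _ S] exI[of _ "\<lambda>s. a * c s"]) (auto simp: sum_distrib_left mult.assoc)
qed

lemma point_evals_add:
  assumes "\<mu> \<in> point_evals" "\<nu> \<in> point_evals"
  shows "(\<lambda>F. \<mu> F + \<nu> F) \<in> point_evals"
proof -
  obtain S c where 1: "finite S" "\<mu> = (\<lambda>F. \<Sum>s\<in>S. c s * F s)" using assms by (auto simp: point_evals_def)
  obtain S' c' where 2: "finite S'" "\<nu> = (\<lambda>F. \<Sum>s\<in>S'. c' s * F s)" using assms by (auto simp: point_evals_def)
  have "(\<Sum>s\<in>S. c s * F s) = (\<Sum>s\<in>S \<union> S'. (if s \<in> S then c s else 0) * F s)" for F :: rfun
    by (rule sum.mono_neutral_cong_left) (use 1 2 in auto)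
  moreover have "(\<Sum>s\<in>S'. c' s * F s) = (\<Sum>s\<in>S \<union> S'. (if s \<in> S' then c' s else 0) * F s)" for F :: rfun
    by (rule sum.mono_neutral_cong_left) (use 1 2 in auto)
  ultimately have "(\<lambda>F. \<mu> F + \<nu> F) = (\<lambda>F. \<Sum>s\<in>S \<union> S'. ((if s \<in> S then c s else 0) + (if s \<in> S' then c' s else 0)) * F s)"
    by (simp add: 1 2 distrib_right sum.distrib)
  with 1 2 show ?thesis
    unfolding point_evals_def
    by (intro CollectI exI[of _ "S \<union> S'"] exI[of _ "\<lambda>s. (if s \<in> S then c s else 0) + (if s \<in> S' then c' s else 0)"]) auto
qed

lemma point_evals_linear:
  assumes "\<mu> \<in> point_evals"
  shows "\<mu> (\<lambda>t. F t + G t) = \<mu> F + \<mu> G" "\<mu> (\<lambda>t. c * F t) = c * \<mu> F"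
  using assms by (auto simp: point_evals_def distrib_left sum.distrib sum_distrib_left mult.left_commute)

text \<open>The condition on point evaluations says that they cannot tell \<open>G\<close> from a
  combination of elements of \<open>B\<close>; eliminating the elements of \<open>B\<close> one at a
  time carries this over to \<open>\<phi>\<close>. In the base case all values of \<open>G\<close>
  vanish, so \<open>G\<close> is the zero function.\<close>

lemma A0_linear_zero_of_point_evals:
  assumes \<phi>: "A0_linear \<phi>" and B: "finite B" "B \<subseteq> A0" and G: "G \<in> A0"
    and 0: "\<forall>F\<in>B. \<phi> F = 0"
    and ev: "\<forall>\<nu>\<in>point_evals. (\<forall>F\<in>B. \<nu> F = 0) \<longrightarrow> \<nu> G = 0"
  shows "\<phi> G = 0"
  using B G 0 ev
proof (induction B arbitrary: G rule: finite_induct)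
  case empty
  have "G t = 0" for t using bspec[OF empty.prems(4) point_evals_single[of t]] by simp
  then have "G = (\<lambda>t. 0 * G t)" by auto
  moreover have "\<phi> (\<lambda>t. 0 * G t) = 0 * \<phi> G"
    using \<phi> empty unfolding A0_linear_def by blast
  ultimately show ?case by simp
next
  case (insert F B)
  show ?case
  proof (cases "\<forall>\<nu>\<in>point_evals. (\<forall>F\<in>B. \<nu> F = 0) \<longrightarrow> \<nu> F = 0")
    case True
    show ?thesis
    proof (rule insert.IH)
      show "\<forall>\<nu>\<in>point_evals. (\<forall>F\<in>B. \<nu> F = 0) \<longrightarrow> \<nu> G = 0"
        using True insert.prems(4) by simp
    qed (use insert.prems in simp_all)
  next
    case False
    then obtain \<nu>0 where n0: "\<nu>0 \<in> point_evals" "\<forall>F\<in>B. \<nu>0 F = 0" "\<nu>0 F \<noteq> 0" by blast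
    \<comment> \<open>Chosen so that \<open>\<nu>0\<close> kills \<open>G + a * F\<close>, the
      element to which the induction hypothesis is applied.\<close>
    define a where "a = - (\<nu>0 G / \<nu>0 F)"
    have FA: "F \<in> A0" using insert by simp
    have GF: "(\<lambda>t. G t + a * F t) \<in> A0"
      using A0_add[OF insert.prems(2) A0_cmult[OF FA]] .
    have "\<phi> (\<lambda>t. G t + a * F t) = 0"
    proof (rule insert.IH[OF _ GF])
      show "\<forall>\<nu>\<in>point_evals. (\<forall>F\<in>B. \<nu> F = 0) \<longrightarrow> \<nu> (\<lambda>t. G t + a * F t) = 0"
      proof (intro ballI impI)
        fix \<nu> assume n: "\<nu> \<in> point_evals" "\<forall>F\<in>B. \<nu> F = 0"
        \<comment> \<open>Correcting \<open>\<nu>\<close> by a multiple of \<open>\<nu>0\<close>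
          makes it kill \<open>F\<close> as well, so the assumption for \<open>insert F B\<close>
          applies to it.\<close>
        have "(\<lambda>H. \<nu> H + - (\<nu> F / \<nu>0 F) * \<nu>0 H) \<in> point_evals"
          by (intro point_evals_add point_evals_cmult n n0)
        from bspec[OF insert.prems(4) this] have "\<nu> G + - (\<nu> F / \<nu>0 F) * \<nu>0 G = 0"
          using n n0 by simp
        then show "\<nu> (\<lambda>t. G t + a * F t) = 0"
          unfolding point_evals_linear[OF n(1)] a_def by (simp add: mult.commute)
      qed
    qed (use insert in auto)
    moreover have "\<phi> (\<lambda>t. G t + a * F t) = \<phi> G + a * \<phi> F"
      using \<phi> insert.prems(2) FA A0_cmult[OF FA, of a] unfolding A0_linear_def by metis
    ultimately show ?thesis using insert by simp
  qed
qed

text \<open>When \<open>G\<close> joins \<open>B\<close>, either some point evaluation kills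
  \<open>B\<close> but not \<open>G\<close> and serves to correct the value at \<open>G\<close>, or
  \<open>\<phi> - \<mu>\<close> already vanishes at \<open>G\<close> by the preceding
  elimination.\<close>

lemma point_evals_interpolate:
  assumes \<phi>: "A0_linear \<phi>" and B: "finite B" "B \<subseteq> A0"
  shows "\<exists>\<mu>\<in>point_evals. \<forall>F\<in>B. \<mu> F = \<phi> F"
  using B
proof (induction B rule: finite_induct)
  case empty
  then show ?case using point_evals_zero by auto
next
  case (insert G B)
  then obtain \<mu> where m: "\<mu> \<in> point_evals" "\<forall>F\<in>B. \<mu> F = \<phi> F" by auto
  show ?case
  proof (cases "\<forall>\<nu>\<in>point_evals. (\<forall>F\<in>B. \<nu> F = 0) \<longrightarrow> \<nu> G = 0")
    case True
    have lin: "A0_linear (\<lambda>F. \<phi> F - \<mu> F)"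
      using \<phi> by (auto simp: A0_linear_def point_evals_linear[OF m(1)] algebra_simps)
    have "\<phi> G - \<mu> G = 0"
      by (rule A0_linear_zero_of_point_evals[OF lin insert.hyps(1), of G]) (use insert m True in auto)
    then show ?thesis using m by auto
  next
    case False
    then obtain \<nu> where n: "\<nu> \<in> point_evals" "\<forall>F\<in>B. \<nu> F = 0" "\<nu> G \<noteq> 0" by blast
    have "(\<lambda>F. \<mu> F + ((\<phi> G - \<mu> G) / \<nu> G) * \<nu> F) \<in> point_evals"
      by (intro point_evals_add point_evals_cmult m n)
    then show ?thesis
      by (rule bexI[rotated]) (use m n in auto)
  qed
qed

lemma point_evals_translation_sum:
  assumes "\<mu> \<in> point_evals"
  obtains n :: nat and c :: "nat \<Rightarrow> complex" and s :: "nat \<Rightarrow> real" where "\<mu> = (\<lambda>F. \<Sum>i<n. c i * F (- s i))"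
proof -
  obtain S c where S: "finite S" "\<mu> = (\<lambda>F. \<Sum>s\<in>S. c s * F s)" using assms by (auto simp: point_evals_def)
  obtain b where b: "bij_betw b {..<card S} S"
    using ex_bij_betw_nat_finite[OF S(1)] by (auto simp: atLeast0LessThan)
  have "(\<Sum>i<card S. c (b i) * F (b i)) = (\<Sum>s\<in>S. c s * F s)" for F :: rfun
    by (rule sum.reindex_bij_betw[OF b])
  \<comment> \<open>The nodes are negated because translation by \<open>s\<close> evaluates at
    \<open>- s\<close>.\<close>
  then show thesis using that[where n = "card S" and c = "\<lambda>i. c (b i)" and s = "\<lambda>i. - b i"] S(2) by simp
qed

section \<open>\<open>PM\<close> as the annihilator of representations of 0\<close>

lemma topspace_wstarB: "topspace wstarB = Bop"
proof -
  have "predual_elt (\<lambda>k t. 0, \<lambda>k t. 0)"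
    by (auto simp: predual_elt_def C0_zero H1_zero L1norm_def)
  then have "\<Union> {{T. wpair T u \<in> U} | u U. predual_elt u \<and> open U} = UNIV" by blast
  then show ?thesis by (simp add: wstarB_def)
qed

lemma span_tau_Bop: "span_tau \<subseteq> Bop"
  by (auto simp: span_tau_def translation_sum_Bop)

text \<open>If \<open>T\<close> had a nonzero pairing with a representation of 0, the operators with
  nonzero pairing would form a weak-star neighbourhood of \<open>T\<close> that contains no
  combination of translations.\<close>

lemma PM_imp_annihilates:
  assumes "T \<in> PM" shows "annihilates T"
proof -
  have T: "T \<in> Bop" using assms by (auto simp: PM_def in_closure_of topspace_wstarB)
  have "wpair T (f, h) = 0" if r: "A0_rep (\<lambda>t. 0) f h" for f h
  proof (rule ccontr)
    assume nz: "wpair T (f, h) \<noteq> 0"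
    have "predual_elt (f, h)" using r by (simp add: A0_rep_iff)
    then have "{S. wpair S (f, h) \<in> - {0}} \<in> {{T. wpair T u \<in> U} | u U. predual_elt u \<and> open U}"
      by blast
    then have "openin wstarB ({S. wpair S (f, h) \<in> - {0}} \<inter> Bop)"
      unfolding wstarB_def by (intro openin_subtopology_Int topology_generated_by_Basis)
    moreover have "T \<in> {S. wpair S (f, h) \<in> - {0}} \<inter> Bop" using nz T by simp
    moreover have "\<forall>W. T \<in> W \<and> openin wstarB W \<longrightarrow> (\<exists>S. S \<in> span_tau \<and> S \<in> W)"
      using assms by (simp add: PM_def in_closure_of)
    ultimately have "\<exists>S. S \<in> span_tau \<and> S \<in> {S. wpair S (f, h) \<in> - {0}} \<inter> Bop"
      by (simp only: simp_thms)
    then obtain S where S: "S \<in> span_tau" "wpair S (f, h) \<noteq> 0" by auto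
    then obtain n :: nat and c s where Seq: "S = (\<lambda>h t. \<Sum>i<n. c i * h (t - s i))"
      by (auto simp: span_tau_def)
    have "wpair S (f, h) = 0" unfolding Seq by (subst wpair_translation_sum[OF r]) simp
    then show False using S by simp
  qed
  then show ?thesis using T by (simp add: annihilates_def)
qed

text \<open>Recording equality of finitely many pairings, rather than closeness, passes through the
  induction without any estimates: intersections take the union of the finite sets, unions pick one
  member.\<close>

lemma wpair_generated_nbhd:
  assumes "generate_topology_on {{T. wpair T u \<in> U} | u U. predual_elt u \<and> open U} W" "T \<in> W"
  shows "\<exists>us. finite us \<and> (\<forall>u\<in>us. predual_elt u) \<and> (\<forall>S. (\<forall>u\<in>us. wpair S u = wpair T u) \<longrightarrow> S \<in> W)"
  using assms
proof (induction rule: generate_topology_on.induct)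
  case (Int a b)
  then obtain us vs where "finite us \<and> (\<forall>u\<in>us. predual_elt u) \<and> (\<forall>S. (\<forall>u\<in>us. wpair S u = wpair T u) \<longrightarrow> S \<in> a)"
    "finite vs \<and> (\<forall>u\<in>vs. predual_elt u) \<and> (\<forall>S. (\<forall>u\<in>vs. wpair S u = wpair T u) \<longrightarrow> S \<in> b)"
    by auto
  then show ?case by (intro exI[of _ "us \<union> vs"]) auto
next
  case (UN K)
  then obtain k where "k \<in> K" "T \<in> k" by blast
  with UN show ?case by (meson UnionI)
next
  case (Basis W)
  then obtain u U where "W = {T. wpair T u \<in> U}" "predual_elt u" by blast
  with Basis show ?case by (intro exI[of _ "{u}"]) auto
qed auto

text \<open>The finitely many functions \<open>predual_fun u\<close> coming from a neighbourhood of
  \<open>T\<close> are interpolated by a point evaluation carrying the values of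
  \<open>eta_op T\<close>. Read as a combination of translations, it has the same pairings as
  \<open>T\<close> there.\<close>

lemma annihilates_imp_PM:
  assumes T: "annihilates T" shows "T \<in> PM"
  unfolding PM_def in_closure_of topspace_wstarB
proof (intro conjI allI impI)
  show "T \<in> Bop" by (rule annihilates_Bop[OF T])
  fix W assume W: "T \<in> W \<and> openin wstarB W"
  then obtain W' where W': "W = W' \<inter> Bop" "openin (topology_generated_by {{T. wpair T u \<in> U} | u U. predual_elt u \<and> open U}) W'"
    by (auto simp: wstarB_def openin_subtopology)
  then obtain us where us: "finite us" "\<And>u. u \<in> us \<Longrightarrow> predual_elt u" "\<And>S. (\<forall>u\<in>us. wpair S u = wpair T u) \<Longrightarrow> S \<in> W'"
    using wpair_generated_nbhd[of W' T] W by (auto dest!: openin_topology_generated_by)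
  have rep: "A0_rep (predual_fun u) (fst u) (snd u)" if "u \<in> us" for u
    using A0_rep_predual_fun[of "fst u" "snd u"] us(2)[OF that] by simp
  have "A0_linear (eta_op T)" by (intro A0dual_linear eta_op_A0dual T)
  then obtain \<mu> where m: "\<mu> \<in> point_evals" "\<And>u. u \<in> us \<Longrightarrow> \<mu> (predual_fun u) = eta_op T (predual_fun u)"
    using point_evals_interpolate[of "eta_op T" "predual_fun ` us"] us(1) A0_rep_imp_A0[OF rep]
    by (metis (no_types, lifting) finite_imageI image_eqI image_subsetI)
  obtain n :: nat and c s where mu: "\<mu> = (\<lambda>F. \<Sum>i<n. c i * F (- s i))"
    using point_evals_translation_sum[OF m(1)] by metis
  define S :: rop where "S = (\<lambda>h t. \<Sum>i<n. c i * h (t - s i))"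
  have Ssp: "S \<in> span_tau" unfolding S_def span_tau_def by blast
  have "wpair S u = wpair T u" if "u \<in> us" for u
  proof -
    have "wpair S (fst u, snd u) = \<mu> (predual_fun u)"
      unfolding S_def mu by (rule wpair_translation_sum[OF rep[OF that]])
    also have "\<dots> = wpair T (fst u, snd u)" using m(2)[OF that] eta_op_rep[OF T rep[OF that]] by simp
    finally show ?thesis by simp
  qed
  then have "S \<in> W" using us(3) W'(1) Ssp span_tau_Bop by auto
  with Ssp show "\<exists>S. S \<in> span_tau \<and> S \<in> W" by blast
qed

text \<open>The condition on \<open>\<eta>\<close> in the theorem, for an arbitrary operator: sums
  and multiples can be treated without placing them in \<open>PM\<close> first.\<close>

definition represents :: "(rfun \<Rightarrow> complex) \<Rightarrow> rop \<Rightarrow> bool" where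
  "represents \<eta> T \<longleftrightarrow> \<eta> \<in> A0dual \<and> (\<forall>f\<in>C0. \<forall>h\<in>H1. \<eta> (f \<star> h) = (LINT t|lborel. T h t * f (- t)))"

lemma represents_unique: "represents \<eta> T \<Longrightarrow> represents \<eta>' T \<Longrightarrow> \<eta> = \<eta>'"
  by (rule A0dual_eqI) (auto simp: represents_def)

lemma the_represents: "represents \<eta> T \<Longrightarrow> (THE \<eta>. represents \<eta> T) = \<eta>"
  by (rule the_equality) (auto intro: represents_unique)

lemma eta_op_represents: "T \<in> PM \<Longrightarrow> represents (eta_op T) T"
  unfolding represents_def using eta_op_A0dual eta_op_conv PM_imp_annihilates by blast

lemma represents_add:
  assumes "represents \<eta> T" "represents \<theta> S" "T \<in> Bop" "S \<in> Bop"
  shows "represents (\<lambda>F. \<eta> F + \<theta> F) (\<lambda>h t. T h t + S h t)"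
proof -
  obtain C D where C: "\<And>F. F \<in> A0 \<Longrightarrow> norm (\<eta> F) \<le> C * A0norm F" and D: "\<And>F. F \<in> A0 \<Longrightarrow> norm (\<theta> F) \<le> D * A0norm F"
    using assms A0dual_bound unfolding represents_def by metis
  have "norm (\<eta> F + \<theta> F) \<le> (C + D) * A0norm F" if "F \<in> A0" for F
    using norm_triangle_ineq[of "\<eta> F" "\<theta> F"] C[OF that] D[OF that] by (simp add: distrib_right)
  then have "(\<lambda>F. \<eta> F + \<theta> F) \<in> A0dual"
    using assms exI[of "\<lambda>C. \<forall>F\<in>A0. norm (\<eta> F + \<theta> F) \<le> C * A0norm F" "C + D"]
    unfolding represents_def A0dual_def by (simp add: algebra_simps)
  moreover have "(LINT t|lborel. (T h t + S h t) * f (- t)) = op_pair T h f + op_pair S h f" if "f \<in> C0" "h \<in> H1" for f h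
    using assms that by (simp add: distrib_right reflected_pairing_integrable Bop_integrable)
  ultimately show ?thesis using assms by (simp add: represents_def)
qed

lemma represents_cmult:
  assumes "represents \<eta> T"
  shows "represents (\<lambda>F. c * \<eta> F) (\<lambda>h t. c * T h t)"
proof -
  obtain C where C: "\<And>F. F \<in> A0 \<Longrightarrow> norm (\<eta> F) \<le> C * A0norm F"
    using assms A0dual_bound unfolding represents_def by metis
  have "norm (c * \<eta> F) \<le> (norm c * C) * A0norm F" if "F \<in> A0" for F
    using mult_left_mono[OF C[OF that], of "norm c"] by (simp add: norm_mult mult.assoc)
  then have "(\<lambda>F. c * \<eta> F) \<in> A0dual"
    using assms exI[of "\<lambda>C. \<forall>F\<in>A0. norm (c * \<eta> F) \<le> C * A0norm F" "norm c * C"]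
    unfolding represents_def A0dual_def by (simp add: algebra_simps)
  then show ?thesis using assms by (simp add: represents_def mult.assoc)
qed

text \<open>The usual rescaling to norm 1. An operator is homogeneous only almost everywhere, so the
  scalar is moved inside the integral; \<open>L1norm h = 0\<close> is covered by the constant of
  \<open>Bop_bound\<close>.\<close>

lemma Bop_opnorm:
  assumes T: "T \<in> Bop"
  shows "0 \<le> opnorm T" "h \<in> H1 \<Longrightarrow> L1norm (T h) \<le> opnorm T * L1norm h"
proof -
  obtain C where C: "C \<ge> 0" "\<And>h. h \<in> H1 \<Longrightarrow> L1norm (T h) \<le> C * L1norm h" using Bop_bound[OF T] by metis
  have up: "L1norm (T h) \<le> opnorm T" if "h \<in> H1" "L1norm h \<le> 1" for h
    unfolding opnorm_def
  proof (rule cSup_upper)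
    show "bdd_above {L1norm (T h) |h. h \<in> H1 \<and> L1norm h \<le> 1}"
      using C by (intro bdd_aboveI[of _ C]) (auto intro: order_trans mult_left_le)
  qed (use that in blast)
  have z: "L1norm (\<lambda>t. 0) = 0" by (simp add: L1norm_def)
  show "0 \<le> opnorm T" using up[OF H1_zero] L1norm_nonneg[of "T (\<lambda>t. 0)"] z by simp
  assume h: "h \<in> H1"
  show "L1norm (T h) \<le> opnorm T * L1norm h"
  proof (cases "L1norm h = 0")
    case True
    then show ?thesis using C(2)[OF h] by simp
  next
    case False
    define a where "a = complex_of_real (1 / L1norm h)"
    have p: "L1norm h > 0" using False L1norm_nonneg[of h] by simp
    have "L1norm (T (\<lambda>t. a * h t)) \<le> opnorm T"
      using p by (intro up H1_cmult h, unfold L1norm_cmult) (simp add: a_def norm_divide)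
    moreover have "L1norm (T (\<lambda>t. a * h t)) = L1norm (\<lambda>t. a * T h t)"
      unfolding L1norm_def
    proof (rule integral_cong_AE)
      show "(\<lambda>t. norm (T (\<lambda>t. a * h t) t)) \<in> borel_measurable lborel" "(\<lambda>t. norm (a * T h t)) \<in> borel_measurable lborel"
        using Bop_integrable[OF T H1_cmult[OF h, of a]] Bop_integrable[OF T h] by auto
      have "aeeq (T (\<lambda>t. a * h t)) (\<lambda>t. a * T h t)" using T h by (auto simp: Bop_def)
      then show "AE t in lborel. norm (T (\<lambda>t. a * h t) t) = norm (a * T h t)" by (auto simp: aeeq_def)
    qed
    ultimately have "L1norm (T h) / L1norm h \<le> opnorm T"
      using p unfolding L1norm_cmult by (simp add: a_def norm_divide)
    then show ?thesis using p by (simp add: field_simps)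
  qed
qed

text \<open>Upper bound: every representation of \<open>F\<close> gives the same estimate, hence so
  does the infimum. Lower bound: the unit ball of \<open>A0\<close> contains
  \<open>f \<star> h\<close> for \<open>f\<close> and \<open>h\<close> in the unit balls, and these
  pairings recover \<open>L1norm (T h)\<close> by duality.\<close>

lemma dualnorm_eta_op:
  assumes T: "T \<in> PM" shows "dualnorm (eta_op T) = opnorm T"
proof -
  have an: "annihilates T" and TB: "T \<in> Bop" using T PM_imp_annihilates annihilates_Bop by auto
  note on = Bop_opnorm[OF TB]
  have b: "norm (eta_op T F) \<le> opnorm T" if "F \<in> A0" "A0norm F \<le> 1" for F
    using eta_op_bound[OF an on that(1)] mult_left_le[OF that(2) on(1)] by (rule order_trans)
  have up: "norm (eta_op T F) \<le> dualnorm (eta_op T)" if "F \<in> A0" "A0norm F \<le> 1" for F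
    unfolding dualnorm_def
  proof (rule cSup_upper)
    show "bdd_above {norm (eta_op T F) |F. F \<in> A0 \<and> A0norm F \<le> 1}"
      using b by (intro bdd_aboveI[of _ "opnorm T"]) auto
  qed (use that in blast)
  have z: "L1norm (\<lambda>t. 0) = 0" by (simp add: L1norm_def)
  have z1: "(\<lambda>t. 0) \<star> (\<lambda>t. 0) \<in> A0" "A0norm ((\<lambda>t. 0) \<star> (\<lambda>t. 0)) \<le> 1"
    using conv_in_A0[OF C0_zero H1_zero] A0norm_conv_le[OF C0_zero H1_zero] by (auto simp: z)
  have "dualnorm (eta_op T) \<le> opnorm T"
    unfolding dualnorm_def by (rule cSup_least) (use b z1 in auto)
  moreover have "opnorm T \<le> dualnorm (eta_op T)"
    unfolding opnorm_def
  proof (rule cSup_least)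
    show "{L1norm (T h) |h. h \<in> H1 \<and> L1norm h \<le> 1} \<noteq> {}" using H1_zero z by auto
    fix x assume "x \<in> {L1norm (T h) |h. h \<in> H1 \<and> L1norm h \<le> 1}"
    then obtain h where x: "x = L1norm (T h)" and h: "h \<in> H1" "L1norm h \<le> 1" by auto
    show "x \<le> dualnorm (eta_op T)"
      unfolding x
    proof (rule L1norm_le_reflected_pairing[OF Bop_integrable[OF TB h(1)]])
      fix f assume f: "f \<in> C0" "\<And>t. norm (f t) \<le> 1"
      have "supnorm f * L1norm h \<le> 1 * 1"
        using supnorm_le[OF f(2)] h L1norm_nonneg[of h] by (intro mult_mono) auto
      then have "A0norm (f \<star> h) \<le> 1" using A0norm_conv_le[OF f(1) h(1)] by simp
      then show "norm (op_pair T h f) \<le> dualnorm (eta_op T)"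
        using up[OF conv_in_A0[OF f(1) h(1)]] eta_op_conv[OF an f(1) h(1)] by simp
    qed
  qed
  ultimately show ?thesis by simp
qed

lemma eta_op_eq_iff:
  assumes "T \<in> PM" "S \<in> PM"
  shows "eta_op T = eta_op S \<longleftrightarrow> op_eq T S"
proof -
  have an: "annihilates T" "annihilates S" and B: "T \<in> Bop" "S \<in> Bop"
    using assms PM_imp_annihilates annihilates_Bop by auto
  have "op_eq T S \<longleftrightarrow> (\<forall>h\<in>H1. \<forall>f\<in>C0. eta_op T (f \<star> h) = eta_op S (f \<star> h))"
    unfolding op_eq_def using an B
    by (simp add: aeeq_iff_reflected_pairing Bop_integrable eta_op_conv)
  then show ?thesis
    using A0dual_eqI[OF eta_op_A0dual[OF an(1)] eta_op_A0dual[OF an(2)]] by auto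
qed

text \<open>A fixed representation of \<open>F\<close> turns evaluation at \<open>F\<close> into the
  pairing with one predual element, so preimages of subbasic sets are subbasic, cut down to
  \<open>PM\<close>.\<close>

lemma continuous_map_eta_op: "continuous_map (subtopology wstarB PM) wstarA eta_op"
proof -
  have sub: "PM \<subseteq> Bop" using PM_imp_annihilates annihilates_Bop by blast
  have ts: "topspace (subtopology wstarB PM) = PM" using sub by (auto simp: topspace_wstarB)
  have "continuous_map (subtopology wstarB PM) (topology_generated_by {{\<phi>. \<phi> F \<in> U} | F U. F \<in> A0 \<and> open (U :: complex set)}) eta_op"
  proof (rule continuous_on_generated_topo)
    fix V assume "V \<in> {{\<phi>. \<phi> F \<in> U} | F U. F \<in> A0 \<and> open (U :: complex set)}"
    then obtain F U where V: "V = {\<phi>. \<phi> F \<in> U}" "F \<in> A0" "open U" by blast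
    obtain f h where r: "A0_rep F f h" using V by (auto simp: A0_def)
    have "eta_op -` V \<inter> topspace (subtopology wstarB PM) = ({T. wpair T (f, h) \<in> U} \<inter> Bop) \<inter> PM"
      unfolding ts V using eta_op_rep[OF PM_imp_annihilates r] sub by auto
    moreover have "{T. wpair T (f, h) \<in> U} \<in> {{T. wpair T u \<in> U} | u U. predual_elt u \<and> open U}"
      using r V by (auto simp: A0_rep_iff)
    then have "openin wstarB ({T. wpair T (f, h) \<in> U} \<inter> Bop)"
      unfolding wstarB_def by (intro openin_subtopology_Int topology_generated_by_Basis)
    ultimately show "openin (subtopology wstarB PM) (eta_op -` V \<inter> topspace (subtopology wstarB PM))"
      by (simp add: openin_subtopology_Int)
  next
    have "(\<lambda>t. 0) \<star> (\<lambda>t. 0) \<in> A0" by (intro conv_in_A0 C0_zero H1_zero)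
    then show "eta_op ` topspace (subtopology wstarB PM) \<subseteq> \<Union> {{\<phi>. \<phi> F \<in> U} | F U. F \<in> A0 \<and> open (U :: complex set)}"
      by blast
  qed
  then show ?thesis
    unfolding wstarA_def
    by (rule continuous_map_into_subtopology) (auto simp: ts dest: PM_imp_annihilates eta_op_A0dual)
qed

text \<open>\<open>eta_op\<close> identifies operators that agree almost everywhere, so an open set
  must be shown to be saturated: within \<open>PM\<close> every weak-star open set is a full
  preimage. Surjectivity then makes its image relatively open in \<open>A0dual\<close>.\<close>

lemma open_map_eta_op:
  assumes surj: "eta_op ` PM = A0dual"
  shows "open_map (subtopology wstarB PM) wstarA eta_op"
proof -
  have sub: "PM \<subseteq> Bop" using PM_imp_annihilates annihilates_Bop by blast
  let ?A = "topology_generated_by {{\<phi>. \<phi> F \<in> U} | F U. F \<in> A0 \<and> open (U :: complex set)}"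
  have pull: "\<exists>V. openin ?A V \<and> W \<inter> PM = {T\<in>PM. eta_op T \<in> V}"
    if "generate_topology_on {{T. wpair T u \<in> U} | u U. predual_elt u \<and> open U} W" for W
    using that
  proof (induction rule: generate_topology_on.induct)
    case Empty
    then show ?case by (intro exI[of _ "{}"]) auto
  next
    case (Int a b)
    then obtain V V' where "openin ?A V" "a \<inter> PM = {T\<in>PM. eta_op T \<in> V}" "openin ?A V'" "b \<inter> PM = {T\<in>PM. eta_op T \<in> V'}"
      by blast
    then show ?case by (intro exI[of _ "V \<inter> V'"]) auto
  next
    case (UN K)
    have "\<forall>k\<in>K. \<exists>V. openin ?A V \<and> k \<inter> PM = {T\<in>PM. eta_op T \<in> V}"
      by (intro ballI UN.IH)
    then obtain V where "\<forall>k\<in>K. openin ?A (V k) \<and> k \<inter> PM = {T\<in>PM. eta_op T \<in> V k}"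
      by (rule bchoice[THEN exE])
    then have V: "openin ?A (V k)" "k \<inter> PM = {T\<in>PM. eta_op T \<in> V k}" if "k \<in> K" for k
      using that by auto
    have "openin ?A (\<Union>k\<in>K. V k)" using V by (intro openin_Union) auto
    moreover have "\<Union>K \<inter> PM = {T\<in>PM. eta_op T \<in> (\<Union>k\<in>K. V k)}" using V by blast
    ultimately show ?case by blast
  next
    case (Basis W)
    then obtain u U where u: "W = {T. wpair T u \<in> U}" "predual_elt u" "open U" by blast
    have r: "A0_rep (predual_fun u) (fst u) (snd u)" using A0_rep_predual_fun[of "fst u" "snd u"] u(2) by simp
    have "openin ?A {\<phi>. \<phi> (predual_fun u) \<in> U}"
      by (rule topology_generated_by_Basis) (use A0_rep_imp_A0[OF r] u in blast)
    moreover have "W \<inter> PM = {T\<in>PM. eta_op T \<in> {\<phi>. \<phi> (predual_fun u) \<in> U}}"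
      using eta_op_rep[OF PM_imp_annihilates r] u by auto
    ultimately show ?case by blast
  qed
  show ?thesis
    unfolding open_map_def
  proof (intro allI impI)
    fix X assume "openin (subtopology wstarB PM) X"
    then obtain W where W: "X = W \<inter> Bop \<inter> PM" "generate_topology_on {{T. wpair T u \<in> U} | u U. predual_elt u \<and> open U} W"
      by (auto simp: wstarB_def openin_subtopology dest!: openin_topology_generated_by)
    then obtain V where V: "openin ?A V" "W \<inter> PM = {T\<in>PM. eta_op T \<in> V}" using pull by blast
    have "X = {T\<in>PM. eta_op T \<in> V}" using W(1) V(2) sub by auto
    then have "eta_op ` X = V \<inter> A0dual" using surj by auto
    then show "openin wstarA (eta_op ` X)"
      using V(1) by (auto simp: wstarA_def openin_subtopology)
  qed
qed

section \<open>Convolution with bump functions\<close>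

text \<open>A convolution kernel of mass 1 and width \<open>d\<close>. The Lipschitz condition makes
  its translates depend continuously on the shift in the sup norm, which gives a continuous
  density.\<close>

definition bump :: "real \<Rightarrow> (real \<Rightarrow> real) \<Rightarrow> bool" where
  "bump d k \<longleftrightarrow> (\<forall>t. 0 \<le> k t) \<and> (\<forall>t. d \<le> \<bar>t\<bar> \<longrightarrow> k t = 0)
     \<and> (\<exists>C\<ge>0. \<forall>s t. \<bar>k s - k t\<bar> \<le> C * \<bar>s - t\<bar>) \<and> integrable lborel k \<and> (LINT t|lborel. k t) = 1"

lemma bump_exists:
  assumes d: "d > 0" shows "\<exists>k. bump d k"
proof -
  define q where "q t = max 0 (d - \<bar>t\<bar>)" for t :: real
  define c where "c = (LINT t|lborel. q t)"
  have qc: "continuous_on UNIV q" unfolding q_def by (intro continuous_intros)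
  have [measurable]: "q \<in> borel_measurable borel" by (rule borel_measurable_continuous_onI[OF qc])
  have qi: "integrable lborel q"
  proof (rule Bochner_Integration.integrable_bound)
    show "integrable lborel (\<lambda>t. d * indicator {-d..d} t)" using d by simp
    have "norm (q t) \<le> norm (d * indicator {-d..d} t)" for t
      using d by (auto simp: q_def indicator_def)
    then show "AE t in lborel. norm (q t) \<le> norm (d * indicator {-d..d} t)" by simp
  qed simp
  \<comment> \<open>The tent is at least \<open>d / 2\<close> on the middle interval of length
    \<open>d\<close>, so its mass is positive and can be normalised.\<close>
  have "(LINT t|lborel. (d / 2) * indicator {-(d/2)..d/2} t) \<le> c"
    unfolding c_def
  proof (rule integral_mono[OF _ qi])
    show "(d / 2) * indicator {-(d/2)..d/2} t \<le> q t" for t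
      using d by (auto simp: q_def indicator_def)
  qed (use d in simp)
  moreover have "(LINT t|lborel. (d / 2) * indicator {-(d/2)..d/2} t) = (d / 2) * d" using d by simp
  ultimately have c: "c > 0" using d by (smt (verit) mult_pos_pos half_gt_zero)
  have "bump d (\<lambda>t. q t / c)"
    unfolding bump_def
  proof (intro conjI)
    show "\<exists>C\<ge>0. \<forall>s t. \<bar>q s / c - q t / c\<bar> \<le> C * \<bar>s - t\<bar>"
    proof (intro exI[of _ "1 / c"] conjI allI)
      fix s t
      have "\<bar>q s - q t\<bar> \<le> \<bar>s - t\<bar>" unfolding q_def by linarith
      then show "\<bar>q s / c - q t / c\<bar> \<le> 1 / c * \<bar>s - t\<bar>"
        using c by (simp flip: diff_divide_distrib add: divide_right_mono)
    qed (use c in simp)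
    show "integrable lborel (\<lambda>t. q t / c)" using qi by simp
    show "(LINT t|lborel. q t / c) = 1" using c by (simp add: c_def)
  qed (use c in \<open>auto simp: q_def\<close>)
  then show ?thesis by blast
qed

lemma bump_continuous: "bump d k \<Longrightarrow> continuous_on UNIV k"
proof -
  assume "bump d k"
  then obtain C where C: "C \<ge> 0" "\<And>s t. \<bar>k s - k t\<bar> \<le> C * \<bar>s - t\<bar>" unfolding bump_def by blast
  then have "C-lipschitz_on UNIV k" by (auto simp: lipschitz_on_def dist_real_def)
  then show ?thesis by (rule lipschitz_on_continuous_on)
qed

lemma bump_C0: "bump d k \<Longrightarrow> (\<lambda>t. complex_of_real (k t)) \<in> C0"
  using bump_continuous[of d k]
  by (intro C0_compact_support[of _ d]) (auto simp: bump_def intro!: continuous_intros)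

lemma bump_L1norm: "bump d k \<Longrightarrow> L1norm (\<lambda>t. complex_of_real (k t)) = 1"
  by (simp add: bump_def L1norm_def)

lemma bump_integrable: "bump d k \<Longrightarrow> integrable lborel (\<lambda>t. complex_of_real (k t))"
  by (simp add: bump_def)

lemma C0_translate: "f \<in> C0 \<Longrightarrow> (\<lambda>t. f (t - s)) \<in> C0"
proof (rule C0_I)
  assume f: "f \<in> C0"
  show "continuous_on UNIV (\<lambda>t. f (t - s))"
    using f by (auto simp: C0_def intro!: continuous_on_compose2[of UNIV f] continuous_intros)
  fix e :: real assume "e > 0"
  then obtain R where R: "\<And>t. R \<le> \<bar>t\<bar> \<Longrightarrow> norm (f t) < e" using C0_small[OF f] by metis
  have "norm (f (t - s)) < e" if "R + \<bar>s\<bar> \<le> \<bar>t\<bar>" for t using that by (intro R) linarith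
  then show "\<exists>R. \<forall>t. R \<le> \<bar>t\<bar> \<longrightarrow> norm (f (t - s)) < e" by blast
qed

lemma conv_commute_integral:
  fixes f h :: rfun
  shows "(LINT s|lborel. f (t - s) * h s) = (LINT s|lborel. f s * h (t - s))"
  using lborel_integral_real_affine[of "-1" "\<lambda>s. f (t - s) * h s" t] by simp

lemma conv_integrable_swap:
  assumes "f \<in> C0" "integrable lborel h"
  shows "integrable lborel (\<lambda>s. f s * h (t - s))"
  using lborel_integrable_real_affine[OF conv_integrable[OF assms, of t], of "-1" t] by simp

lemma continuous_Icc_integral:
  fixes f :: "real \<Rightarrow> 'a::euclidean_space"
  assumes "continuous_on UNIV f"
  shows "integrable lborel (\<lambda>s. indicator {a..b} s *\<^sub>R f s)"
    and "integral {a..b} f = (LINT s|lborel. indicator {a..b} s *\<^sub>R f s)"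
proof -
  have "set_integrable lborel {a..b} f"
    by (rule borel_integrable_atLeastAtMost') (rule continuous_on_subset[OF assms], simp)
  then show "integrable lborel (\<lambda>s. indicator {a..b} s *\<^sub>R f s)"
    "integral {a..b} f = (LINT s|lborel. indicator {a..b} s *\<^sub>R f s)"
    using set_borel_integral_eq_integral(2)[of "{a..b}" f]
    by (auto simp: set_integrable_def set_lebesgue_integral_def)
qed

text \<open>Continuity is dominated convergence; decay holds because the value at \<open>t\<close>
  involves \<open>f\<close> only within distance \<open>d\<close> of \<open>t\<close>.\<close>

lemma conv_bump_C0:
  assumes f: "f \<in> C0" and k: "bump d k"
  shows "f \<star> (\<lambda>t. complex_of_real (k t)) \<in> C0"
proof (rule C0_I)
  let ?K = "\<lambda>t. complex_of_real (k t)"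
  note Ki = bump_integrable[OF k]
  have [measurable]: "?K \<in> borel_measurable borel" by (rule integrable_measurable_borel[OF Ki])
  have [measurable]: "f \<in> borel_measurable borel" by (rule C0_measurable[OF f])
  have fc: "isCont f t" for t using f by (simp add: C0_def continuous_on_eq_continuous_at)
  show "continuous_on UNIV (f \<star> ?K)"
    unfolding continuous_on_sequentially
  proof (intro ballI allI impI)
    fix x :: "nat \<Rightarrow> real" and a assume "(\<forall>n. x n \<in> UNIV) \<and> x \<longlonglongrightarrow> a"
    then have x: "x \<longlonglongrightarrow> a" by simp
    have "(\<lambda>n. LINT s|lborel. f (x n - s) * ?K s) \<longlonglongrightarrow> (LINT s|lborel. f (a - s) * ?K s)"
    proof (rule integral_dominated_convergence[where w = "\<lambda>s. supnorm f * norm (?K s)"])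
      show "integrable lborel (\<lambda>s. supnorm f * norm (?K s))" by (intro integrable_mult_right integrable_norm Ki)
      have "(\<lambda>n. f (x n - s) * ?K s) \<longlonglongrightarrow> f (a - s) * ?K s" for s
        by (intro tendsto_intros isCont_tendsto_compose[OF fc] x)
      then show "AE s in lborel. (\<lambda>n. f (x n - s) * ?K s) \<longlonglongrightarrow> f (a - s) * ?K s" by simp
      show "AE s in lborel. norm (f (x n - s) * ?K s) \<le> supnorm f * norm (?K s)" for n
        unfolding norm_mult by (intro AE_I2 mult_right_mono norm_le_supnorm f) simp
    qed auto
    then show "((f \<star> ?K) \<circ> x) \<longlonglongrightarrow> (f \<star> ?K) a" by (simp add: conv_def o_def)
  qed
  fix e :: real assume e: "e > 0"
  then obtain R where R: "\<And>t. R \<le> \<bar>t\<bar> \<Longrightarrow> norm (f t) < e / 2" using C0_small[OF f, of "e / 2"] by (metis half_gt_zero)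
  have "norm ((f \<star> ?K) t) < e" if t: "R + d \<le> \<bar>t\<bar>" for t
  proof -
    have "norm ((f \<star> ?K) t) \<le> (LINT s|lborel. norm (f (t - s) * ?K s))" by (simp add: conv_def)
    also have "\<dots> \<le> (LINT s|lborel. e / 2 * k s)"
    proof (rule integral_mono)
      show "integrable lborel (\<lambda>s. norm (f (t - s) * ?K s))"
        using conv_integrable[OF f Ki] by (rule integrable_norm)
      show "integrable lborel (\<lambda>s. e / 2 * k s)" using k by (simp add: bump_def)
      fix s
      show "norm (f (t - s) * ?K s) \<le> e / 2 * k s"
      proof (cases "d \<le> \<bar>s\<bar>")
        case True
        then show ?thesis using k by (simp add: bump_def)
      next
        case False
        then have "norm (f (t - s)) < e / 2" using t by (intro R) linarith
        moreover have "0 \<le> k s" using k by (simp add: bump_def)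
        ultimately show ?thesis using mult_right_mono[of "norm (f (t - s))" "e / 2" "k s"] by (simp add: norm_mult)
      qed
    qed
    also have "\<dots> = e / 2" using k by (simp add: bump_def)
    finally show ?thesis using e by simp
  qed
  then show "\<exists>R. \<forall>t. R \<le> \<bar>t\<bar> \<longrightarrow> norm ((f \<star> ?K) t) < e" by blast
qed

text \<open>Instantiated later with \<open>L f = \<phi> (f \<star> h)\<close> for fixed
  \<open>h\<close>, where \<open>M\<close> is a bound of \<open>\<phi>\<close> times
  \<open>L1norm h\<close>.\<close>

locale C0_functional =
  fixes L :: "rfun \<Rightarrow> complex" and M :: real
  assumes add: "f \<in> C0 \<Longrightarrow> g \<in> C0 \<Longrightarrow> L (\<lambda>t. f t + g t) = L f + L g"
    and cmult: "f \<in> C0 \<Longrightarrow> L (\<lambda>t. c * f t) = c * L f"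
    and bound: "f \<in> C0 \<Longrightarrow> norm (L f) \<le> M * supnorm f"
    and M_nonneg: "0 \<le> M"
begin

lemma bound_le: "f \<in> C0 \<Longrightarrow> (\<And>t. norm (f t) \<le> B) \<Longrightarrow> norm (L f) \<le> M * B"
  by (rule order_trans[OF bound mult_left_mono[OF supnorm_le M_nonneg]])

lemma diff: "f \<in> C0 \<Longrightarrow> g \<in> C0 \<Longrightarrow> L (\<lambda>t. f t - g t) = L f - L g"
  using add[of f "\<lambda>t. -1 * g t"] cmult[of g "-1"] C0_cmult[of g "-1"] by simp

end

locale C0_functional_bump = C0_functional +
  fixes d :: real and k :: "real \<Rightarrow> real"
  assumes k: "bump d k"
begin

abbreviation K :: rfun where "K \<equiv> \<lambda>t. complex_of_real (k t)"

text \<open>\<open>f \<star> K\<close> with the argument of \<open>f\<close> restricted to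
  \<open>{a..b}\<close>. The restriction puts it into \<open>C0\<close> for any continuous
  \<open>f\<close>, and the gauge integral gives access to the fundamental theorem of calculus in
  the endpoint \<open>b\<close>.\<close>

definition partial_conv :: "rfun \<Rightarrow> real \<Rightarrow> real \<Rightarrow> rfun" where
  "partial_conv f a b t = integral {a..b} (\<lambda>s. f s * K (t - s))"

text \<open>The candidate density: formally \<open>f \<star> K\<close> is the integral of
  \<open>f s\<close> times the translate of \<open>K\<close> by \<open>s\<close>, and
  \<open>L\<close> would act under that integral.\<close>

definition G :: rfun where "G s = L (\<lambda>t. K (t - s))"

lemma K_continuous: "continuous_on UNIV (\<lambda>s. K (t - s))"
  by (intro continuous_intros continuous_on_compose2[OF bump_continuous[OF k]]) auto

lemma K_translate_C0: "(\<lambda>t. K (t - s)) \<in> C0"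
  by (rule C0_translate[OF bump_C0[OF k]])

lemma partial_conv_C0:
  assumes f: "continuous_on UNIV f"
  shows "partial_conv f a b \<in> C0"
proof (rule C0_compact_support)
  have "continuous_on (UNIV \<times> cbox a b) (\<lambda>(t, s). f s * K (t - s))"
    unfolding split_beta
    by (intro continuous_intros continuous_on_compose2[OF bump_continuous[OF k]] continuous_on_compose2[OF f]) auto
  from integral_continuous_on_param[OF this] show "continuous_on UNIV (partial_conv f a b)"
    by (simp add: partial_conv_def[abs_def])
  fix t assume t: "\<bar>a\<bar> + \<bar>b\<bar> + d < \<bar>t\<bar>"
  have "K (t - s) = 0" if "s \<in> {a..b}" for s
    using k t that by (auto simp: bump_def)
  then have "partial_conv f a b t = integral {a..b} (\<lambda>s. 0)"
    unfolding partial_conv_def by (intro integral_cong) auto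
  then show "partial_conv f a b t = 0" by simp
qed

lemma norm_partial_conv_le:
  assumes f: "continuous_on UNIV f" and B: "\<And>s. norm (f s) \<le> B"
  shows "norm (partial_conv f a b t) \<le> B"
proof -
  have c: "continuous_on UNIV (\<lambda>s. f s * K (t - s))" by (intro continuous_intros f K_continuous)
  have B0: "B \<ge> 0" using B[of 0] norm_ge_zero order_trans by blast
  have ki: "integrable lborel (\<lambda>s. k (t - s))"
    using k lborel_integrable_real_affine[of k "-1" t] by (simp add: bump_def)
  have "norm (partial_conv f a b t) \<le> (LINT s|lborel. norm (indicator {a..b} s *\<^sub>R (f s * K (t - s))))"
    unfolding partial_conv_def continuous_Icc_integral(2)[OF c] by (rule integral_norm_bound)
  also have "\<dots> \<le> (LINT s|lborel. B * k (t - s))"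
  proof (rule integral_mono)
    show "integrable lborel (\<lambda>s. norm (indicator {a..b} s *\<^sub>R (f s * K (t - s))))"
      by (intro integrable_norm continuous_Icc_integral(1) c)
    show "integrable lborel (\<lambda>s. B * k (t - s))" using ki by simp
    show "norm (indicator {a..b} s *\<^sub>R (f s * K (t - s))) \<le> B * k (t - s)" for s
      using k B[of s] B0 by (auto simp: bump_def indicator_def norm_mult mult_right_mono)
  qed
  also have "\<dots> = B"
    using k lborel_integral_real_affine[of "-1" k t] by (simp add: bump_def)
  finally show ?thesis .
qed

lemma G_continuous: "continuous_on UNIV G"
proof -
  obtain C where C: "C \<ge> 0" "\<And>s t. \<bar>k s - k t\<bar> \<le> C * \<bar>s - t\<bar>" using k unfolding bump_def by blast
  have "norm (G s - G r) \<le> M * (C * \<bar>s - r\<bar>)" for s r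
  proof -
    have "norm (K (t - s) - K (t - r)) \<le> C * \<bar>s - r\<bar>" for t
      using C(2)[of "t - s" "t - r"] by (simp flip: of_real_diff add: abs_minus_commute)
    then have "norm (L (\<lambda>t. K (t - s) - K (t - r))) \<le> M * (C * \<bar>s - r\<bar>)"
      by (intro bound_le C0_diff K_translate_C0)
    then show ?thesis unfolding G_def using diff[OF K_translate_C0 K_translate_C0] by simp
  qed
  then have "(M * C)-lipschitz_on UNIV G"
    using C M_nonneg by (auto simp: lipschitz_on_def dist_norm mult.assoc)
  then show ?thesis by (rule lipschitz_on_continuous_on)
qed

text \<open>Differentiating in the endpoint replaces a vector-valued integral: \<open>L\<close> is only defined on the
  subspace \<open>C0\<close>, so it cannot be pulled into such an integral directly.\<close>

lemma partial_conv_derivative: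
  assumes f: "continuous_on UNIV f" and x: "x \<in> {a..b}"
  shows "((\<lambda>y. L (partial_conv f a y)) has_vector_derivative f x * G x) (at x within {a..b})"
  unfolding has_vector_derivative_def has_derivative_within_alt
proof (intro conjI allI impI)
  show "bounded_linear (\<lambda>h. h *\<^sub>R (f x * G x))" by (rule bounded_linear_scaleR_left)
  fix e :: real assume e: "e > 0"
  \<comment> \<open>\<open>M + 1\<close> instead of \<open>M\<close> avoids division by 0 and keeps
    \<open>M * e' \<le> e\<close>.\<close>
  define e' where "e' = e / (M + 1)"
  have e': "e' > 0" "M * e' \<le> e" using e M_nonneg by (auto simp: e'_def field_simps)
  obtain C where C: "C \<ge> 0" "\<And>s t. \<bar>k s - k t\<bar> \<le> C * \<bar>s - t\<bar>" using k unfolding bump_def by blast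
  \<comment> \<open>A majorant, uniform in \<open>t\<close>, for the change of the integrand between
    \<open>s\<close> and \<open>x\<close>; it is continuous at \<open>x\<close> with value
    0.\<close>
  define r where "r s = norm (f s - f x) * supnorm K + norm (f x) * (C * \<bar>s - x\<bar>)" for s
  have "isCont r x"
    unfolding r_def using f by (auto simp: continuous_on_eq_continuous_at intro!: continuous_intros)
  moreover have "r x = 0" by (simp add: r_def)
  ultimately obtain \<delta> where \<delta>: "\<delta> > 0" "\<And>s. \<bar>s - x\<bar> < \<delta> \<Longrightarrow> \<bar>r s\<bar> < e'"
    using e' unfolding continuous_at_eps_delta by (metis diff_zero dist_real_def)
  have unif: "norm (f s * K (t - s) - f x * K (t - x)) \<le> e'" if s: "\<bar>s - x\<bar> < \<delta>" for s t
  proof -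
    have "f s * K (t - s) - f x * K (t - x) = (f s - f x) * K (t - s) + f x * (K (t - s) - K (t - x))"
      by (simp add: algebra_simps)
    also have "norm \<dots> \<le> norm (f s - f x) * norm (K (t - s)) + norm (f x) * norm (K (t - s) - K (t - x))"
      by (metis norm_triangle_ineq norm_mult)
    also have "\<dots> \<le> r s"
      unfolding r_def
    proof (intro add_mono mult_left_mono)
      show "norm (K (t - s)) \<le> supnorm K" by (rule norm_le_supnorm[OF bump_C0[OF k]])
      show "norm (K (t - s) - K (t - x)) \<le> C * \<bar>s - x\<bar>"
        using C(2)[of "t - s" "t - x"] by (simp flip: of_real_diff add: abs_minus_commute)
    qed auto
    finally show ?thesis using \<delta>(2)[OF s] by linarith
  qed
  show "\<exists>\<delta>>0. \<forall>y\<in>{a..b}. norm (y - x) < \<delta> \<longrightarrow>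
      norm (L (partial_conv f a y) - L (partial_conv f a x) - (y - x) *\<^sub>R (f x * G x)) \<le> e * norm (y - x)"
  proof (intro exI[of _ \<delta>] conjI ballI impI)
    fix y assume y: "y \<in> {a..b}" "norm (y - x) < \<delta>"
    define c where "c = of_real (y - x) * f x"
    \<comment> \<open>The error of the linear approximation before \<open>L\<close> is applied; a
      bound uniform in \<open>t\<close> lets the norm bound of \<open>L\<close> finish the
      estimate.\<close>
    define Q where "Q t = partial_conv f a y t - partial_conv f a x t - c * K (t - x)" for t
    have QC: "Q \<in> C0"
      unfolding Q_def by (intro C0_diff C0_cmult partial_conv_C0 f K_translate_C0)
    have "L Q = L (partial_conv f a y) - L (partial_conv f a x) - c * G x"
      unfolding Q_def G_def
      by (subst diff, intro C0_diff partial_conv_C0 f, intro C0_cmult K_translate_C0,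
          subst diff, intro partial_conv_C0 f, intro partial_conv_C0 f, subst cmult, rule K_translate_C0, rule refl)
    then have LQ: "L (partial_conv f a y) - L (partial_conv f a x) - (y - x) *\<^sub>R (f x * G x) = L Q"
      by (simp add: c_def scaleR_conv_of_real mult.assoc)
    have "norm (Q t) \<le> e' * norm (y - x)" for t
    proof -
      define S where "S = {a..b} \<inter> ball x \<delta>"
      \<comment> \<open>For fixed \<open>t\<close> the error is an increment of \<open>q\<close> in
        the endpoint; the mean value inequality bounds it through the derivative, which
        \<open>unif\<close> controls.\<close>
      define q where "q s = partial_conv f a s t - s *\<^sub>R (f x * K (t - x))" for s
      have cf: "continuous_on {a..b} (\<lambda>s. f s * K (t - s))"
        by (rule continuous_on_subset[of UNIV]) (auto intro!: continuous_on_mult f K_continuous)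
      have "norm (q y - q x) \<le> e' * norm (y - x)"
      proof (rule differentiable_bound)
        show "convex S" by (simp add: S_def convex_Int)
        show "(q has_derivative (\<lambda>h. h *\<^sub>R (f s * K (t - s) - f x * K (t - x)))) (at s within S)" if "s \<in> S" for s
        proof -
          have "((\<lambda>u. partial_conv f a u t) has_vector_derivative f s * K (t - s)) (at s within {a..b})"
            unfolding partial_conv_def using integral_has_vector_derivative[OF cf, of s] that by (simp add: S_def)
          then have "((\<lambda>u. partial_conv f a u t) has_vector_derivative f s * K (t - s)) (at s within S)"
            by (rule has_vector_derivative_within_subset) (simp add: S_def)
          then have "(q has_vector_derivative (f s * K (t - s) - 1 *\<^sub>R (f x * K (t - x)))) (at s within S)"
            unfolding q_def
            by (intro has_vector_derivative_diff) (auto intro!: derivative_eq_intros)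
          then show ?thesis by (simp add: has_vector_derivative_def)
        qed
        show "onorm (\<lambda>h. h *\<^sub>R (f s * K (t - s) - f x * K (t - x))) \<le> e'" if "s \<in> S" for s
        proof (rule onorm_le)
          fix h :: real
          have "norm (f s * K (t - s) - f x * K (t - x)) \<le> e'"
            using that by (intro unif) (auto simp: S_def dist_real_def)
          then show "norm (h *\<^sub>R (f s * K (t - s) - f x * K (t - x))) \<le> e' * norm h"
            unfolding norm_scaleR real_norm_def mult.commute[of "\<bar>h\<bar>"] by (rule mult_right_mono) simp
        qed
        show "y \<in> S" "x \<in> S" using y x \<delta>(1) by (auto simp: S_def dist_real_def)
      qed
      moreover have "q y - q x = Q t"
        by (simp add: q_def Q_def c_def scaleR_conv_of_real algebra_simps)
      ultimately show ?thesis by simp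
    qed
    then have "norm (L Q) \<le> M * (e' * norm (y - x))" by (rule bound_le[OF QC])
    also have "\<dots> \<le> e * norm (y - x)"
      using e'(2) by (simp add: mult_right_mono flip: mult.assoc)
    finally show "norm (L (partial_conv f a y) - L (partial_conv f a x) - (y - x) *\<^sub>R (f x * G x)) \<le> e * norm (y - x)"
      unfolding LQ .
  qed (rule \<delta>(1))
qed

lemma L_partial_conv:
  assumes f: "continuous_on UNIV f" and ab: "a \<le> b"
  shows "L (partial_conv f a b) = integral {a..b} (\<lambda>s. f s * G s)"
proof -
  have "((\<lambda>s. f s * G s) has_integral (L (partial_conv f a b) - L (partial_conv f a a))) {a..b}"
    using ab partial_conv_derivative[OF f] by (intro fundamental_theorem_of_calculus) auto
  \<comment> \<open>The product form lets homogeneity with factor 0 yield the value 0 of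
    \<open>L\<close> at the zero function.\<close>
  moreover have "partial_conv f a a = (\<lambda>t. 0 * 0)" by (auto simp: partial_conv_def)
  then have "L (partial_conv f a a) = 0" using cmult[OF C0_zero, of 0] by simp
  ultimately show ?thesis by (simp add: integral_unique)
qed

text \<open>The bound of \<open>L\<close> is tested on the partial convolution of the regularised
  conjugate sign of \<open>G\<close>; its sup norm is at most 1, and \<open>L\<close> of it is
  nearly the integral of \<open>norm (G s)\<close>.\<close>

lemma integral_norm_G_le:
  assumes R: "R \<ge> 0" shows "integral {-R..R} (\<lambda>s. norm (G s)) \<le> M"
proof (rule field_le_epsilon)
  fix e :: real assume e: "e > 0"
  \<comment> \<open>The loss over an interval of length \<open>2 * R\<close> stays within
    \<open>e\<close>; the summand 1 covers \<open>R = 0\<close>.\<close>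
  define \<delta> where "\<delta> = e / (2 * R + 1)"
  have \<delta>: "\<delta> > 0" "2 * R * \<delta> \<le> e" using e R by (auto simp: \<delta>_def field_simps)
  define f where "f s = cnj (G s) /\<^sub>R (norm (G s) + \<delta>)" for s
  have nz: "norm z + \<delta> \<noteq> 0" for z :: complex using \<delta> by (metis add_nonneg_pos norm_ge_zero less_irrefl)
  have f: "continuous_on UNIV f"
    unfolding f_def using G_continuous by (intro continuous_intros) (auto simp: nz)
  have f1: "norm (f s) \<le> 1" for s unfolding f_def by (rule norm_sq_div_ge[OF \<delta>(1)])
  have fG: "f s * G s = of_real ((norm (G s))\<^sup>2 / (norm (G s) + \<delta>))" for s
    unfolding f_def using norm_sq_div_ge(3)[OF \<delta>(1), of "G s"] by (simp add: mult.commute)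
  define w where "w s = (norm (G s))\<^sup>2 / (norm (G s) + \<delta>)" for s
  have wc: "continuous_on {-R..R} w"
    unfolding w_def using continuous_on_subset[OF G_continuous] by (intro continuous_intros) (auto simp: nz)
  have nc: "continuous_on {-R..R} (\<lambda>s. norm (G s))"
    using continuous_on_subset[OF G_continuous] by (intro continuous_intros) auto
  have "integral {-R..R} (\<lambda>s. norm (G s) - \<delta>) \<le> integral {-R..R} w"
  proof (rule integral_le)
    show "(\<lambda>s. norm (G s) - \<delta>) integrable_on {-R..R}" "w integrable_on {-R..R}"
      using wc nc by (auto intro!: integrable_continuous_real continuous_intros)
    show "norm (G s) - \<delta> \<le> w s" for s unfolding w_def by (rule norm_sq_div_ge(1)[OF \<delta>(1)])
  qed
  also have "integral {-R..R} w = Re (integral {-R..R} (\<lambda>s. f s * G s))"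
  proof -
    have "integral {-R..R} (\<lambda>s. complex_of_real (w s)) = complex_of_real (integral {-R..R} w)"
      using has_integral_of_real[OF integrable_integral[OF integrable_continuous_real[OF wc]]] by (rule integral_unique)
    then show ?thesis by (simp add: fG w_def)
  qed
  also have "\<dots> \<le> norm (L (partial_conv f (-R) R))"
    using L_partial_conv[OF f, of "-R" R] R complex_Re_le_cmod by simp
  also have "\<dots> \<le> M * 1"
    by (intro bound_le partial_conv_C0 f norm_partial_conv_le f1)
  finally have "integral {-R..R} (\<lambda>s. norm (G s) - \<delta>) \<le> M" by simp
  moreover have "integral {-R..R} (\<lambda>s. norm (G s) - \<delta>) = integral {-R..R} (\<lambda>s. norm (G s)) - 2 * R * \<delta>"
    using integrable_continuous_real[OF nc] R by (subst Henstock_Kurzweil_Integration.integral_diff) auto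
  ultimately show "integral {-R..R} (\<lambda>s. norm (G s)) \<le> M + e" using \<delta>(2) by simp
qed

lemma G_integrable: "integrable lborel G"
proof -
  have nc: "continuous_on UNIV (\<lambda>s. norm (G s))" by (intro continuous_intros G_continuous)
  have [measurable]: "G \<in> borel_measurable borel" by (rule borel_measurable_continuous_onI[OF G_continuous])
  define I where "I n = (LINT s|lborel. indicator {-real n..real n} s *\<^sub>R norm (G s))" for n
  have Ile: "I n \<le> M" for n
    unfolding I_def using integral_norm_G_le[of "real n"] continuous_Icc_integral(2)[OF nc] by simp
  have mono: "mono (\<lambda>n. indicator {-real n..real n} s *\<^sub>R norm (G s))" for s
    by (rule monoI) (auto simp: indicator_def)
  have "incseq I"
  proof (rule incseq_SucI)
    show "I n \<le> I (Suc n)" for n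
      unfolding I_def by (intro integral_mono continuous_Icc_integral(1) nc monoD[OF mono]) simp
  qed
  then obtain l where l: "I \<longlonglongrightarrow> l" using Ile incseq_convergent[of I M] by metis
  have "integrable lborel (\<lambda>s. norm (G s))"
  proof (rule integrable_monotone_convergence[where f = "\<lambda>n s. indicator {-real n..real n} s *\<^sub>R norm (G s)" and x = l])
    show "integrable lborel (\<lambda>s. indicator {-real n..real n} s *\<^sub>R norm (G s))" for n
      by (rule continuous_Icc_integral(1)[OF nc])
    show "AE s in lborel. mono (\<lambda>n. indicator {-real n..real n} s *\<^sub>R norm (G s))" using mono by simp
    have "(\<lambda>n. indicator {-real n..real n} s *\<^sub>R norm (G s)) \<longlonglongrightarrow> norm (G s)" for s
    proof (rule tendsto_eventually)
      obtain N :: nat where N: "\<bar>s\<bar> \<le> real N" using real_arch_simple by blast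
      show "\<forall>\<^sub>F n in sequentially. indicator {-real n..real n} s *\<^sub>R norm (G s) = norm (G s)"
        using eventually_ge_at_top[of N] by eventually_elim (use N in \<open>auto simp: indicator_def\<close>)
    qed
    then show "AE s in lborel. (\<lambda>n. indicator {-real n..real n} s *\<^sub>R norm (G s)) \<longlonglongrightarrow> norm (G s)" by simp
  qed (use l in \<open>auto simp: I_def[abs_def]\<close>)
  then show ?thesis by (simp add: integrable_norm_iff)
qed

text \<open>Both sides are limits of \<open>L\<close> on partial convolutions over growing
  intervals: these tend to \<open>f \<star> K\<close> uniformly because \<open>f\<close> is small
  far out, and the integrals of \<open>f t * G t\<close> converge by domination.\<close>

lemma L_conv_bump:
  assumes f: "f \<in> C0"
  shows "L (f \<star> K) = (LINT t|lborel. f t * G t)"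
proof -
  have fc: "continuous_on UNIV f" using f by (simp add: C0_def)
  note Ki = bump_integrable[OF k]
  have [measurable]: "f \<in> borel_measurable borel" "G \<in> borel_measurable borel"
    using f G_integrable by (auto intro: C0_measurable integrable_measurable_borel)
  let ?P = "\<lambda>n. partial_conv f (- real n) (real n)"
  have fK: "f \<star> K \<in> C0" by (rule conv_bump_C0[OF f k])
  have "(\<lambda>n. L (?P n)) \<longlonglongrightarrow> L (f \<star> K)"
  proof (rule LIMSEQ_I)
    fix e :: real assume e: "e > 0"
    define e' where "e' = e / (M + 1) / 2"
    have e': "e' > 0" "M * e' < e" using e M_nonneg by (auto simp: e'_def field_simps add_nonneg_pos)
    obtain R where R: "\<And>t. R \<le> \<bar>t\<bar> \<Longrightarrow> norm (f t) < e'" using C0_small[OF f e'(1)] by metis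
    obtain N :: nat where N: "R \<le> real N" using real_arch_simple by blast
    have "norm (L (?P n) - L (f \<star> K)) < e" if n: "n \<ge> N" for n
    proof -
      have "norm (?P n t - (f \<star> K) t) \<le> e'" for t
      proof -
        have c: "continuous_on UNIV (\<lambda>s. f s * K (t - s))" by (intro continuous_intros fc K_continuous)
        have ki: "integrable lborel (\<lambda>s. k (t - s))"
          using k lborel_integrable_real_affine[of k "-1" t] by (simp add: bump_def)
        have i: "integrable lborel (\<lambda>s. f s * K (t - s))" by (rule conv_integrable_swap[OF f Ki])
        note j = continuous_Icc_integral(1)[OF c, of "- real n" "real n"]
        have eq: "?P n t - (f \<star> K) t = (LINT s|lborel. indicator {-real n..real n} s *\<^sub>R (f s * K (t - s)) - f s * K (t - s))"
          unfolding partial_conv_def continuous_Icc_integral(2)[OF c] conv_def conv_commute_integral[where f = f and h = K and t = t]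
          using i j by (intro Bochner_Integration.integral_diff[symmetric])
        have "norm (?P n t - (f \<star> K) t) \<le> (LINT s|lborel. norm (indicator {-real n..real n} s *\<^sub>R (f s * K (t - s)) - f s * K (t - s)))"
          unfolding eq by (rule integral_norm_bound)
        also have "\<dots> \<le> (LINT s|lborel. e' * k (t - s))"
        proof (rule integral_mono)
          show "integrable lborel (\<lambda>s. norm (indicator {-real n..real n} s *\<^sub>R (f s * K (t - s)) - f s * K (t - s)))"
            by (rule integrable_norm[OF Bochner_Integration.integrable_diff[OF j i]])
          show "integrable lborel (\<lambda>s. e' * k (t - s))" using ki by simp
          fix s
          show "norm (indicator {-real n..real n} s *\<^sub>R (f s * K (t - s)) - f s * K (t - s)) \<le> e' * k (t - s)"
          proof (cases "\<bar>s\<bar> \<le> real n")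
            case True
            then show ?thesis using k e'(1) by (auto simp: indicator_def bump_def abs_le_iff)
          next
            case False
            then have "norm (f s) < e'" using n N by (intro R) linarith
            moreover have "indicator {-real n..real n} s = (0::real)" using False by (auto simp: indicator_def)
            ultimately show ?thesis using k by (auto simp: bump_def norm_mult mult_right_mono)
          qed
        qed
        also have "\<dots> = e'"
          using k lborel_integral_real_affine[of "-1" k t] by (simp add: bump_def)
        finally show ?thesis .
      qed
      then have "norm (L (\<lambda>t. ?P n t - (f \<star> K) t)) \<le> M * e'"
        by (intro bound_le C0_diff partial_conv_C0 fc fK)
      then show ?thesis using e'(2) by (simp add: diff[OF partial_conv_C0[OF fc] fK])
    qed
    then show "\<exists>N. \<forall>n\<ge>N. norm (L (?P n) - L (f \<star> K)) < e" by blast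
  qed
  moreover have "(\<lambda>n. L (?P n)) \<longlonglongrightarrow> (LINT t|lborel. f t * G t)"
  proof -
    have c: "continuous_on UNIV (\<lambda>s. f s * G s)" by (intro continuous_intros fc G_continuous)
    have "(\<lambda>n. LINT s|lborel. indicator {-real n..real n} s *\<^sub>R (f s * G s)) \<longlonglongrightarrow> (LINT s|lborel. f s * G s)"
    proof (rule integral_dominated_convergence[where w = "\<lambda>s. supnorm f * norm (G s)"])
      show "integrable lborel (\<lambda>s. supnorm f * norm (G s))" using G_integrable by auto
      have "(\<lambda>n. indicator {-real n..real n} s *\<^sub>R (f s * G s)) \<longlonglongrightarrow> f s * G s" for s
      proof (rule tendsto_eventually)
        obtain N :: nat where N: "\<bar>s\<bar> \<le> real N" using real_arch_simple by blast
        show "\<forall>\<^sub>F n in sequentially. indicator {-real n..real n} s *\<^sub>R (f s * G s) = f s * G s"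
          using eventually_ge_at_top[of N] by eventually_elim (use N in \<open>auto simp: indicator_def\<close>)
      qed
      then show "AE s in lborel. (\<lambda>n. indicator {-real n..real n} s *\<^sub>R (f s * G s)) \<longlonglongrightarrow> f s * G s" by simp
      have "norm (indicator {-real n..real n} s *\<^sub>R (f s * G s)) \<le> supnorm f * norm (G s)" for n s
        using norm_le_supnorm[OF f, of s] supnorm_nonneg[OF f]
        by (auto simp: indicator_def norm_mult mult_right_mono)
      then show "AE s in lborel. norm (indicator {-real n..real n} s *\<^sub>R (f s * G s)) \<le> supnorm f * norm (G s)" for n by simp
    qed auto
    then show ?thesis by (simp add: L_partial_conv[OF fc] continuous_Icc_integral(2)[OF c])
  qed
  ultimately show ?thesis by (rule LIMSEQ_unique)
qed

lemma conv_bump_representable: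
  "\<exists>G. integrable lborel G \<and> (\<forall>f\<in>C0. L (f \<star> K) = (LINT t|lborel. f t * G t))"
  using G_integrable L_conv_bump by blast

end

section \<open>Approximate identities\<close>

lemma conv_pair_integrable:
  fixes k h :: rfun
  assumes k: "integrable lborel k" and h: "integrable lborel h"
  shows "integrable (lborel \<Otimes>\<^sub>M lborel) (\<lambda>(r, s). k (s - r) * h r)"
proof (rule lborel_pair.Fubini_integrable)
  have [measurable]: "k \<in> borel_measurable borel" "h \<in> borel_measurable borel"
    using k h by (auto intro: integrable_measurable_borel)
  show "(\<lambda>(r, s). k (s - r) * h r) \<in> borel_measurable (lborel \<Otimes>\<^sub>M lborel)" by measurable
  have "(LINT s|lborel. norm (k (s - r))) = L1norm k" for r
    using L1norm_translate[of k r] by (simp add: L1norm_def)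
  then have "(\<lambda>r. LINT s|lborel. norm (case (r, s) of (r, s) \<Rightarrow> k (s - r) * h r)) = (\<lambda>r. L1norm k * norm (h r))"
    by (simp add: norm_mult)
  then show "integrable lborel (\<lambda>r. LINT s|lborel. norm (case (r, s) of (r, s) \<Rightarrow> k (s - r) * h r))"
    using h by simp
  show "AE r in lborel. integrable lborel (\<lambda>s. case (r, s) of (r, s) \<Rightarrow> k (s - r) * h r)"
    using lborel_integrable_translate[OF k] by simp
qed

lemma L1_conv_integrable:
  assumes "integrable lborel k" "integrable lborel h"
  shows "integrable lborel (k \<star> h)"
  using lborel_pair.integrable_snd[OF conv_pair_integrable[OF assms]] by (simp add: conv_def[abs_def])

lemma L1norm_conv_le:
  assumes k: "integrable lborel k" and h: "integrable lborel h"
  shows "L1norm (k \<star> h) \<le> L1norm k * L1norm h"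
proof -
  have i: "integrable (lborel \<Otimes>\<^sub>M lborel) (\<lambda>(r, s). norm (k (s - r) * h r))"
    using integrable_norm[OF conv_pair_integrable[OF assms]] by (simp add: case_prod_beta')
  have "L1norm (k \<star> h) \<le> (LINT s|lborel. LINT r|lborel. norm (k (s - r) * h r))"
    unfolding L1norm_def
  proof (rule integral_mono)
    show "integrable lborel (\<lambda>s. norm ((k \<star> h) s))" using L1_conv_integrable[OF assms] by (rule integrable_norm)
    show "integrable lborel (\<lambda>s. LINT r|lborel. norm (k (s - r) * h r))" by (rule lborel_pair.integrable_snd[OF i])
    show "norm ((k \<star> h) s) \<le> (LINT r|lborel. norm (k (s - r) * h r))" for s unfolding conv_def by (rule integral_norm_bound)
  qed
  also have "\<dots> = (LINT r|lborel. LINT s|lborel. norm (k (s - r) * h r))"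
    by (rule lborel_pair.Fubini_integral[OF i])
  also have "\<dots> = (LINT r|lborel. L1norm k * norm (h r))"
    using L1norm_translate[of k] by (simp add: norm_mult L1norm_def)
  also have "\<dots> = L1norm k * L1norm h" by (simp add: L1norm_def)
  finally show ?thesis .
qed

text \<open>One exchange of integrals that serves twice: a reflected \<open>C0\<close> function for
  \<open>g\<close> gives associativity of convolution, a character gives multiplicativity of the
  Fourier transform.\<close>

lemma integral_mult_conv:
  assumes k: "integrable lborel k" and h: "integrable lborel h"
    and g [measurable]: "g \<in> borel_measurable borel" and B: "\<And>t. norm (g t) \<le> B"
  shows "(LINT s|lborel. g s * (k \<star> h) s) = (LINT r|lborel. (LINT s|lborel. g (s + r) * k s) * h r)"
proof -
  have [measurable]: "k \<in> borel_measurable borel" "h \<in> borel_measurable borel"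
    using k h by (auto intro: integrable_measurable_borel)
  have i: "integrable (lborel \<Otimes>\<^sub>M lborel) (\<lambda>(r, s). g s * (k (s - r) * h r))"
  proof (rule Bochner_Integration.integrable_bound)
    show "integrable (lborel \<Otimes>\<^sub>M lborel) (\<lambda>x. B * norm (case x of (r, s) \<Rightarrow> k (s - r) * h r))"
      by (intro integrable_mult_right integrable_norm conv_pair_integrable[OF k h])
    show "(\<lambda>(r, s). g s * (k (s - r) * h r)) \<in> borel_measurable (lborel \<Otimes>\<^sub>M lborel)" by measurable
    have "B \<ge> 0" using B[of 0] norm_ge_zero order_trans by blast
    then have "norm (g s * (k (s - r) * h r)) \<le> norm (B * norm (k (s - r) * h r))" for r s
      using B[of s] mult_right_mono[of "norm (g s)" B "norm (k (s - r) * h r)"] by (simp add: norm_mult)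
    then show "AE x in lborel \<Otimes>\<^sub>M lborel. norm (case x of (r, s) \<Rightarrow> g s * (k (s - r) * h r))
        \<le> norm (B * norm (case x of (r, s) \<Rightarrow> k (s - r) * h r))"
      by (intro AE_I2) auto
  qed
  have "(LINT s|lborel. g s * (k \<star> h) s) = (LINT s|lborel. LINT r|lborel. g s * (k (s - r) * h r))"
    by (simp add: conv_def)
  also have "\<dots> = (LINT r|lborel. LINT s|lborel. g s * (k (s - r) * h r))"
    by (rule lborel_pair.Fubini_integral[OF i])
  also have "\<dots> = (LINT r|lborel. (LINT s|lborel. g (s + r) * k s) * h r)"
  proof (intro Bochner_Integration.integral_cong refl)
    fix r
    have "(LINT s|lborel. g s * (k (s - r) * h r)) = (LINT s|lborel. g s * k (s - r)) * h r"
      by (simp flip: mult.assoc)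
    also have "(LINT s|lborel. g s * k (s - r)) = (LINT s|lborel. g (s + r) * k s)"
      using lborel_integral_translate[of "\<lambda>s. g (s + r) * k s" r] by simp
    finally show "(LINT s|lborel. g s * (k (s - r) * h r)) = (LINT s|lborel. g (s + r) * k s) * h r" .
  qed
  finally show ?thesis .
qed

lemma conv_assoc:
  assumes f: "f \<in> C0" and k: "integrable lborel k" and h: "integrable lborel h"
  shows "f \<star> (k \<star> h) = (f \<star> k) \<star> h"
proof
  fix t
  have "(f \<star> (k \<star> h)) t = (LINT s|lborel. f (t - s) * (k \<star> h) s)" by (simp add: conv_def[of f])
  also have "\<dots> = (LINT r|lborel. (LINT s|lborel. f (t - (s + r)) * k s) * h r)"
    by (rule integral_mult_conv[OF k h C0_reflect_measurable[OF f] norm_le_supnorm[OF f]])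
  also have "\<dots> = ((f \<star> k) \<star> h) t" by (simp add: conv_def algebra_simps)
  finally show "(f \<star> (k \<star> h)) t = ((f \<star> k) \<star> h) t" .
qed

lemma H1_conv:
  assumes k: "integrable lborel k" and h: "h \<in> H1"
  shows "k \<star> h \<in> H1"
proof -
  have hi: "integrable lborel h" by (rule H1_integrable[OF h])
  have "fourier (k \<star> h) u = fourier k u * fourier h u" for u
  proof -
    let ?e = "\<lambda>t. exp (- (\<i> * complex_of_real (t * u)))"
    have "fourier (k \<star> h) u = (LINT s|lborel. ?e s * (k \<star> h) s)" by (simp add: fourier_def mult.commute)
    also have "\<dots> = (LINT r|lborel. (LINT s|lborel. ?e (s + r) * k s) * h r)"
      by (rule integral_mult_conv[OF k hi, of _ 1]) auto
    also have "\<dots> = (LINT r|lborel. fourier k u * (h r * ?e r))"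
    proof (intro Bochner_Integration.integral_cong refl)
      fix r
      have "(LINT s|lborel. ?e (s + r) * k s) = (LINT s|lborel. ?e r * (k s * ?e s))"
        by (intro Bochner_Integration.integral_cong refl) (simp add: algebra_simps exp_diff exp_minus divide_inverse)
      also have "\<dots> = ?e r * fourier k u" by (simp add: fourier_def del: of_real_mult)
      finally show "(LINT s|lborel. ?e (s + r) * k s) * h r = fourier k u * (h r * ?e r)" by (simp add: mult_ac)
    qed
    also have "\<dots> = fourier k u * fourier h u" by (simp add: fourier_def del: of_real_mult)
    finally show ?thesis .
  qed
  then show ?thesis using h L1_conv_integrable[OF k hi] by (simp add: H1_def)
qed

text \<open>Density reduces the claim to a compactly supported \<open>g\<close>, where uniform
  continuity bounds the error pointwise on a slightly larger interval.\<close>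

lemma bump_conv_approx:
  assumes h: "integrable lborel h" and e: "e > 0"
  shows "\<exists>d k. bump d k \<and> L1norm (\<lambda>t. ((\<lambda>t. complex_of_real (k t)) \<star> h) t - h t) < e"
proof -
  have e3: "e / 3 > 0" using e by simp
  obtain g R where g: "continuous_on UNIV g" "R > 0" "\<And>t. R < \<bar>t\<bar> \<Longrightarrow> g t = 0"
    "integrable lborel g" "L1norm (\<lambda>t. h t - g t) < e / 3"
    using continuous_compact_support_dense_L1[OF h e3] by metis
  \<comment> \<open>An error of \<open>e'\<close> on an interval of length
    \<open>2 * (R + 1)\<close> integrates to \<open>e / 3\<close>.\<close>
  define e' where "e' = e / (6 * (R + 1))"
  have e': "e' > 0" using e g(2) by (simp add: e'_def)
  \<comment> \<open>For \<open>t\<close> up to \<open>R + 1\<close> the nearby point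
    \<open>s\<close> may reach \<open>R + 2\<close>, since the width is at most 1.\<close>
  have "uniformly_continuous_on {-(R+2)..R+2} g"
    by (intro compact_uniformly_continuous continuous_on_subset[OF g(1)]) auto
  then obtain \<delta> where \<delta>: "\<delta> > 0" "\<And>s t. s \<in> {-(R+2)..R+2} \<Longrightarrow> t \<in> {-(R+2)..R+2} \<Longrightarrow> \<bar>s - t\<bar> < \<delta> \<Longrightarrow> norm (g s - g t) < e'"
    unfolding uniformly_continuous_on_def dist_norm using e' by (metis real_norm_def)
  define d where "d = min 1 \<delta>"
  have d: "d > 0" "d \<le> 1" "d \<le> \<delta>" using \<delta> by (auto simp: d_def)
  obtain k where k: "bump d k" using bump_exists[OF d(1)] by blast
  let ?K = "\<lambda>t. complex_of_real (k t)"
  note Ki = bump_integrable[OF k]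
  have near: "norm (g s - g t) \<le> e' * indicator {-(R+1)..R+1} t" if st: "\<bar>t - s\<bar> < d" for s t
  proof (cases "\<bar>t\<bar> \<le> R + 1")
    case True
    then have "norm (g s - g t) < e'" using st d by (intro \<delta>(2)) auto
    then show ?thesis using True by (simp add: indicator_def abs_le_iff)
  next
    case False
    then have "g t = 0" "g s = 0" using st d by (auto intro!: g(3))
    then show ?thesis using e' by simp
  qed
  have pw: "norm ((?K \<star> g) t - g t) \<le> e' * indicator {-(R+1)..R+1} t" for t
  proof -
    have Kt: "integrable lborel (\<lambda>s. ?K (t - s))"
      using lborel_integrable_real_affine[OF Ki, of "-1" t] by simp
    have kt: "integrable lborel (\<lambda>s. k (t - s))"
      using k lborel_integrable_real_affine[of k "-1" t] by (simp add: bump_def)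
    have kt1: "(LINT s|lborel. k (t - s)) = 1"
      using k lborel_integral_real_affine[of "-1" k t] by (simp add: bump_def)
    have i1: "integrable lborel (\<lambda>s. ?K (t - s) * g s)" by (rule conv_integrable[OF bump_C0[OF k] g(4)])
    have "(LINT s|lborel. ?K (t - s)) = 1"
      using kt1 by simp
    then have "(?K \<star> g) t - g t = (LINT s|lborel. ?K (t - s) * g s) - (LINT s|lborel. ?K (t - s) * g t)"
      by (simp add: conv_def)
    also have "\<dots> = (LINT s|lborel. ?K (t - s) * g s - ?K (t - s) * g t)"
      using i1 Kt by (intro Bochner_Integration.integral_diff[symmetric]) auto
    finally have eq: "(?K \<star> g) t - g t = (LINT s|lborel. ?K (t - s) * g s - ?K (t - s) * g t)" .
    have "norm ((?K \<star> g) t - g t) \<le> (LINT s|lborel. norm (?K (t - s) * g s - ?K (t - s) * g t))"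
      unfolding eq by (rule integral_norm_bound)
    also have "\<dots> \<le> (LINT s|lborel. k (t - s) * (e' * indicator {-(R+1)..R+1} t))"
    proof (rule integral_mono)
      have "integrable lborel (\<lambda>s. ?K (t - s) * g s - ?K (t - s) * g t)"
        using i1 Kt by (intro Bochner_Integration.integrable_diff) auto
      then show "integrable lborel (\<lambda>s. norm (?K (t - s) * g s - ?K (t - s) * g t))" by (rule integrable_norm)
      show "integrable lborel (\<lambda>s. k (t - s) * (e' * indicator {-(R+1)..R+1} t))"
        using kt by (rule integrable_mult_left)
      fix s
      have k0: "0 \<le> k (t - s)" using k by (simp add: bump_def)
      have "norm (?K (t - s) * g s - ?K (t - s) * g t) = k (t - s) * norm (g s - g t)"
        using k0 by (simp flip: right_diff_distrib add: norm_mult)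
      also have "\<dots> \<le> k (t - s) * (e' * indicator {-(R+1)..R+1} t)"
      proof (cases "\<bar>t - s\<bar> < d")
        case True
        then show ?thesis by (intro mult_left_mono near k0)
      next
        case False
        then show ?thesis using k by (simp add: bump_def)
      qed
      finally show "norm (?K (t - s) * g s - ?K (t - s) * g t) \<le> k (t - s) * (e' * indicator {-(R+1)..R+1} t)" .
    qed
    also have "\<dots> = e' * indicator {-(R+1)..R+1} t" using kt1 by simp
    finally show ?thesis .
  qed
  have Kg: "integrable lborel (?K \<star> g)" by (rule L1_conv_integrable[OF Ki g(4)])
  have "L1norm (\<lambda>t. (?K \<star> g) t - g t) \<le> (LINT t|lborel. e' * indicator {-(R+1)..R+1} t)"
    unfolding L1norm_def
  proof (rule integral_mono)
    show "integrable lborel (\<lambda>t. norm ((?K \<star> g) t - g t))" using Kg g(4) by auto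
    show "integrable lborel (\<lambda>t. e' * indicator {-(R+1)..R+1} t)" using g(2) by simp
  qed (rule pw)
  also have "\<dots> = e / 3" using g(2) by (simp add: e'_def field_simps)
  finally have 1: "L1norm (\<lambda>t. (?K \<star> g) t - g t) \<le> e / 3" .
  have hg: "integrable lborel (\<lambda>t. h t - g t)" using h g(4) by simp
  have 2: "L1norm (?K \<star> (\<lambda>t. h t - g t)) < e / 3"
    using L1norm_conv_le[OF Ki hg] bump_L1norm[OF k] g(5) by simp
  have 3: "L1norm (\<lambda>t. g t - h t) < e / 3" using g(5) by (simp add: L1norm_minus_commute[of g])
  have "?K \<star> h = (\<lambda>t. (?K \<star> (\<lambda>t. h t - g t)) t + (?K \<star> g) t)"
    using conv_add_right[OF bump_C0[OF k] hg g(4)] by simp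
  then have "(\<lambda>t. (?K \<star> h) t - h t) = (\<lambda>t. (?K \<star> (\<lambda>t. h t - g t)) t + (((?K \<star> g) t - g t) + (g t - h t)))"
    by (simp add: fun_eq_iff)
  then have "L1norm (\<lambda>t. (?K \<star> h) t - h t) \<le> L1norm (?K \<star> (\<lambda>t. h t - g t)) + L1norm (\<lambda>t. ((?K \<star> g) t - g t) + (g t - h t))"
    using L1norm_triangle[OF L1_conv_integrable[OF Ki hg], of "\<lambda>t. ((?K \<star> g) t - g t) + (g t - h t)"] Kg g(4) h by simp
  moreover have "L1norm (\<lambda>t. ((?K \<star> g) t - g t) + (g t - h t)) \<le> L1norm (\<lambda>t. (?K \<star> g) t - g t) + L1norm (\<lambda>t. g t - h t)"
    using Kg g(4) h by (intro L1norm_triangle) auto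
  ultimately have "L1norm (\<lambda>t. (?K \<star> h) t - h t) < e" using 1 2 3 by linarith
  with k show ?thesis by blast
qed

lemma AE_summable_norm:
  fixes D :: "nat \<Rightarrow> rfun"
  assumes D: "\<And>n. integrable lborel (D n)" and s: "summable (\<lambda>n. L1norm (D n))"
  shows "AE t in lborel. summable (\<lambda>n. norm (D n t))"
proof -
  have [measurable]: "D n \<in> borel_measurable borel" for n using D by (rule integrable_measurable_borel)
  have "(\<integral>\<^sup>+t. (\<Sum>n. ennreal (norm (D n t))) \<partial>lborel) = (\<Sum>n. \<integral>\<^sup>+t. ennreal (norm (D n t)) \<partial>lborel)"
    by (rule nn_integral_suminf) auto
  also have "\<dots> = (\<Sum>n. ennreal (L1norm (D n)))"
    unfolding L1norm_def using D by (subst nn_integral_eq_integral) auto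
  also have "\<dots> \<noteq> \<infinity>"
    using s by (simp add: ennreal_suminf_neq_top L1norm_nonneg)
  finally have "AE t in lborel. (\<Sum>n. ennreal (norm (D n t))) \<noteq> \<infinity>"
    by (intro nn_integral_PInf_AE) auto
  then show ?thesis
    by eventually_elim (rule summable_suminf_not_top, auto)
qed

text \<open>The limit is \<open>G 0\<close> plus the sum of the increments, which converges almost
  everywhere; integrating this series against \<open>f\<close> termwise and telescoping gives the
  pairings.\<close>

lemma L1_Cauchy_pairing_limit:
  fixes G :: "nat \<Rightarrow> rfun"
  assumes G: "\<And>n. integrable lborel (G n)" and s: "summable (\<lambda>n. L1norm (\<lambda>t. G (Suc n) t - G n t))"
  shows "\<exists>H. integrable lborel H \<and>
    (\<forall>f\<in>C0. (\<lambda>n. LINT t|lborel. f t * G n t) \<longlonglongrightarrow> (LINT t|lborel. f t * H t))"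
proof -
  define D where "D n t = G (Suc n) t - G n t" for n t
  have Di: "integrable lborel (D n)" for n unfolding D_def using G by simp
  have Ds: "summable (\<lambda>n. L1norm (D n))" using s by (simp add: D_def[abs_def])
  note ae = AE_summable_norm[OF Di Ds]
  have Si: "integrable lborel (\<lambda>t. \<Sum>n. D n t)"
    by (rule integrable_suminf[OF Di ae]) (use Ds in \<open>simp add: L1norm_def\<close>)
  show ?thesis
  proof (intro exI[of _ "\<lambda>t. G 0 t + (\<Sum>n. D n t)"] conjI ballI)
    show "integrable lborel (\<lambda>t. G 0 t + (\<Sum>n. D n t))" using G Si by simp
    fix f assume f: "f \<in> C0"
    note fm = C0_measurable[OF f]
    have fG: "integrable lborel (\<lambda>t. f t * k t)" if "integrable lborel k" for k
      by (rule integrable_bounded_mult[OF that fm norm_le_supnorm[OF f]])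
    have fDs: "summable (\<lambda>n. LINT t|lborel. norm (f t * D n t))"
    proof (rule summable_comparison_test[OF _ summable_mult[OF Ds, of "supnorm f"]])
      have "norm (LINT t|lborel. norm (f t * D n t)) \<le> supnorm f * L1norm (D n)" for n
      proof -
        have "norm (LINT t|lborel. norm (f t * D n t)) = (LINT t|lborel. norm (f t * D n t))"
          by (simp add: integral_nonneg_AE)
        also have "\<dots> \<le> (LINT t|lborel. supnorm f * norm (D n t))"
        proof (rule integral_mono)
          show "integrable lborel (\<lambda>t. norm (f t * D n t))" by (rule integrable_norm[OF fG[OF Di]])
          show "integrable lborel (\<lambda>t. supnorm f * norm (D n t))" by (rule integrable_mult_right[OF integrable_norm[OF Di]])
          show "norm (f t * D n t) \<le> supnorm f * norm (D n t)" for t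
            unfolding norm_mult by (intro mult_right_mono norm_le_supnorm f) simp
        qed
        finally show ?thesis by (simp add: L1norm_def)
      qed
      then show "\<exists>N. \<forall>n\<ge>N. norm (LINT t|lborel. norm (f t * D n t)) \<le> supnorm f * L1norm (D n)" by blast
    qed
    have aef: "AE t in lborel. summable (\<lambda>n. norm (f t * D n t))"
      using ae by eventually_elim (simp add: norm_mult summable_mult)
    have "(\<lambda>n. LINT t|lborel. f t * D n t) sums (LINT t|lborel. (\<Sum>n. f t * D n t))"
      by (rule sums_integral[OF fG[OF Di] aef fDs])
    also have "(LINT t|lborel. (\<Sum>n. f t * D n t)) = (LINT t|lborel. f t * (\<Sum>n. D n t))"
    proof (rule integral_cong_AE)
      show "(\<lambda>t. \<Sum>n. f t * D n t) \<in> borel_measurable lborel"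
        using integrable_suminf[OF fG[OF Di] aef fDs] by (rule borel_measurable_integrable)
      show "(\<lambda>t. f t * (\<Sum>n. D n t)) \<in> borel_measurable lborel" using fG[OF Si] by (rule borel_measurable_integrable)
      show "AE t in lborel. (\<Sum>n. f t * D n t) = f t * (\<Sum>n. D n t)"
        using ae by eventually_elim (rule suminf_mult, erule summable_norm_cancel)
    qed
    finally have "(\<lambda>n. \<Sum>i<n. LINT t|lborel. f t * D i t) \<longlonglongrightarrow> (LINT t|lborel. f t * (\<Sum>n. D n t))"
      by (simp add: sums_def)
    then have "(\<lambda>n. (LINT t|lborel. f t * G 0 t) + (\<Sum>i<n. LINT t|lborel. f t * D i t)) \<longlonglongrightarrow>
        (LINT t|lborel. f t * G 0 t) + (LINT t|lborel. f t * (\<Sum>n. D n t))"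
      by (intro tendsto_intros)
    moreover have "(LINT t|lborel. f t * G 0 t) + (\<Sum>i<n. LINT t|lborel. f t * D i t) = (LINT t|lborel. f t * G n t)" for n
      by (induction n) (simp_all add: D_def right_diff_distrib fG G flip: add.assoc)
    moreover have "(LINT t|lborel. f t * G 0 t) + (LINT t|lborel. f t * (\<Sum>n. D n t)) = (LINT t|lborel. f t * (G 0 t + (\<Sum>n. D n t)))"
      using fG[OF G] fG[OF Si] by (simp add: distrib_left)
    ultimately show "(\<lambda>n. LINT t|lborel. f t * G n t) \<longlonglongrightarrow> (LINT t|lborel. f t * (G 0 t + (\<Sum>n. D n t)))"
      by simp
  qed
qed

section \<open>Surjectivity\<close>

text \<open>The character \<open>t \<mapsto> exp (\<i> t u)\<close> is not in \<open>C0\<close>; averaging it over frequencies slightly below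
  \<open>u\<close> makes it decay while keeping the spectrum in \<open>{..u}\<close>.\<close>

definition spectral_window :: "real \<Rightarrow> nat \<Rightarrow> rfun" where
  "spectral_window u n t = (LINT r|lborel. indicator {0..1} r *\<^sub>R exp (\<i> * complex_of_real (t * (u - r / real (Suc n)))))"

lemma spectral_window_bound: "norm (spectral_window u n t) \<le> 1"
proof -
  have "norm (spectral_window u n t) \<le> (LINT r|lborel. norm (indicator {0..1} r *\<^sub>R exp (\<i> * complex_of_real (t * (u - r / real (Suc n))))))"
    unfolding spectral_window_def by (rule integral_norm_bound)
  also have "\<dots> = (LINT r|lborel. indicator {0..1::real} r)"
    by (intro Bochner_Integration.integral_cong refl) (simp add: indicator_def)
  finally show ?thesis by simp
qed

text \<open>Averaging over a frequency interval of length \<open>1 / Suc n\<close> has an explicit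
  primitive with a multiple of \<open>t / Suc n\<close> in the denominator, hence decay like
  \<open>1 / \<bar>t\<bar>\<close> for fixed \<open>n\<close>.\<close>

lemma spectral_window_C0: "spectral_window u n \<in> C0"
proof (rule C0_I)
  let ?E = "\<lambda>t r. exp (\<i> * complex_of_real (t * (u - r / real (Suc n))))"
  have ec: "continuous_on UNIV (?E t)" for t by (intro continuous_intros) auto
  have eq: "spectral_window u n t = integral {0..1} (?E t)" for t
    unfolding spectral_window_def by (rule continuous_Icc_integral(2)[OF ec, symmetric])
  have "continuous_on (UNIV \<times> cbox 0 1) (\<lambda>(t, r). ?E t r)"
    unfolding split_beta by (intro continuous_intros) auto
  from integral_continuous_on_param[OF this] show "continuous_on UNIV (spectral_window u n)"
    by (simp add: eq[abs_def])
  fix e :: real assume e: "e > 0"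
  have small: "norm (spectral_window u n t) \<le> 2 * real (Suc n) / \<bar>t\<bar>" if t: "t \<noteq> 0" for t
  proof -
    define a where "a = - \<i> * complex_of_real (t / real (Suc n))"
    define b where "b = \<i> * complex_of_real (t * u)"
    have a0: "a \<noteq> 0" using t by (simp add: a_def del: of_nat_Suc)
    have E: "?E t r = exp (b + a * complex_of_real r)" for r
      by (simp add: a_def b_def algebra_simps)
    have "(?E t has_integral (exp (b + a * complex_of_real 1) / a - exp (b + a * complex_of_real 0) / a)) {0..1}"
      unfolding E
    proof (rule fundamental_theorem_of_calculus)
      fix r :: real
      have "((\<lambda>z. exp (b + a * z) / a) has_field_derivative exp (b + a * complex_of_real r)) (at (complex_of_real r))"
        using a0 by (auto intro!: derivative_eq_intros)
      then show "((\<lambda>r. exp (b + a * complex_of_real r) / a) has_vector_derivative exp (b + a * complex_of_real r)) (at r within {0..1})"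
        by (rule has_vector_derivative_real_field)
    qed simp
    then have "spectral_window u n t = (exp (b + a) - exp b) / a"
      by (simp add: eq integral_unique diff_divide_distrib)
    moreover have "norm (exp (b + a) - exp b) / norm a \<le> (1 + 1) / norm a"
      by (intro divide_right_mono, rule order_trans[OF norm_triangle_ineq4]) (simp_all add: a_def b_def)
    moreover have "norm a = \<bar>t\<bar> / real (Suc n)" by (simp add: a_def norm_mult norm_divide del: of_nat_Suc)
    ultimately show ?thesis by (simp add: norm_divide del: of_nat_Suc)
  qed
  have "norm (spectral_window u n t) < e" if t: "2 * real (Suc n) / e + 1 \<le> \<bar>t\<bar>" for t
  proof -
    have p: "0 < 2 * real (Suc n) / e" using e by simp
    have t0: "0 < \<bar>t\<bar>" and lt: "2 * real (Suc n) / e < \<bar>t\<bar>" using t p by linarith+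
    have "2 * real (Suc n) / \<bar>t\<bar> < e"
      using lt t0 e by (simp add: field_simps)
    then show ?thesis using small[of t] t0 by fastforce
  qed
  then show "\<exists>R. \<forall>t. R \<le> \<bar>t\<bar> \<longrightarrow> norm (spectral_window u n t) < e" by blast
qed

text \<open>Every frequency in the window is at most \<open>u \<le> 0\<close>, and convolving its
  character with \<open>h\<close> gives a multiple of \<open>fourier h\<close> at that frequency,
  which is 0; Fubini carries this through the average.\<close>

lemma spectral_window_conv:
  assumes h: "h \<in> H1" and u: "u \<le> 0"
  shows "spectral_window u n \<star> h = (\<lambda>t. 0)"
proof
  fix t
  let ?v = "\<lambda>r. u - r / real (Suc n)"
  let ?F = "\<lambda>s r. indicator {0..1} r *\<^sub>R (exp (\<i> * complex_of_real ((t - s) * ?v r)) * h s)"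
  have hi: "integrable lborel h" by (rule H1_integrable[OF h])
  have [measurable]: "h \<in> borel_measurable borel" by (rule integrable_measurable_borel[OF hi])
  have i: "integrable (lborel \<Otimes>\<^sub>M lborel) (case_prod ?F)"
  proof (rule lborel_pair.Fubini_integrable)
    show "case_prod ?F \<in> borel_measurable (lborel \<Otimes>\<^sub>M lborel)" by measurable
    have "(LINT r|lborel. norm (case (s, r) of (s, r) \<Rightarrow> ?F s r)) = norm (h s)" for s
    proof -
      have "(LINT r|lborel. norm (case (s, r) of (s, r) \<Rightarrow> ?F s r)) = (LINT r|lborel. indicator {0..1::real} r * norm (h s))"
        by (intro Bochner_Integration.integral_cong refl) (simp add: indicator_def norm_mult)
      then show ?thesis by simp
    qed
    then show "integrable lborel (\<lambda>s. LINT r|lborel. norm (case (s, r) of (s, r) \<Rightarrow> ?F s r))" using hi by simp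
    have "continuous_on UNIV (\<lambda>r. exp (\<i> * complex_of_real ((t - s) * ?v r)) * h s)" for s
      by (intro continuous_intros) auto
    from continuous_Icc_integral(1)[OF this]
    show "AE s in lborel. integrable lborel (\<lambda>r. case (s, r) of (s, r) \<Rightarrow> ?F s r)" by simp
  qed
  have "(spectral_window u n \<star> h) t = (LINT s|lborel. LINT r|lborel. ?F s r)"
    unfolding conv_def spectral_window_def by (simp flip: integral_mult_left_zero add: mult_scaleR_left)
  also have "\<dots> = (LINT r|lborel. LINT s|lborel. ?F s r)"
    by (rule lborel_pair.Fubini_integral[OF i, symmetric])
  also have "\<dots> = (LINT r|(lborel :: real measure). 0)"
  proof (intro Bochner_Integration.integral_cong refl)
    fix r :: real
    show "(LINT s|lborel. ?F s r) = 0"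
    proof (cases "r \<in> {0..1}")
      case True
      then have "0 \<le> r / real (Suc n)" by (intro divide_nonneg_nonneg) auto
      then have "?v r \<le> 0" using u by linarith
      then have f0: "fourier h (?v r) = 0" using h by (simp add: H1_def)
      have E: "exp (\<i> * complex_of_real ((t - s) * v)) = exp (\<i> * complex_of_real (t * v)) * exp (- (\<i> * complex_of_real (s * v)))" for s v
        by (simp add: left_diff_distrib right_diff_distrib exp_diff exp_minus divide_inverse)
      have "(LINT s|lborel. ?F s r) = (LINT s|lborel. exp (\<i> * complex_of_real (t * ?v r)) * (h s * exp (- (\<i> * complex_of_real (s * ?v r)))))"
        unfolding E using True by (intro Bochner_Integration.integral_cong refl) (simp add: mult_ac)
      also have "\<dots> = exp (\<i> * complex_of_real (t * ?v r)) * fourier h (?v r)"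
        by (simp add: fourier_def del: of_real_mult of_real_diff)
      finally show ?thesis unfolding f0 by simp
    qed simp
  qed
  finally show "(spectral_window u n \<star> h) t = 0" by simp
qed

text \<open>The shrinking window recovers the character at \<open>u\<close>; with the uniform bound
  1 this permits passing to the limit against integrable functions.\<close>

lemma spectral_window_tendsto:
  "(\<lambda>n. spectral_window u n t) \<longlonglongrightarrow> exp (\<i> * complex_of_real (t * u))"
proof -
  have "(\<lambda>n. spectral_window u n t) \<longlonglongrightarrow> (LINT r|lborel. indicator {0..1::real} r *\<^sub>R exp (\<i> * complex_of_real (t * (u - 0))))"
    unfolding spectral_window_def
  proof (rule integral_dominated_convergence[where w = "\<lambda>r. indicator {0..1} r"])
    have "(\<lambda>n. indicator {0..1} r *\<^sub>R exp (\<i> * complex_of_real (t * (u - r / real (Suc n))))) \<longlonglongrightarrow>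
      indicator {0..1} r *\<^sub>R exp (\<i> * complex_of_real (t * (u - 0)))" for r
      by (intro tendsto_intros LIMSEQ_Suc[OF lim_const_over_n])
    then show "AE r in lborel. (\<lambda>n. indicator {0..1} r *\<^sub>R exp (\<i> * complex_of_real (t * (u - r / real (Suc n))))) \<longlonglongrightarrow>
      indicator {0..1} r *\<^sub>R exp (\<i> * complex_of_real (t * (u - 0)))" by simp
    show "AE r in lborel. norm (indicator {0..1} r *\<^sub>R exp (\<i> * complex_of_real (t * (u - r / real (Suc n))))) \<le> indicator {0..1::real} r" for n
      by (intro AE_I2) (simp add: indicator_def)
  qed auto
  then show ?thesis by simp
qed

text \<open>The windows convolve with \<open>h\<close> to 0, so their pairings with \<open>g\<close>
  vanish; in the limit the reflected argument turns the character into the kernel of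
  \<open>fourier g u\<close>.\<close>

lemma representing_function_H1:
  assumes \<phi>: "\<phi> \<in> A0dual" and h: "h \<in> H1" and g: "integrable lborel g"
    and rep: "\<And>f. f \<in> C0 \<Longrightarrow> \<phi> (f \<star> h) = (LINT t|lborel. g t * f (- t))"
  shows "g \<in> H1"
proof -
  have "fourier g u = 0" if u: "u \<le> 0" for u
  proof -
    have [measurable]: "g \<in> borel_measurable borel" by (rule integrable_measurable_borel[OF g])
    have "(\<lambda>n. LINT t|lborel. g t * spectral_window u n (- t)) \<longlonglongrightarrow> (LINT t|lborel. g t * exp (\<i> * complex_of_real (- t * u)))"
    proof (rule integral_dominated_convergence[where w = "\<lambda>t. norm (g t)"])
      show "(\<lambda>t. g t * spectral_window u n (- t)) \<in> borel_measurable lborel" for n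
        using reflected_pairing_integrable[OF g spectral_window_C0] by (rule borel_measurable_integrable)
      show "AE t in lborel. (\<lambda>n. g t * spectral_window u n (- t)) \<longlonglongrightarrow> g t * exp (\<i> * complex_of_real (- t * u))"
        by (intro AE_I2 tendsto_intros spectral_window_tendsto)
      show "AE t in lborel. norm (g t * spectral_window u n (- t)) \<le> norm (g t)" for n
        unfolding norm_mult by (intro AE_I2 mult_left_le spectral_window_bound) simp
    qed (use g in auto)
    moreover have "(LINT t|lborel. g t * spectral_window u n (- t)) = 0" for n
    proof -
      have "(\<lambda>t. 0) \<in> A0" using conv_in_A0[OF C0_zero H1_zero] by (simp add: conv_zero_left)
      from A0dual_cmult[OF \<phi> this, of 0] have "\<phi> (\<lambda>t. 0) = 0" by simp
      then show ?thesis using rep[OF spectral_window_C0[of u n]] spectral_window_conv[OF h u] by simp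
    qed
    ultimately have "(LINT t|lborel. g t * exp (\<i> * complex_of_real (- t * u))) = 0"
      by (simp add: LIMSEQ_const_iff)
    then show ?thesis by (simp add: fourier_def)
  qed
  then show ?thesis using g by (simp add: H1_def)
qed

lemma A0dual_C0_functional:
  assumes \<phi>: "\<phi> \<in> A0dual" and C: "C \<ge> 0" "\<And>F. F \<in> A0 \<Longrightarrow> norm (\<phi> F) \<le> C * A0norm F" and h: "h \<in> H1"
  shows "C0_functional (\<lambda>f. \<phi> (f \<star> h)) (C * L1norm h)"
proof
  show "0 \<le> C * L1norm h" using C(1) L1norm_nonneg by simp
  show "\<phi> ((\<lambda>t. f t + g t) \<star> h) = \<phi> (f \<star> h) + \<phi> (g \<star> h)" if "f \<in> C0" "g \<in> C0" for f g
    using A0dual_add[OF \<phi> conv_in_A0[OF that(1) h] conv_in_A0[OF that(2) h]]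
    by (simp add: conv_add_left[OF that H1_integrable[OF h]])
  show "\<phi> ((\<lambda>t. c * f t) \<star> h) = c * \<phi> (f \<star> h)" if "f \<in> C0" for f c
    using A0dual_cmult[OF \<phi> conv_in_A0[OF that h]] by (simp add: conv_cmult_left)
  show "norm (\<phi> (f \<star> h)) \<le> C * L1norm h * supnorm f" if "f \<in> C0" for f
    using C(2)[OF conv_in_A0[OF that h]] mult_left_mono[OF A0norm_conv_le[OF that h] C(1)] by (simp add: mult_ac)
qed

lemma A0dual_conv_diff:
  assumes \<phi>: "\<phi> \<in> A0dual" and C: "C \<ge> 0" "\<And>F. F \<in> A0 \<Longrightarrow> norm (\<phi> F) \<le> C * A0norm F"
    and g: "g \<in> H1" and h: "h \<in> H1" and f: "f \<in> C0"
  shows "norm (\<phi> (f \<star> g) - \<phi> (f \<star> h)) \<le> C * (supnorm f * L1norm (\<lambda>t. g t - h t))"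
proof -
  have gh: "(\<lambda>t. g t - h t) \<in> H1" using H1_add[OF g H1_cmult[OF h, of "-1"]] by simp
  have "f \<star> g = (\<lambda>t. (f \<star> (\<lambda>t. g t - h t)) t + (f \<star> h) t)"
    using conv_add_right[OF f H1_integrable[OF gh] H1_integrable[OF h]] by simp
  then have "\<phi> (f \<star> g) - \<phi> (f \<star> h) = \<phi> (f \<star> (\<lambda>t. g t - h t))"
    using A0dual_add[OF \<phi> conv_in_A0[OF f gh] conv_in_A0[OF f h]] by simp
  then show ?thesis
    using C(2)[OF conv_in_A0[OF f gh]] mult_left_mono[OF A0norm_conv_le[OF f gh] C(1)] by simp
qed

lemma A0dual_representing_function:
  assumes \<phi>: "\<phi> \<in> A0dual" and h: "h \<in> H1"
  shows "\<exists>g\<in>H1. \<forall>f\<in>C0. \<phi> (f \<star> h) = (LINT t|lborel. g t * f (- t))"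
proof -
  obtain C where C: "C \<ge> 0" "\<And>F. F \<in> A0 \<Longrightarrow> norm (\<phi> F) \<le> C * A0norm F"
    using A0dual_bound[OF \<phi>] by blast
  have hi: "integrable lborel h" by (rule H1_integrable[OF h])
  \<comment> \<open>The geometric rate of the smoothed functions \<open>w\<close> is what makes the
    increments of the densities summable.\<close>
  have "\<exists>w G. w \<in> H1 \<and> L1norm (\<lambda>t. w t - h t) < (1 / 2) ^ n \<and> integrable lborel G \<and>
     (\<forall>f\<in>C0. \<phi> (f \<star> w) = (LINT t|lborel. f t * G t))" for n :: nat
  proof -
    obtain d k where k: "bump d k" and le: "L1norm (\<lambda>t. ((\<lambda>t. complex_of_real (k t)) \<star> h) t - h t) < (1 / 2) ^ n"
      using bump_conv_approx[OF hi, of "(1 / 2) ^ n"] by auto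
    let ?K = "\<lambda>t. complex_of_real (k t)"
    interpret C0_functional_bump "\<lambda>f. \<phi> (f \<star> h)" "C * L1norm h" d k
      using A0dual_C0_functional[OF \<phi> C h] k by (simp add: C0_functional_bump_def C0_functional_bump_axioms_def)
    obtain G where G: "integrable lborel G" "\<And>f. f \<in> C0 \<Longrightarrow> \<phi> (f \<star> ?K \<star> h) = (LINT t|lborel. f t * G t)"
      using conv_bump_representable by blast
    have "?K \<star> h \<in> H1" by (rule H1_conv[OF bump_integrable[OF k] h])
    moreover have "\<phi> (f \<star> (?K \<star> h)) = (LINT t|lborel. f t * G t)" if "f \<in> C0" for f
      using G(2)[OF that] conv_assoc[OF that bump_integrable[OF k] hi] by simp
    ultimately show ?thesis using le G(1) by blast
  qed
  then obtain w G where w: "\<And>n. w n \<in> H1" "\<And>n. L1norm (\<lambda>t. w n t - h t) < (1 / 2) ^ n"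
    and G: "\<And>n. integrable lborel (G n)" "\<And>n f. f \<in> C0 \<Longrightarrow> \<phi> (f \<star> w n) = (LINT t|lborel. f t * G n t)"
    by metis
  have close: "norm ((LINT t|lborel. f t * G n t) - \<phi> (f \<star> h)) \<le> C * (supnorm f * (1 / 2) ^ n)" if f: "f \<in> C0" for f n
  proof -
    have "norm (\<phi> (f \<star> w n) - \<phi> (f \<star> h)) \<le> C * (supnorm f * L1norm (\<lambda>t. w n t - h t))"
      by (rule A0dual_conv_diff[OF \<phi> C w(1) h f])
    also have "\<dots> \<le> C * (supnorm f * (1 / 2) ^ n)"
      using w(2)[of n] by (intro mult_left_mono C(1) supnorm_nonneg f) simp
    finally show ?thesis using G(2)[OF f] by simp
  qed
  \<comment> \<open>Duality converts closeness of functionals into closeness of densities: both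
    pairings lie within a geometric error of \<open>\<phi> (f \<star> h)\<close>, uniformly over
    \<open>f\<close> bounded by 1.\<close>
  have "L1norm (\<lambda>t. G (Suc n) t - G n t) \<le> 2 * C * (1 / 2) ^ n" for n
  proof (rule L1norm_le_pairing)
    show "integrable lborel (\<lambda>t. G (Suc n) t - G n t)" using G(1) by simp
    fix f assume f: "f \<in> C0" "\<And>t. norm (f t) \<le> 1"
    have fG: "integrable lborel (\<lambda>t. f t * G m t)" for m
      by (rule integrable_bounded_mult[OF G(1) C0_measurable[OF f(1)] f(2)])
    have c: "norm ((LINT t|lborel. f t * G m t) - \<phi> (f \<star> h)) \<le> C * (1 / 2) ^ m" for m
    proof -
      have "supnorm f * (1 / 2) ^ m \<le> 1 * (1 / 2) ^ m" by (intro mult_right_mono supnorm_le f) simp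
      from mult_left_mono[OF this C(1)] show ?thesis using close[OF f(1), of m] by simp
    qed
    have "(LINT t|lborel. f t * (G (Suc n) t - G n t)) =
        ((LINT t|lborel. f t * G (Suc n) t) - \<phi> (f \<star> h)) - ((LINT t|lborel. f t * G n t) - \<phi> (f \<star> h))"
      using fG by (simp add: right_diff_distrib)
    then have "norm (LINT t|lborel. f t * (G (Suc n) t - G n t)) \<le> C * (1 / 2) ^ Suc n + C * (1 / 2) ^ n"
      using norm_triangle_le_diff[OF add_mono[OF c[of "Suc n"] c[of n]]] by simp
    also have "\<dots> \<le> 2 * C * (1 / 2) ^ n" using C(1) by simp
    finally show "norm (LINT t|lborel. f t * (G (Suc n) t - G n t)) \<le> 2 * C * (1 / 2) ^ n" .
  qed
  then have sm: "summable (\<lambda>n. L1norm (\<lambda>t. G (Suc n) t - G n t))"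
    by (intro summable_comparison_test[OF _ summable_mult[OF summable_geometric[of "1 / 2 :: real"], of "2 * C"]])
       (auto simp: L1norm_nonneg)
  obtain H where H: "integrable lborel H"
    "\<And>f. f \<in> C0 \<Longrightarrow> (\<lambda>n. LINT t|lborel. f t * G n t) \<longlonglongrightarrow> (LINT t|lborel. f t * H t)"
    using L1_Cauchy_pairing_limit[OF G(1) sm] by blast
  have eq: "\<phi> (f \<star> h) = (LINT t|lborel. f t * H t)" if f: "f \<in> C0" for f
  proof (rule LIMSEQ_unique[OF _ H(2)[OF f]])
    have "(\<lambda>n. C * (supnorm f * (1 / 2) ^ n)) \<longlonglongrightarrow> C * (supnorm f * 0)"
      by (intro tendsto_intros LIMSEQ_power_zero) simp
    then have "(\<lambda>n. C * (supnorm f * (1 / 2) ^ n)) \<longlonglongrightarrow> 0" by simp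
    then have "(\<lambda>n. (LINT t|lborel. f t * G n t) - \<phi> (f \<star> h)) \<longlonglongrightarrow> 0"
      by (rule Lim_null_comparison[OF always_eventually[OF allI[OF close[OF f]]]])
    then show "(\<lambda>n. LINT t|lborel. f t * G n t) \<longlonglongrightarrow> \<phi> (f \<star> h)" by (simp add: LIM_zero_iff)
  qed
  \<comment> \<open>\<open>H\<close> pairs with \<open>f t\<close>, whereas the theorem pairs with
    \<open>f (- t)\<close>.\<close>
  define g where "g t = H (- t)" for t
  have gi: "integrable lborel g"
    unfolding g_def using lborel_integrable_real_affine[OF H(1), of "-1" 0] by simp
  have rep: "\<phi> (f \<star> h) = (LINT t|lborel. g t * f (- t))" if f: "f \<in> C0" for f
    unfolding eq[OF f] g_def
    using lborel_integral_real_affine[of "-1" "\<lambda>t. f t * H t" 0] by (simp add: mult.commute)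
  show ?thesis
    using representing_function_H1[OF \<phi> h gi rep] rep by blast
qed

text \<open>The representing functions are chosen separately for each \<open>h\<close>. Linearity
  and compatibility with null sets follow because pairings with \<open>C0\<close> determine them
  almost everywhere, and the bound follows by duality.\<close>

lemma A0dual_op:
  assumes \<phi>: "\<phi> \<in> A0dual"
  obtains T where "T \<in> Bop" "\<And>f h. f \<in> C0 \<Longrightarrow> h \<in> H1 \<Longrightarrow> \<phi> (f \<star> h) = op_pair T h f"
proof -
  obtain C where C: "C \<ge> 0" "\<And>F. F \<in> A0 \<Longrightarrow> norm (\<phi> F) \<le> C * A0norm F"
    using A0dual_bound[OF \<phi>] by blast
  define T where "T h = (SOME g. g \<in> H1 \<and> (\<forall>f\<in>C0. \<phi> (f \<star> h) = (LINT t|lborel. g t * f (- t))))" for h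
  have "T h \<in> H1 \<and> (\<forall>f\<in>C0. \<phi> (f \<star> h) = op_pair T h f)" if "h \<in> H1" for h
    using A0dual_representing_function[OF \<phi> that] unfolding T_def by (intro someI_ex[of "\<lambda>g. g \<in> H1 \<and> (\<forall>f\<in>C0. \<phi> (f \<star> h) = (LINT t|lborel. g t * f (- t)))"]) blast
  then have TH: "\<And>h. h \<in> H1 \<Longrightarrow> T h \<in> H1" and rep: "\<And>f h. f \<in> C0 \<Longrightarrow> h \<in> H1 \<Longrightarrow> op_pair T h f = \<phi> (f \<star> h)"
    by auto
  note Ti = H1_integrable[OF TH]
  have "T \<in> Bop"
    unfolding Bop_def
  proof (intro CollectI conjI ballI impI allI)
    fix g h assume g: "g \<in> H1" and h: "h \<in> H1"
    show "aeeq (T g) (T h)" if "aeeq g h"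
      using conv_cong_AE[OF that H1_integrable[OF g] H1_integrable[OF h]]
      by (simp add: aeeq_iff_reflected_pairing Ti g h rep)
    have gh: "(\<lambda>t. g t + h t) \<in> H1" by (rule H1_add[OF g h])
    show "aeeq (T (\<lambda>t. g t + h t)) (\<lambda>t. T g t + T h t)"
    proof (subst aeeq_iff_reflected_pairing)
      show "\<forall>f\<in>C0. op_pair T (\<lambda>t. g t + h t) f = (LINT t|lborel. (T g t + T h t) * f (- t))"
      proof
        fix f assume f: "f \<in> C0"
        have "op_pair T (\<lambda>t. g t + h t) f = op_pair T g f + op_pair T h f"
          using A0dual_add[OF \<phi> conv_in_A0[OF f g] conv_in_A0[OF f h]]
          by (simp add: rep f g h gh conv_add_right H1_integrable)
        then show "op_pair T (\<lambda>t. g t + h t) f = (LINT t|lborel. (T g t + T h t) * f (- t))"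
          by (simp add: distrib_right reflected_pairing_integrable Ti g h f)
      qed
    qed (use Ti g h gh in auto)
  next
    fix h and c :: complex assume h: "h \<in> H1"
    have ch: "(\<lambda>t. c * h t) \<in> H1" by (rule H1_cmult[OF h])
    show "aeeq (T (\<lambda>t. c * h t)) (\<lambda>t. c * T h t)"
    proof (subst aeeq_iff_reflected_pairing)
      show "\<forall>f\<in>C0. op_pair T (\<lambda>t. c * h t) f = (LINT t|lborel. (c * T h t) * f (- t))"
      proof
        fix f assume f: "f \<in> C0"
        have "op_pair T (\<lambda>t. c * h t) f = c * op_pair T h f"
          using A0dual_cmult[OF \<phi> conv_in_A0[OF f h]] by (simp add: rep f h ch conv_cmult_right)
        then show "op_pair T (\<lambda>t. c * h t) f = (LINT t|lborel. (c * T h t) * f (- t))"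
          by (simp add: mult.assoc)
      qed
    qed (use Ti h ch in auto)
  next
    have "L1norm (T h) \<le> C * L1norm h" if h: "h \<in> H1" for h
    proof (rule L1norm_le_reflected_pairing[OF Ti[OF h]])
      fix f assume f: "f \<in> C0" "\<And>t. norm (f t) \<le> 1"
      have "norm (op_pair T h f) \<le> C * A0norm (f \<star> h)"
        using C(2)[OF conv_in_A0[OF f(1) h]] by (simp add: rep f h)
      also have "\<dots> \<le> C * (supnorm f * L1norm h)"
        by (intro mult_left_mono A0norm_conv_le f h C(1))
      also have "\<dots> \<le> C * (1 * L1norm h)"
        by (intro mult_left_mono mult_right_mono supnorm_le f C(1) L1norm_nonneg)
      finally show "norm (op_pair T h f) \<le> C * L1norm h" by simp
    qed
    then show "\<exists>C. \<forall>h\<in>H1. L1norm (T h) \<le> C * L1norm h" by blast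
  qed (use TH in auto)
  then show thesis using rep by (intro that[of T]) auto
qed

text \<open>The operator built from \<open>\<phi>\<close> kills representations of 0, since
  \<open>\<phi>\<close> may be summed termwise along them and gives its value at the zero function.
  So it lies in \<open>PM\<close>, and its functional agrees with \<open>\<phi>\<close> on
  convolutions.\<close>

lemma eta_op_surj: "eta_op ` PM = A0dual"
proof
  show "eta_op ` PM \<subseteq> A0dual" using PM_imp_annihilates eta_op_A0dual by blast
  show "A0dual \<subseteq> eta_op ` PM"
  proof
    fix \<phi> assume \<phi>: "\<phi> \<in> A0dual"
    obtain T where T: "T \<in> Bop" "\<And>f h. f \<in> C0 \<Longrightarrow> h \<in> H1 \<Longrightarrow> \<phi> (f \<star> h) = op_pair T h f"
      using A0dual_op[OF \<phi>] by metis
    have "wpair T (f, h) = 0" if r: "A0_rep (\<lambda>t. 0) f h" for f h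
    proof -
      have "(\<lambda>t. 0) \<in> A0" using A0_rep_imp_A0[OF r] .
      from A0dual_cmult[OF \<phi> this, of 0] have "\<phi> (\<lambda>t. 0) = 0" by simp
      moreover have "\<phi> (f k \<star> h k) = op_pair T (h k) (f k)" for k
        using r by (intro T) (auto simp: A0_rep_def)
      ultimately show ?thesis
        using A0dual_rep_sums[OF \<phi> r] wpair_sums[OF T(1), of f h] r by (simp add: A0_rep_iff sums_unique2)
    qed
    then have an: "annihilates T" using T(1) by (simp add: annihilates_def)
    have "eta_op T = \<phi>"
      using eta_op_A0dual[OF an] \<phi> by (rule A0dual_eqI) (simp add: eta_op_conv[OF an] T)
    then show "\<phi> \<in> eta_op ` PM" using annihilates_imp_PM[OF an] by blast
  qed
qed

text \<open>On \<open>PM\<close> the description by \<open>THE\<close> coincides with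
  \<open>eta_op\<close>, so the clauses transfer; for sums and multiples the representing functional
  is exhibited directly.\<close>

theorem mainTheorem6:
  shows "(\<forall>T\<in>PM. \<exists>!\<eta>. \<eta> \<in> A0dual \<and>
            (\<forall>f\<in>C0. \<forall>h\<in>H1. \<eta> (f \<star> h) = (LINT t|lborel. T h t * f (- t))))
     \<and> (let eta = (\<lambda>T. THE \<eta>. \<eta> \<in> A0dual \<and>
            (\<forall>f\<in>C0. \<forall>h\<in>H1. \<eta> (f \<star> h) = (LINT t|lborel. T h t * f (- t))))
        in (\<forall>T\<in>PM. \<forall>S\<in>PM. eta (\<lambda>h t. T h t + S h t) = (\<lambda>F. eta T F + eta S F))
         \<and> (\<forall>T\<in>PM. \<forall>c. eta (\<lambda>h t. c * T h t) = (\<lambda>F. c * eta T F))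
         \<and> (\<forall>T\<in>PM. dualnorm (eta T) = opnorm T)
         \<and> (\<forall>T\<in>PM. \<forall>S\<in>PM. eta T = eta S \<longleftrightarrow> op_eq T S)
         \<and> eta ` PM = A0dual
         \<and> continuous_map (subtopology wstarB PM) wstarA eta
         \<and> open_map (subtopology wstarB PM) wstarA eta)"
  unfolding represents_def[symmetric] Let_def
proof (intro conjI ballI allI)
  define eta where "eta = (\<lambda>T. THE \<eta>. represents \<eta> T)"
  have eta: "eta T = eta_op T" if "T \<in> PM" for T
    unfolding eta_def by (rule the_represents[OF eta_op_represents[OF that]])
  have sub: "PM \<subseteq> Bop" using PM_imp_annihilates annihilates_Bop by blast
  show "\<exists>!\<eta>. represents \<eta> T" if "T \<in> PM" for T
    using eta_op_represents[OF that] represents_unique by blast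
  fix T assume T: "T \<in> PM"
  show "dualnorm (THE \<eta>. represents \<eta> T) = opnorm T"
    using eta[OF T] dualnorm_eta_op[OF T] by (simp add: eta_def)
  show "(THE \<eta>. represents \<eta> (\<lambda>h t. c * T h t)) = (\<lambda>F. c * (THE \<eta>. represents \<eta> T) F)" for c
    unfolding the_represents[OF eta_op_represents[OF T]]
    by (rule the_represents[OF represents_cmult[OF eta_op_represents[OF T]]])
  fix S assume S: "S \<in> PM"
  show "(THE \<eta>. represents \<eta> (\<lambda>h t. T h t + S h t)) = (\<lambda>F. (THE \<eta>. represents \<eta> T) F + (THE \<eta>. represents \<eta> S) F)"
    unfolding the_represents[OF eta_op_represents[OF T]] the_represents[OF eta_op_represents[OF S]]
    using sub T S by (intro the_represents represents_add eta_op_represents) auto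
  show "((THE \<eta>. represents \<eta> T) = (THE \<eta>. represents \<eta> S)) = op_eq T S"
    using eta[OF T] eta[OF S] eta_op_eq_iff[OF T S] by (simp add: eta_def)
next
  define eta where "eta = (\<lambda>T. THE \<eta>. represents \<eta> T)"
  have eta: "eta T = eta_op T" if "T \<in> PM" for T
    unfolding eta_def by (rule the_represents[OF eta_op_represents[OF that]])
  have ts: "topspace (subtopology wstarB PM) = PM"
    using PM_imp_annihilates annihilates_Bop by (auto simp: topspace_wstarB)
  have "eta ` PM = A0dual" using eta eta_op_surj by (metis image_cong)
  moreover have "continuous_map (subtopology wstarB PM) wstarA eta"
    using continuous_map_eq[OF continuous_map_eta_op] eta ts by metis
  moreover have "open_map (subtopology wstarB PM) wstarA eta"
    by (rule open_map_eq[OF open_map_eta_op[OF eta_op_surj]]) (simp add: ts eta)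
  ultimately show "(\<lambda>T. THE \<eta>. represents \<eta> T) ` PM = A0dual"
    "continuous_map (subtopology wstarB PM) wstarA (\<lambda>T. THE \<eta>. represents \<eta> T)"
    "open_map (subtopology wstarB PM) wstarA (\<lambda>T. THE \<eta>. represents \<eta> T)"
    unfolding eta_def by auto
qed

end
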